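(* Let $F$ be a distribution function with $F(0^-)=0$ such that $F(0)=F(\delta)=p$ for some $\delta>0$ and some $p\in[1/2,1)$, and such that $\int x^\eta\,\mathrm{d}F(x)<\infty$ for some $\eta>4$. Let $(\tau_e)_{e\in\mathbb{E}^2}$ be i.i.d. with distribution function $F$. Given $k_1>0$, $K_2\in[1,\infty)$, and $k_3:[0,\infty)\to(0,\infty)$, there exist $c,C>0$ such that the following holds. For any $f:[0,\infty)\to[0,\infty)$ with $f(0)=0$ and any sequence of integers $0=r_0<r_1<r_2<\cdots$ satisfying assumptions A1, A2, A3 (stated in the context) for $k_1,K_2,k_3$, we have, as $n\to\infty$, $$c\,\iota(n)\lesssim\mathrm{Var}\,T_f(0,P(n))\lesssim C\,\iota(n)$$ and $$c\,\mathbb{E}T_f(0,P(n))\lesssim\mathrm{Var}\,T_f(0,P(n))\lesssim C\,\mathbb{E}T_f(0,P(n)),$$ where $\iota(n)=\min\{i: r_{2i}\ge n\}$.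
   Context: $\mathbb{E}^2$ is the set of nearest-neighbor edges of $\mathbb{Z}^2$. For $f:[0,\infty)\to[0,\infty)$ with $f(0)=0$, the graph $\mathbb{G}_f=(\mathbb{V}_f,\mathbb{E}_f)$ has $\mathbb{V}_f=\{(x_1,x_2)\in\mathbb{Z}^2:x_1\ge0,\ 0\le x_2\le f(x_1)\}$ and $\mathbb{E}_f$ the set of all nearest-neighbor edges between vertices of $\mathbb{V}_f$. For a path $\gamma$ in $\mathbb{G}_f$, $T_f(\gamma)$ is the sum of $\tau_e$ over the edges $e$ of $\gamma$; $T_f(x,y)=\inf_{\gamma:x\to y}T_f(\gamma)$ over paths in $\mathbb{G}_f$; $T_f(x,S)=\inf_{y\in S\cap\mathbb{V}_f}T_f(x,y)$ and $T_f(S,S')=\inf_{x\in S\cap\mathbb{V}_f}T_f(x,S')$. $P(n)=\{(x_1,x_2)\in\mathbb{Z}^2:x_1=n\}$; $0$ is the origin. Let $(t_e)_{e\in\mathbb{E}^2}$ be i.i.d. with $\mathbb{P}(t_e=0)=p=1-\mathbb{P}(t_e=1)$, where $p=F(0)$; $T_f^B$ denotes the passage time defined as $T_f$ but with weights $(t_e)$ in place of $(\tau_e)$. Given integers $0=r_0<r_1<\cdots$, set $R_i=\{(x_1,x_2)\in\mathbb{V}_f:r_i\le x_1\le r_{i+1}\}$. A path with all vertices in $R_i$ is a top-down crossing of $R_i$ if its first vertex is in $\{(x_1,x_2)\in R_i:(x_1,x_2+1)\notin R_i\}$ and its last vertex is in $\{(x_1,x_2)\in R_i:x_2=0\}$;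 it is open if all its edges $e$ have $t_e=0$. Assumptions for $k_1>0$, $K_2\in[1,\infty)$, $k_3:[0,\infty)\to(0,\infty)$: A1. $\liminf_{i\to\infty}\mathbb{P}(\exists\text{ top-down open crossing of }R_i)\ge k_1$. A2. $\limsup_{i\to\infty}\left[\mathbb{E}T_f^B(0,P(r_{i+1}))-\mathbb{E}T_f^B(0,P(r_i))\right]\le K_2$. A3. $\liminf_{i\to\infty}\mathbb{P}(T_f^B(P(r_i),P(r_{i+1}))\ge M)\ge k_3(M)$ for each $M\ge0$. $f_1(n)\lesssim f_2(n)$ means $\limsup_{n\to\infty}f_1(n)/f_2(n)\le1$. *)

theory Defs
  imports "HOL-Probability.Probability"
begin

section \<open>The square lattice and the graph below a function\<close>

type_synonym vertex = "int \<times> int"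
type_synonym edge = "vertex set"

text \<open>Undirected edges are represented by the two-element set of their endpoints.\<close>

definition edges_Z2 :: "edge set" where
  "edges_Z2 = {{x, y} | x y :: vertex. \<bar>fst x - fst y\<bar> + \<bar>snd x - snd y\<bar> = 1}"

definition vertices_below :: "(real \<Rightarrow> real) \<Rightarrow> vertex set" where
  "vertices_below f =
     {(x1, x2). 0 \<le> x1 \<and> 0 \<le> x2 \<and> real_of_int x2 \<le> f (real_of_int x1)}"

definition edges_below :: "(real \<Rightarrow> real) \<Rightarrow> edge set" where
  "edges_below f = {e \<in> edges_Z2. e \<subseteq> vertices_below f}"

definition vertical_line :: "int \<Rightarrow> vertex set" where
  "vertical_line n = {x. fst x = n}"

section \<open>Paths and passage times\<close>

text \<open>
  A path is a nonempty list of vertices. Repetitions are allowed, and a repeated edge is counted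
  with multiplicity in the passage time; for nonnegative weights the infimum is the same as over
  self-avoiding paths.
\<close>

definition path_edges :: "vertex list \<Rightarrow> edge list" where
  "path_edges xs = map (\<lambda>(x, y). {x, y}) (zip xs (tl xs))"

definition is_path :: "(real \<Rightarrow> real) \<Rightarrow> vertex list \<Rightarrow> bool" where
  "is_path f xs \<longleftrightarrow>
     xs \<noteq> [] \<and> set xs \<subseteq> vertices_below f \<and> set (path_edges xs) \<subseteq> edges_below f"

definition path_time :: "(edge \<Rightarrow> real) \<Rightarrow> vertex list \<Rightarrow> real" where
  "path_time w xs = sum_list (map w (path_edges xs))"

text \<open>
  The infima below are infima of real numbers. If \<open>f \<ge> 0\<close> on \<open>[0, \<infinity>)\<close>, the graph is connected
  (every vertex is joined vertically to the horizontal axis) and meets every column with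
  nonnegative index, so all sets of competitors that are used are nonempty. They are bounded
  below by 0 as soon as the weights are nonnegative, which holds almost surely for the random
  weights considered.
\<close>

definition passage_time :: "(real \<Rightarrow> real) \<Rightarrow> (edge \<Rightarrow> real) \<Rightarrow> vertex \<Rightarrow> vertex \<Rightarrow> real" where
  "passage_time f w x y =
     (INF xs \<in> {xs. is_path f xs \<and> hd xs = x \<and> last xs = y}. path_time w xs)"

definition passage_time_to :: "(real \<Rightarrow> real) \<Rightarrow> (edge \<Rightarrow> real) \<Rightarrow> vertex \<Rightarrow> vertex set \<Rightarrow> real" where
  "passage_time_to f w x S = (INF y \<in> S \<inter> vertices_below f. passage_time f w x y)"

definition passage_time_between ::
    "(real \<Rightarrow> real) \<Rightarrow> (edge \<Rightarrow> real) \<Rightarrow> vertex set \<Rightarrow> vertex set \<Rightarrow> real" where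
  "passage_time_between f w S S' = (INF x \<in> S \<inter> vertices_below f. passage_time_to f w x S')"

section \<open>Top-down crossings\<close>

definition region :: "(real \<Rightarrow> real) \<Rightarrow> (nat \<Rightarrow> int) \<Rightarrow> nat \<Rightarrow> vertex set" where
  "region f r i = {(x1, x2) \<in> vertices_below f. r i \<le> x1 \<and> x1 \<le> r (Suc i)}"

definition top_down_crossing :: "(real \<Rightarrow> real) \<Rightarrow> (nat \<Rightarrow> int) \<Rightarrow> nat \<Rightarrow> vertex list \<Rightarrow> bool" where
  "top_down_crossing f r i xs \<longleftrightarrow>
     is_path f xs \<and> set xs \<subseteq> region f r i \<and>
     hd xs \<in> {(x1, x2) \<in> region f r i. (x1, x2 + 1) \<notin> region f r i} \<and>
     last xs \<in> {(x1, x2) \<in> region f r i. x2 = 0}"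

definition open_path :: "(edge \<Rightarrow> real) \<Rightarrow> vertex list \<Rightarrow> bool" where
  "open_path w xs \<longleftrightarrow> (\<forall>e \<in> set (path_edges xs). w e = 0)"

section \<open>Random weights and the standing assumptions\<close>

definition distribution_function :: "(real \<Rightarrow> real) \<Rightarrow> bool" where
  "distribution_function F \<longleftrightarrow>
     mono F \<and> (\<forall>x. continuous (at_right x) F) \<and>
     (F \<longlongrightarrow> 0) at_bot \<and> (F \<longlongrightarrow> 1) at_top"

definition iid_weights :: "'a measure \<Rightarrow> (edge \<Rightarrow> 'a \<Rightarrow> real) \<Rightarrow> (real \<Rightarrow> real) \<Rightarrow> bool" where
  "iid_weights M \<tau> F \<longleftrightarrow>
     prob_space.indep_vars M (\<lambda>_. borel) \<tau> edges_Z2 \<and>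
     (\<forall>e \<in> edges_Z2. cdf (distr M borel (\<tau> e)) = F)"

definition iid_bernoulli_weights :: "'a measure \<Rightarrow> (edge \<Rightarrow> 'a \<Rightarrow> real) \<Rightarrow> real \<Rightarrow> bool" where
  "iid_bernoulli_weights M t p \<longleftrightarrow>
     prob_space.indep_vars M (\<lambda>_. borel) t edges_Z2 \<and>
     (\<forall>e \<in> edges_Z2. measure M {\<omega> \<in> space M. t e \<omega> = 0} = p \<and>
                     measure M {\<omega> \<in> space M. t e \<omega> = 1} = 1 - p)"

definition assumption_A1 ::
    "'a measure \<Rightarrow> (edge \<Rightarrow> 'a \<Rightarrow> real) \<Rightarrow> (real \<Rightarrow> real) \<Rightarrow> (nat \<Rightarrow> int) \<Rightarrow> real \<Rightarrow> bool" where
  "assumption_A1 M t f r k1 \<longleftrightarrow>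
     liminf (\<lambda>i. ereal (measure M {\<omega> \<in> space M.
       \<exists>xs. top_down_crossing f r i xs \<and> open_path (\<lambda>e. t e \<omega>) xs})) \<ge> ereal k1"

definition assumption_A2 ::
    "'a measure \<Rightarrow> (edge \<Rightarrow> 'a \<Rightarrow> real) \<Rightarrow> (real \<Rightarrow> real) \<Rightarrow> (nat \<Rightarrow> int) \<Rightarrow> real \<Rightarrow> bool" where
  "assumption_A2 M t f r K2 \<longleftrightarrow>
     limsup (\<lambda>i. ereal (
       prob_space.expectation M
         (\<lambda>\<omega>. passage_time_to f (\<lambda>e. t e \<omega>) (0, 0) (vertical_line (r (Suc i)))) -
       prob_space.expectation M
         (\<lambda>\<omega>. passage_time_to f (\<lambda>e. t e \<omega>) (0, 0) (vertical_line (r i))))) \<le> ereal K2"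

definition assumption_A3 ::
    "'a measure \<Rightarrow> (edge \<Rightarrow> 'a \<Rightarrow> real) \<Rightarrow> (real \<Rightarrow> real) \<Rightarrow> (nat \<Rightarrow> int) \<Rightarrow> (real \<Rightarrow> real) \<Rightarrow> bool" where
  "assumption_A3 M t f r k3 \<longleftrightarrow>
     (\<forall>m \<ge> 0. liminf (\<lambda>i. ereal (measure M {\<omega> \<in> space M.
        passage_time_between f (\<lambda>e. t e \<omega>) (vertical_line (r i)) (vertical_line (r (Suc i))) \<ge> m}))
        \<ge> ereal (k3 m))"

section \<open>Asymptotic comparison\<close>

text \<open>
  The quotient is formed in the extended reals, where \<open>a / 0 = \<infinity>\<close> for \<open>a > 0\<close>, so that a vanishing
  denominator cannot make the relation hold by the convention \<open>a / 0 = 0\<close> of the reals.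
\<close>

definition asymp_le :: "(nat \<Rightarrow> real) \<Rightarrow> (nat \<Rightarrow> real) \<Rightarrow> bool" where
  "asymp_le g h \<longleftrightarrow> limsup (\<lambda>n. ereal (g n) / ereal (h n)) \<le> 1"

definition iota :: "(nat \<Rightarrow> int) \<Rightarrow> nat \<Rightarrow> nat" where
  "iota r n = (LEAST i. r (2 * i) \<ge> int n)"

end

theory Submission
  imports Defs
begin

text \<open>
  Let \<open>T(a, b)\<close> be the passage time between the columns \<open>a \<le> b\<close>. It is superadditive, it depends
  only on the edges strictly between the two columns, and by planarity paths can be glued along open
  top-down crossings. Hence, for \<open>i \<le> k < j\<close>,
  \<open>0 \<le> T(r\<^sub>i, r\<^sub>j) - T(r\<^sub>i, r\<^sub>k) - T(r\<^sub>k\<^sub>+\<^sub>1, r\<^sub>j) \<le> T(r\<^sub>k\<^sub>-\<^sub>a, r\<^sub>k\<^sub>+\<^sub>b)\<close>,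
  where \<open>a\<close> and \<open>b\<close> are given by the nearest blocks with open crossings on both sides of
  block \<open>k\<close>. By A1, used for every other block to have independence, \<open>a\<close> and \<open>b\<close> have geometric
  tails. By A2 and superadditivity the Bernoulli passage times \<open>T\<^sup>B(r\<^sub>i, r\<^sub>j)\<close> have mean at most
  \<open>K (j - i)\<close>. Exploring the set of vertices reached at cost less than \<open>m\<close> shows
  \<open>P(T\<^sup>B \<ge> m + n) \<le> P(T\<^sup>B \<ge> m) P(T\<^sup>B \<ge> n)\<close>, so all moments of \<open>T\<^sup>B\<close> are controlled by its mean.
  Therefore the gap has a second moment bounded by a constant \<open>C\<^sup>2\<close>.

  The two subtracted passage times are independent. Splitting dyadically thus shows that the
  variance over \<open>n\<close> blocks is \<open>O(n)\<close>, and splitting off one block at a time that the mean is \<open>O(n)\<close>.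
  Conversely, let \<open>S\<close> count the blocks whose Bernoulli crossing time is at least \<open>m\<close>, where
  \<open>\<delta> m \<ge> C + 1\<close>. Each block contributes at least its probability to the covariance of \<open>T\<close> and \<open>S\<close>,
  so A3 and \<open>Var (T - S) \<ge> 0\<close> give a linear lower bound for the variance.
\<close>

section \<open>Planarity: a left-to-right connection meets every top-down path\<close>

text \<open>Two difficulties shape the argument. The extent of the gap around block \<open>k\<close>
  is decided by closed edges (those of positive weight) on which the passage time across the gap
  depends as well, and positive weights may be large. Both are met by choosing a geodesic of the
  Bernoulli weights as a function of the set of closed edges: given this set, the positive weights
  along the geodesic are still independent, with second moment at most \<open>s / q\<close>. So, on
  an event decided by closed edges, the second moment of the passage time is at most
  \<open>s / q\<close> times that of the Bernoulli time, and the fourth moment of the latter pays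
  for separating it from the event. The families \<open>t\<close> and \<open>\<tau>\<close> are not
  coupled. The law of the closed edges in a finite set depends on \<open>p\<close> only, so A1 to A3
  pass to the closed edges of \<open>\<tau>\<close> by equality of laws. The uniform bounds hold
  only from a block on that depends on \<open>f\<close> and \<open>r\<close>. The slopes of all
  linear bounds do not depend on it; the columns before it contribute to additive errors, which are
  absorbed as \<open>iota\<close> grows.\<close>

lemma edges_Z2_iff: "{x, y} \<in> edges_Z2 \<longleftrightarrow> \<bar>fst x - fst y\<bar> + \<bar>snd x - snd y\<bar> = 1"
proof
  assume "{x, y} \<in> edges_Z2"
  then obtain u v :: vertex where uv: "{x, y} = {u, v}" "\<bar>fst u - fst v\<bar> + \<bar>snd u - snd v\<bar> = 1"
    by (auto simp: edges_Z2_def)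
  from uv(1) have "x = u \<and> y = v \<or> x = v \<and> y = u" by (auto simp: doubleton_eq_iff)
  with uv(2) show "\<bar>fst x - fst y\<bar> + \<bar>snd x - snd y\<bar> = 1" by auto
next
  assume "\<bar>fst x - fst y\<bar> + \<bar>snd x - snd y\<bar> = 1"
  then show "{x, y} \<in> edges_Z2" unfolding edges_Z2_def by blast
qed

lemma path_edges_Cons2: "path_edges (x # y # xs) = {x, y} # path_edges (y # xs)"
  by (simp add: path_edges_def)

lemma path_edges_single: "path_edges [x] = []"
  by (simp add: path_edges_def)

lemma sum_list_steps_telescope:
  fixes g :: "'b \<Rightarrow> 'c::ab_group_add"
  assumes "xs \<noteq> []"
  shows "sum_list (map (\<lambda>(p, q). g p - g q) (zip xs (tl xs))) = g (hd xs) - g (last xs)"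
  using assms
proof (induction xs)
  case (Cons x xs)
  then show ?case by (cases xs) (auto simp: algebra_simps)
qed simp

text \<open>
  \<open>winding D z\<close> is the signed number of crossings of the leftward horizontal half-line starting
  slightly above \<open>z\<close> with the curve that comes down vertically from infinity to \<open>hd D\<close> and then
  follows \<open>D\<close>.
\<close>

definition flux :: "vertex \<Rightarrow> vertex \<times> vertex \<Rightarrow> int" where
  "flux z = (\<lambda>(p, q). if fst p = fst q \<and> fst p < fst z
     then of_bool (snd z < snd p) - of_bool (snd z < snd q) else 0)"

definition winding :: "vertex list \<Rightarrow> vertex \<Rightarrow> int" where
  "winding D z = sum_list (map (flux z) (zip D (tl D))) +
     of_bool (snd (hd D) \<le> snd z \<and> fst (hd D) < fst z)"

lemma path_step:
  assumes "is_path f D" "(p, q) \<in> set (zip D (tl D))"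
  shows "\<bar>fst p - fst q\<bar> + \<bar>snd p - snd q\<bar> = 1" "p \<in> set D" "q \<in> set D"
proof -
  have "{p, q} \<in> set (path_edges D)"
    using assms(2) by (force simp: path_edges_def)
  then have "{p, q} \<in> edges_Z2" using assms(1) by (auto simp: is_path_def edges_below_def)
  then show "\<bar>fst p - fst q\<bar> + \<bar>snd p - snd q\<bar> = 1" by (simp add: edges_Z2_iff)
  show "p \<in> set D" using assms(2) by (rule set_zip_leftD)
  show "q \<in> set D" using set_zip_rightD[OF assms(2)] by (cases D) auto
qed

text \<open>The half-line grows by one unit. The only steps of \<open>D\<close> that could be newly
  counted run in the column of \<open>z\<close> between the heights of \<open>z\<close> and of its
  upper neighbour, hence have \<open>z\<close> as an endpoint.\<close>

lemma winding_right:
  assumes D: "is_path f D" and top: "(fst (hd D), snd (hd D) + 1) \<notin> vertices_below f"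
    and z: "z \<in> vertices_below f" "z \<notin> set D"
  shows "winding D (fst z + 1, snd z) = winding D z"
proof -
  have "flux (fst z + 1, snd z) s = flux z s" if "s \<in> set (zip D (tl D))" for s
  proof -
    obtain p q where s: "s = (p, q)" by (cases s)
    note st = path_step[OF D that[unfolded s]]
    have "p \<noteq> z" "q \<noteq> z" using st z by auto
    then have "(fst p \<noteq> fst z \<or> snd p \<noteq> snd z)" "(fst q \<noteq> fst z \<or> snd q \<noteq> snd z)"
      by (auto simp: prod_eq_iff)
    with st(1) show ?thesis unfolding flux_def s by (auto simp: of_bool_def)
  qed
  then have "sum_list (map (flux (fst z + 1, snd z)) (zip D (tl D)))
      = sum_list (map (flux z) (zip D (tl D)))"
    by (intro arg_cong[of _ _ sum_list] map_cong refl)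
  \<comment> \<open>The vertical ray into \<open>hd D\<close> is not met either: a column of the
    graph is an interval, so a head strictly below \<open>z\<close> would have its upper neighbour
    in the graph, against \<open>top\<close>.\<close>
  moreover have "\<not> (snd (hd D) \<le> snd z \<and> fst (hd D) = fst z)"
  proof
    assume a: "snd (hd D) \<le> snd z \<and> fst (hd D) = fst z"
    have hd: "hd D \<in> set D" using D by (auto simp: is_path_def)
    then have "hd D \<noteq> z" using z by auto
    with a have "snd (hd D) < snd z" by (auto simp: prod_eq_iff)
    moreover have "hd D \<in> vertices_below f" using hd D by (auto simp: is_path_def)
    ultimately have "(fst (hd D), snd (hd D) + 1) \<in> vertices_below f"
      using z(1) a by (auto simp: vertices_below_def)
    with top show False by simp
  qed
  ultimately show ?thesis unfolding winding_def by (auto simp: of_bool_def)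
qed

text \<open>The flux changes by a telescoping sum over the visits of \<open>D\<close> to the part of
  row \<open>snd z + 1\<close> to the left of \<open>z\<close>. This part can be left horizontally
  only through the excluded vertex, the end of \<open>D\<close> lies below it, and the ray term in
  \<open>winding\<close> cancels the contribution of \<open>hd D\<close>.\<close>

lemma winding_up:
  assumes D: "is_path f D" and bottom: "snd (last D) = 0"
    and z: "z \<in> vertices_below f" "(fst z, snd z + 1) \<notin> set D"
  shows "winding D (fst z, snd z + 1) = winding D z"
proof -
  define g where "g = (\<lambda>p::vertex. of_bool (snd p = snd z + 1 \<and> fst p < fst z) :: int)"
  have "flux z s - flux (fst z, snd z + 1) s = (case s of (p, q) \<Rightarrow> g p - g q)"
    if "s \<in> set (zip D (tl D))" for s
  proof -
    obtain p q where s: "s = (p, q)" by (cases s)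
    note st = path_step[OF D that[unfolded s]]
    have "p \<noteq> (fst z, snd z + 1)" "q \<noteq> (fst z, snd z + 1)" using st z by auto
    then have "(fst p \<noteq> fst z \<or> snd p \<noteq> snd z + 1)" "(fst q \<noteq> fst z \<or> snd q \<noteq> snd z + 1)"
      by (auto simp: prod_eq_iff)
    with st(1) show ?thesis unfolding flux_def s g_def by (auto simp: of_bool_def)
  qed
  then have "sum_list (map (\<lambda>s. flux z s - flux (fst z, snd z + 1) s) (zip D (tl D)))
      = sum_list (map (\<lambda>(p, q). g p - g q) (zip D (tl D)))"
    by (intro arg_cong[of _ _ sum_list] map_cong refl)
  also have "\<dots> = g (hd D) - g (last D)"
    using D by (intro sum_list_steps_telescope) (simp add: is_path_def)
  finally have "sum_list (map (flux z) (zip D (tl D))) - sum_list (map (flux (fst z, snd z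
      + 1)) (zip D (tl D)))
      = g (hd D) - g (last D)"
    by (simp add: sum_list_subtractf)
  moreover have "g (last D) = 0" using z(1) bottom by (auto simp: g_def vertices_below_def)
  ultimately show ?thesis unfolding winding_def by (auto simp: of_bool_def g_def split: if_splits)
qed

lemma winding_left_end:
  assumes "\<forall>v \<in> set D. fst z \<le> fst v" "D \<noteq> []" "is_path f D"
  shows "winding D z = 0"
proof -
  have "flux z s = 0" if "s \<in> set (zip D (tl D))" for s
  proof -
    obtain p q where s: "s = (p, q)" by (cases s)
    show ?thesis using path_step[OF assms(3) that[unfolded s]] assms by (auto simp: s flux_def)
  qed
  then have "sum_list (map (flux z) (zip D (tl D))) = sum_list (map (\<lambda>_. 0) (zip D (tl D)))"
    by (intro arg_cong[of _ _ sum_list] map_cong refl)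
  then have "sum_list (map (flux z) (zip D (tl D))) = 0" by (simp only: sum_list_0)
  moreover have "fst z \<le> fst (hd D)" using assms by auto
  ultimately show ?thesis by (auto simp: winding_def)
qed

text \<open>The whole curve lies to the left of \<open>z\<close>, so the count is its net number of
  descents through the height just above \<open>z\<close>: it comes from infinity and ends on the
  axis.\<close>

lemma winding_right_end:
  assumes "\<forall>v \<in> set D. fst v < fst z" "is_path f D" "snd (last D) = 0" "0 \<le> snd z"
  shows "winding D z = 1"
proof -
  define g where "g = (\<lambda>p::vertex. of_bool (snd z < snd p) :: int)"
  have "flux z s = (case s of (p, q) \<Rightarrow> g p - g q)" if "s \<in> set (zip D (tl D))" for s
  proof -
    obtain p q where s: "s = (p, q)" by (cases s)
    note st = path_step[OF assms(2) that[unfolded s]]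
    show ?thesis using st assms by (auto simp: s flux_def g_def)
  qed
  then have "sum_list (map (flux z) (zip D (tl D)))
      = sum_list (map (\<lambda>(p, q). g p - g q) (zip D (tl D)))"
    by (intro arg_cong[of _ _ sum_list] map_cong refl)
  also have "\<dots> = g (hd D) - g (last D)"
    using assms by (intro sum_list_steps_telescope) (simp add: is_path_def)
  finally have "sum_list (map (flux z) (zip D (tl D))) = g (hd D) - g (last D)" .
  moreover have "hd D \<in> set D" using assms by (auto simp: is_path_def)
  ultimately show ?thesis using assms by (auto simp: winding_def g_def)
qed

text \<open>Connections are kept as reachability through a set of edges, since such sets can be cut
  by intersection and joined by union without any bookkeeping of lists.\<close>

definition conn :: "edge set \<Rightarrow> vertex \<Rightarrow> vertex \<Rightarrow> bool" where
  "conn A x y \<longleftrightarrow> (x, y) \<in> {(u, v). {u, v} \<in> A}\<^sup>*"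

lemma conn_refl [simp]: "conn A x x"
  by (simp add: conn_def)

lemma conn_trans: "conn A x y \<Longrightarrow> conn A y z \<Longrightarrow> conn A x z"
  by (simp add: conn_def)

lemma conn_step: "conn A x y \<Longrightarrow> {y, z} \<in> A \<Longrightarrow> conn A x z"
  by (auto simp: conn_def intro: rtrancl_into_rtrancl)

lemma conn_sym: "conn A x y \<Longrightarrow> conn A y x"
proof -
  have "sym ({(u, v). {u, v} \<in> A}\<^sup>*)" by (rule sym_rtrancl) (auto simp: sym_def insert_commute)
  then show "conn A x y \<Longrightarrow> conn A y x" unfolding conn_def by (rule symD)
qed

lemma conn_mono: "conn A x y \<Longrightarrow> A \<subseteq> B \<Longrightarrow> conn B x y"
  unfolding conn_def using rtrancl_mono[of "{(u, v). {u, v} \<in> A}" "{(u, v). {u, v} \<in> B}"] by auto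

lemma conn_induct [consumes 1, case_names refl step]:
  assumes "conn A x y" "P x" "\<And>u v. conn A x u \<Longrightarrow> {u, v} \<in> A \<Longrightarrow> P u \<Longrightarrow> P v"
  shows "P y"
  using assms(1) unfolding conn_def
  by (induction rule: rtrancl_induct) (use assms(2,3) in \<open>auto simp: conn_def\<close>)

text \<open>If the connection avoided \<open>D\<close>, the winding number would be constant along
  it, but it is 0 to the left of \<open>D\<close> and 1 to the right.\<close>

lemma crossing_meets:
  assumes D: "is_path f D" and top: "(fst (hd D), snd (hd D) + 1) \<notin> vertices_below f"
    and bottom: "snd (last D) = 0" and cols: "\<forall>v \<in> set D. c \<le> fst v \<and> fst v \<le> d"
    and A: "A \<subseteq> edges_below f" and xy: "conn A x y"
    and x: "x \<in> vertices_below f" "fst x \<le> c" and y: "d \<le> fst y"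
  shows "\<exists>z \<in> set D. conn A x z"
proof (rule ccontr)
  assume "\<not> ?thesis"
  then have no: "conn A x z \<Longrightarrow> z \<notin> set D" for z by auto
  have ne: "D \<noteq> []" using D by (simp add: is_path_def)
  from xy have "y \<in> vertices_below f \<and> winding D y = 0"
  proof (induction rule: conn_induct)
    case refl
    show ?case using winding_left_end[of D x f] cols x D ne by force
  next
    case (step u v)
    have e: "{u, v} \<in> edges_below f" using step A by auto
    then have v: "v \<in> vertices_below f" and u: "u \<in> vertices_below f"
        by (auto simp: edges_below_def)
    have uD: "u \<notin> set D" and vD: "v \<notin> set D" using step no conn_step[OF step(1,2)] by auto
    have "\<bar>fst u - fst v\<bar> + \<bar>snd u - snd v\<bar> = 1"
      using e by (simp add: edges_below_def edges_Z2_iff)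
    then consider "v = (fst u + 1, snd u)" | "u = (fst v + 1, snd v)"
      | "v = (fst u, snd u + 1)" | "u = (fst v, snd v + 1)"
      by (cases u; cases v; simp add: abs_if split: if_splits; fastforce)
    then have "winding D v = winding D u"
    proof cases
      case 1 then show ?thesis using winding_right[OF D top u uD] by simp
    next
      case 2 then show ?thesis using winding_right[OF D top v vD] by simp
    next
      case 3 then show ?thesis using winding_up[OF D bottom u] vD by simp
    next
      case 4 then show ?thesis using winding_up[OF D bottom v] uD by simp
    qed
    with step v show ?case by auto
  qed
  \<comment> \<open>\<open>y\<close> may lie in the last column \<open>d\<close> of
    \<open>D\<close>; the point one step further right, possibly outside the graph, is strictly
    beyond \<open>D\<close>.\<close>
  moreover from this have "winding D (fst y + 1, snd y) = winding D y"
    by (intro winding_right[OF D top]) (use no[OF xy] in auto)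
  moreover have "winding D (fst y + 1, snd y) = 1"
    using cols y calculation(1)
    by (intro winding_right_end[of _ _ f] D bottom) (force simp: vertices_below_def)+
  ultimately show False by simp
qed

section \<open>Passage times as minima over linking edge sets\<close>

definition column :: "(real \<Rightarrow> real) \<Rightarrow> int \<Rightarrow> vertex set" where
  "column f a = vertices_below f \<inter> vertical_line a"

definition links :: "edge set \<Rightarrow> vertex set \<Rightarrow> vertex set \<Rightarrow> bool" where
  "links A S S' \<longleftrightarrow> (\<exists>x \<in> S. \<exists>y \<in> S'. conn A x y)"

definition slab :: "(real \<Rightarrow> real) \<Rightarrow> int \<Rightarrow> int \<Rightarrow> edge set" where
  "slab f a b = {e \<in> edges_below f. \<forall>z \<in> e. a \<le> fst z \<and> fst z \<le> b}"

text \<open>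
  Dropping the vertical edges of both boundary columns makes consecutive strips disjoint.
\<close>

definition strip :: "(real \<Rightarrow> real) \<Rightarrow> int \<Rightarrow> int \<Rightarrow> edge set" where
  "strip f a b = {e \<in> slab f a b. \<not> e \<subseteq> vertical_line a \<and> \<not> e \<subseteq> vertical_line b}"

text \<open>A minimum over finitely many edge sets is attained and measurable without further
  argument. The weight type is general because the same notion serves real weights and natural
  numbers counting closed edges.\<close>

definition strip_time :: "(real \<Rightarrow> real) \<Rightarrow> (edge \<Rightarrow> 'b::linordered_semidom) \<Rightarrow> int \<Rightarrow> int \<Rightarrow> 'b" where
  "strip_time f w a b = Min (sum w ` {A. A \<subseteq> strip f a b \<and> links A (column f a) (column f b)})"

text \<open>\<open>Q\<close> is meant to be the set of closed edges; the existence of an open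
  top-down crossing thereby becomes a function of that set.\<close>

definition crossing :: "(real \<Rightarrow> real) \<Rightarrow> int \<Rightarrow> int \<Rightarrow> edge set \<Rightarrow> bool" where
  "crossing f c d Q \<longleftrightarrow> (\<exists>D. is_path f D \<and> (\<forall>v \<in> set D. c \<le> fst v \<and> fst v \<le> d) \<and>
     (fst (hd D), snd (hd D) + 1) \<notin> vertices_below f \<and> snd (last D) = 0 \<and>
     set (path_edges D) \<inter> Q = {})"

lemma slab_subset: "slab f a b \<subseteq> edges_below f"
  by (auto simp: slab_def)

lemma strip_subset_slab: "strip f a b \<subseteq> slab f a b"
  by (auto simp: strip_def)

lemma strip_subset: "strip f a b \<subseteq> edges_below f"
  using strip_subset_slab slab_subset by blast

lemma edges_below_subset: "edges_below f \<subseteq> edges_Z2"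
  by (auto simp: edges_below_def)

lemma edge_nonempty: "e \<in> edges_Z2 \<Longrightarrow> e \<noteq> {}"
  by (auto simp: edges_Z2_def)

lemma finite_slab: "finite (slab f a b)"
proof -
  have "slab f a b \<subseteq> Pow (SIGMA x:{a..b}. {0..\<lfloor>f (real_of_int x)\<rfloor>})"
    by (fastforce simp: slab_def edges_below_def vertices_below_def le_floor_iff)
  then show ?thesis by (rule finite_subset) auto
qed

lemma finite_strip: "finite (strip f a b)"
  using finite_slab strip_subset_slab by (rule finite_subset[rotated])

lemma strip_disjoint_slab:
  assumes "v \<le> v'"
  shows "strip f u v \<inter> slab f v' y = {}"
proof -
  have False if e: "e \<in> strip f u v" "e \<in> slab f v' y" for e
  proof -
    have "e \<subseteq> vertical_line v" using e assms by (force simp: strip_def slab_def vertical_line_def)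
    with e show False by (auto simp: strip_def)
  qed
  then show ?thesis by auto
qed

lemma slab_disjoint:
  assumes "v < v'"
  shows "slab f u v \<inter> slab f v' y = {}"
proof -
  have False if e: "e \<in> slab f u v" "e \<in> slab f v' y" for e
  proof -
    have "e \<in> edges_Z2" using e by (auto simp: slab_def edges_below_def)
    then obtain z where "z \<in> e" using edge_nonempty by blast
    with e assms show False by (force simp: slab_def)
  qed
  then show ?thesis by auto
qed

lemma strip_disjoint: "v \<le> v' \<Longrightarrow> strip f u v \<inter> strip f v' y = {}"
  using strip_disjoint_slab[of v v' f u y] strip_subset_slab[of f v' y] by blast

lemma slab_mono: "a \<le> u \<Longrightarrow> v \<le> b \<Longrightarrow> slab f u v \<subseteq> slab f a b"
  by (force simp: slab_def)

lemma crossing_slab: "crossing f c d Q \<longleftrightarrow> crossing f c d (Q \<inter> slab f c d)"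
proof -
  have "set (path_edges D) \<inter> Q = {} \<longleftrightarrow> set (path_edges D) \<inter> (Q \<inter> slab f c d) = {}"
    if D: "is_path f D" "\<forall>v \<in> set D. c \<le> fst v \<and> fst v \<le> d" for D
  proof -
    have "e \<in> slab f c d" if "e \<in> set (path_edges D)" for e
    proof -
      obtain p q where pq: "e = {p, q}" "(p, q) \<in> set (zip D (tl D))"
        using \<open>e \<in> set (path_edges D)\<close> unfolding path_edges_def by auto
      have "e \<subseteq> set D" using path_step(2,3)[OF D(1) pq(2)] pq(1) by simp
      moreover have "e \<in> edges_below f" using that D by (auto simp: is_path_def)
      ultimately show ?thesis using D(2) by (auto simp: slab_def)
    qed
    then show ?thesis by auto
  qed
  then show ?thesis unfolding crossing_def by blast
qed

lemma conn_path:
  assumes "xs \<noteq> []" "z \<in> set xs"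
  shows "conn (set (path_edges xs)) (hd xs) z"
  using assms
proof (induction xs)
  case (Cons x xs)
  show ?case
  proof (cases xs)
    case Nil
    then show ?thesis using Cons by simp
  next
    case (Cons y ys)
    show ?thesis
    proof (cases "z = x")
      case False
      then have "conn (set (path_edges xs)) y z"
        using Cons.IH Cons.prems Cons by auto
      then have "conn (set (path_edges (x # xs))) y z"
        by (rule conn_mono) (auto simp: Cons path_edges_Cons2)
      moreover have "conn (set (path_edges (x # xs))) x y"
        by (rule conn_step[OF conn_refl]) (auto simp: Cons path_edges_Cons2)
      ultimately show ?thesis using conn_trans by fastforce
    qed simp
  qed
qed simp

lemma conn_path2:
  assumes "z \<in> set xs" "z' \<in> set xs"
  shows "conn (set (path_edges xs)) z z'"
  using conn_path[of xs z] conn_path[of xs z'] assms conn_sym conn_trans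
      by (metis list.set(1) empty_iff)

section \<open>Cutting and joining linking edge sets\<close>

locale below =
  fixes f :: "real \<Rightarrow> real"
  assumes f_nonneg: "\<And>x. 0 \<le> x \<Longrightarrow> 0 \<le> f x"
begin

lemma axis_in: "0 \<le> a \<Longrightarrow> (a, 0) \<in> column f a"
  by (auto simp: column_def vertical_line_def vertices_below_def f_nonneg)

lemma strip_links:
  assumes "0 \<le> a" "a \<le> b"
  shows "links (strip f a b) (column f a) (column f b)"
proof -
  have "conn (strip f a b) (a, 0) (k, 0)" if "a \<le> k" "k \<le> b" for k
    using that
  proof (induction k rule: int_ge_induct)
    case (step k)
    have "{(k, 0), (k + 1, 0)} \<in> edges_below f"
      using step assms f_nonneg[of "real_of_int k"] f_nonneg[of "real_of_int (k + 1)"]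
      by (auto simp: edges_below_def edges_Z2_iff vertices_below_def)
    then have "{(k, 0), (k + 1, 0)} \<in> strip f a b"
      using step by (auto simp: strip_def slab_def vertical_line_def)
    then show ?case using step conn_step by auto
  qed simp
  from this[OF assms(2)] show ?thesis
    unfolding links_def using axis_in[of a] axis_in[of b] assms by auto
qed

text \<open>\<open>S\<close> is what can be reached from column \<open>u\<close> inside the strip. A
  connection coming from the left has to pass column \<open>u\<close>, which is part of
  \<open>S\<close>; as long as \<open>S\<close> misses column \<open>v\<close>, every vertex of the
  connection beyond column \<open>u\<close> lies in \<open>S\<close>, so that column
  \<open>y\<close> is never reached.\<close>

lemma links_restrict:
  assumes A: "A \<subseteq> edges_below f" and l: "links A (column f x) (column f y)"
    and le: "0 \<le> u" "x \<le> u" "u \<le> v" "v \<le> y"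
  shows "links (A \<inter> strip f u v) (column f u) (column f v)"
proof (cases "u = v")
  case True
  then show ?thesis using axis_in[OF le(1)] unfolding links_def by (metis conn_refl)
next
  case False
  with le have uv: "u < v" by simp
  let ?B = "A \<inter> strip f u v"
  show ?thesis
  proof (rule ccontr)
    assume "\<not> ?thesis"
    then have no: "conn ?B s z \<Longrightarrow> s \<in> column f u \<Longrightarrow> z \<notin> column f v" for s z
      by (auto simp: links_def)
    define S where "S = {z. \<exists>s \<in> column f u. conn ?B s z}"
    have S: "u \<le> fst z \<and> fst z < v \<and> z \<in> vertices_below f" if "z \<in> S" for z
    proof -
      obtain s where s: "s \<in> column f u" "conn ?B s z" using \<open>z \<in> S\<close> unfolding S_def by blast
      from s(2) have "u \<le> fst z \<and> fst z \<le> v \<and> z \<in> vertices_below f"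
      proof (induction rule: conn_induct)
        case refl
        show ?case using s(1) uv by (auto simp: column_def vertical_line_def)
      next
        case (step p q)
        then show ?case by (auto simp: strip_def slab_def edges_below_def)
      qed
      with no[OF s(2,1)] show ?thesis by (force simp: column_def vertical_line_def)
    qed
    obtain p q where pq: "p \<in> column f x" "q \<in> column f y" "conn A p q"
      using l by (auto simp: links_def)
    have colS: "z \<in> S" if "z \<in> vertices_below f" "fst z = u" for z
    proof -
      have "z \<in> column f u" using that by (simp add: column_def vertical_line_def)
      then show ?thesis unfolding S_def using conn_refl by blast
    qed
    from pq(3) have "q \<in> vertices_below f \<and> (fst q \<le> u \<or> q \<in> S)"
    proof (induction rule: conn_induct)
      case refl
      show ?case using pq(1) le by (auto simp: column_def vertical_line_def)
    next
      case (step z z')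
      have e: "{z, z'} \<in> edges_below f" using step A by auto
      then have V: "z \<in> vertices_below f" "z' \<in> vertices_below f" by (auto simp: edges_below_def)
      have "\<bar>fst z - fst z'\<bar> + \<bar>snd z - snd z'\<bar> = 1"
        using e by (simp add: edges_below_def edges_Z2_iff)
      then have d: "fst z' \<le> fst z + 1" by linarith
      show ?case
      proof (cases "fst z' \<le> u")
        case False
        then have "fst z \<ge> u" using d by simp
        then have zS: "z \<in> S" using step(3) colS[OF V(1)] by (meson order_antisym)
        note z = S[OF zS]
        have "{z, z'} \<in> ?B"
          using step(2) e z d False by (auto simp: strip_def slab_def vertical_line_def)
        then have "z' \<in> S" using zS conn_step unfolding S_def by blast
        then show ?thesis using V by simp
      qed (use V in simp)
    qed
    then show False using pq(2) S[of q] uv le by (auto simp: column_def vertical_line_def)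
  qed
qed

lemma strip_time_le:
  assumes "A \<subseteq> strip f a b" "links A (column f a) (column f b)"
  shows "strip_time f w a b \<le> sum w A"
proof -
  have "finite {A. A \<subseteq> strip f a b \<and> links A (column f a) (column f b)}"
    by (rule finite_subset[of _ "Pow (strip f a b)"]) (auto simp: finite_strip)
  then show ?thesis unfolding strip_time_def using assms by (intro Min_le) auto
qed

lemma strip_time_attained:
  assumes "0 \<le> a" "a \<le> b"
  obtains A where "A \<subseteq> strip f a b" "links A (column f a) (column f b)" "strip_time f w a b
      = sum w A"
proof -
  have fin: "finite {A. A \<subseteq> strip f a b \<and> links A (column f a) (column f b)}"
    by (rule finite_subset[of _ "Pow (strip f a b)"]) (auto simp: finite_strip)
  have "strip_time f w a b \<in> sum w ` {A. A \<subseteq> strip f a b \<and> links A (column f a) (column f b)}"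
    unfolding strip_time_def using strip_links[OF assms] fin by (intro Min_in) auto
  then show ?thesis using that by auto
qed

lemma strip_time_le':
  assumes A: "finite A" "A \<subseteq> edges_below f" "links A (column f a) (column f b)" "0 \<le> a" "a \<le> b"
    and w: "\<And>e. e \<in> edges_below f \<Longrightarrow> 0 \<le> w e"
  shows "strip_time f w a b \<le> sum w A"
proof -
  have "strip_time f w a b \<le> sum w (A \<inter> strip f a b)"
    using A links_restrict[of A a b a b] by (intro strip_time_le) auto
  also have "\<dots> \<le> sum w A" using A w by (intro sum_mono2) auto
  finally show ?thesis .
qed

text \<open>A minimiser for the whole strip restricts to linking sets of the three smaller strips,
  which are disjoint. Three pieces, some possibly degenerate, cover both the gap and
  monotonicity.\<close>

lemma strip_time_superadditive:
  assumes w: "\<And>e. e \<in> edges_below f \<Longrightarrow> 0 \<le> w e" and le: "0 \<le> x" "x \<le> u" "u \<le> v" "v \<le> y"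
  shows "strip_time f w x u + strip_time f w u v + strip_time f w v y \<le> strip_time f w x y"
proof -
  obtain A where A: "A \<subseteq> strip f x y" "links A (column f x) (column f y)" "strip_time f w x y
      = sum w A"
    using strip_time_attained[of x y w] le by auto
  have fin: "finite A" using A(1) finite_strip by (rule finite_subset)
  have eb: "A \<subseteq> edges_below f" using A(1) strip_subset by blast
  have T: "strip_time f w a b \<le> sum w (A \<inter> strip f a b)" if "x \<le> a" "a \<le> b" "b \<le> y" for a b
    using that le links_restrict[OF eb A(2), of a b] by (intro strip_time_le) auto
  have d: "strip f x u \<inter> strip f u v = {}" "strip f u v \<inter> strip f v y
      = {}" "strip f x u \<inter> strip f v y = {}"
    using strip_disjoint le by auto
  have "sum w (A \<inter> strip f x u) + sum w (A \<inter> strip f u v) + sum w (A \<inter> strip f v y)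
      = sum w (A \<inter> strip f x u \<union> A \<inter> strip f u v \<union> A \<inter> strip f v y)"
  proof -
    have "sum w (A \<inter> strip f x u \<union> A \<inter> strip f u v) = sum w (A \<inter> strip f x u)
        + sum w (A \<inter> strip f u v)"
      using d fin by (intro sum.union_disjoint) auto
    moreover have "sum w (A \<inter> strip f x u \<union> A \<inter> strip f u v \<union> A \<inter> strip f v y)
        = sum w (A \<inter> strip f x u \<union> A \<inter> strip f u v) + sum w (A \<inter> strip f v y)"
      using d fin by (intro sum.union_disjoint) auto
    ultimately show ?thesis by simp
  qed
  also have "\<dots> \<le> sum w A" using fin eb w by (intro sum_mono2) auto
  finally have "sum w (A \<inter> strip f x u) + sum w (A \<inter> strip f u v) + sum w (A \<inter> strip f v y)
      \<le> strip_time f w x y" using A(3) by simp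
  moreover have "strip_time f w x u + strip_time f w u v + strip_time f w v y
      \<le> sum w (A \<inter> strip f x u) + sum w (A \<inter> strip f u v) + sum w (A \<inter> strip f v y)"
    using T[of x u] T[of u v] T[of v y] le by (intro add_mono) auto
  ultimately show ?thesis by (rule order_trans[rotated])
qed

lemma strip_time_nonneg:
  assumes w: "\<And>e. e \<in> edges_below f \<Longrightarrow> 0 \<le> w e" and le: "0 \<le> x" "x \<le> y"
  shows "0 \<le> strip_time f w x y"
proof -
  obtain A where A: "A \<subseteq> strip f x y" "strip_time f w x y = sum w A"
    using strip_time_attained[OF le] by metis
  have "0 \<le> sum w A" using A(1) strip_subset by (intro sum_nonneg w) blast
  then show ?thesis using A(2) by simp
qed

lemma strip_time_mono:
  assumes w: "\<And>e. e \<in> edges_below f \<Longrightarrow> 0 \<le> w e" and le: "0 \<le> x" "x \<le> u" "u \<le> v" "v \<le> y"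
  shows "strip_time f w u v \<le> strip_time f w x y"
proof -
  have "0 \<le> strip_time f w x u" "0 \<le> strip_time f w v y"
    using le by (auto intro!: strip_time_nonneg w)
  then have "strip_time f w u v \<le> strip_time f w x u + strip_time f w u v + strip_time f w v y"
    by (simp add: add_increasing add_increasing2)
  then show ?thesis using strip_time_superadditive[OF w le] by (rule order_trans)
qed

text \<open>Both connections span all columns of \<open>D\<close>, so each of them meets it.\<close>

lemma crossing_join:
  assumes D: "is_path f D" "(fst (hd D), snd (hd D) + 1) \<notin> vertices_below f"
    "snd (last D) = 0" "\<forall>v \<in> set D. c \<le> fst v \<and> fst v \<le> d"
    and A: "A \<subseteq> edges_below f" "conn A p q" "p \<in> vertices_below f" "fst p \<le> c" "d \<le> fst q"
    and A': "A' \<subseteq> edges_below f" "conn A' p' q'" "p' \<in> vertices_below f" "fst p' \<le> c" "d \<le> fst q'"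
  shows "conn (A \<union> set (path_edges D) \<union> A') p p'"
proof -
  obtain z where z: "z \<in> set D" "conn A p z" using crossing_meets[OF D A] by auto
  obtain z' where z': "z' \<in> set D" "conn A' p' z'" using crossing_meets[OF D A'] by auto
  let ?U = "A \<union> set (path_edges D) \<union> A'"
  have "conn ?U p z" by (rule conn_mono[OF z(2)]) auto
  moreover have "conn ?U z z'" by (rule conn_mono[OF conn_path2[OF z(1) z'(1)]]) auto
  moreover have "conn ?U z' p'" by (rule conn_mono[OF conn_sym[OF z'(2)]]) auto
  ultimately show ?thesis using conn_trans by blast
qed

text \<open>
  The three minimal edge sets overlap in the blocks with open top-down crossings, which join them.
\<close>

lemma strip_time_glue:
  fixes w :: "edge \<Rightarrow> real"
  assumes w: "\<And>e. e \<in> edges_below f \<Longrightarrow> 0 \<le> w e"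
    and Q: "\<And>e. e \<in> edges_below f \<Longrightarrow> e \<notin> Q \<Longrightarrow> w e = 0"
    and le: "0 \<le> x" "x \<le> a" "a \<le> u" "u \<le> v" "v \<le> b" "b \<le> y"
    and L: "a = x \<or> (\<exists>c d. a \<le> c \<and> d \<le> u \<and> crossing f c d Q)"
    and R: "b = y \<or> (\<exists>c d. v \<le> c \<and> d \<le> b \<and> crossing f c d Q)"
  shows "strip_time f w x y \<le> strip_time f w x u + strip_time f w a b + strip_time f w v y"
proof -
  obtain A1 where A1: "A1 \<subseteq> strip f x u" "links A1 (column f x) (column f u)" "strip_time f w x u
      = sum w A1"
    using strip_time_attained[of x u w] le by auto
  obtain A2 where A2: "A2 \<subseteq> strip f a b" "links A2 (column f a) (column f b)" "strip_time f w a b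
      = sum w A2"
    using strip_time_attained[of a b w] le by auto
  obtain A3 where A3: "A3 \<subseteq> strip f v y" "links A3 (column f v) (column f y)" "strip_time f w v y
      = sum w A3"
    using strip_time_attained[of v y w] le by auto
  have fin: "finite A1" "finite A2" "finite A3"
    using A1(1) A2(1) A3(1) finite_strip by (auto intro: finite_subset)
  have eb: "A1 \<subseteq> edges_below f" "A2 \<subseteq> edges_below f" "A3 \<subseteq> edges_below f"
    using A1(1) A2(1) A3(1) strip_subset by blast+
  obtain p1 q1 where pq1: "p1 \<in> column f x" "q1 \<in> column f u" "conn A1 p1 q1"
    using A1(2) by (auto simp: links_def)
  obtain p2 q2 where pq2: "p2 \<in> column f a" "q2 \<in> column f b" "conn A2 p2 q2"
    using A2(2) by (auto simp: links_def)
  obtain p3 q3 where pq3: "p3 \<in> column f v" "q3 \<in> column f y" "conn A3 p3 q3"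
    using A3(2) by (auto simp: links_def)
  have zero: "sum w (A \<union> set (path_edges D)) = sum w A"
    if "set (path_edges D) \<inter> Q = {}" "is_path f D" "finite A" for A D
  proof (rule sum.mono_neutral_right)
    show "\<forall>i\<in>A \<union> set (path_edges D) - A. w i = 0"
      using that by (auto simp: is_path_def disjoint_iff intro!: Q)
  qed (use that in auto)
  \<comment> \<open>\<open>B\<close> is what has to be added to \<open>A2\<close> on the left:
    nothing if \<open>A2\<close> already starts in column \<open>x\<close>, otherwise
    \<open>A1\<close> together with the crossing, whose edges cost nothing.\<close>
  have "\<exists>B p. finite B \<and> B \<subseteq> edges_below f \<and> sum w B \<le> sum w A1 \<and> p \<in> column f x
      \<and> conn (B \<union> A2) p p2"
    using L
  proof
    assume "a = x"
    then show ?thesis using pq2 eb(1) by (intro exI[of _ "{}"] exI[of _ p2]) (auto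
        intro!: sum_nonneg w)
  next
    assume "\<exists>c d. a \<le> c \<and> d \<le> u \<and> crossing f c d Q"
    then obtain c d D where D: "a \<le> c" "d \<le> u" "is_path f D" "\<forall>v \<in> set D. c \<le> fst v \<and> fst v \<le> d"
      "(fst (hd D), snd (hd D) + 1) \<notin> vertices_below f" "snd (last D) = 0"
      "set (path_edges D) \<inter> Q = {}" unfolding crossing_def by auto
    have "conn (A1 \<union> set (path_edges D) \<union> A2) p1 p2"
      using pq1 pq2 le D(1,2) unfolding column_def vertical_line_def
      by (intro crossing_join[OF D(3,5,6,4) eb(1) pq1(3) _ _ _ eb(2) pq2(3)]) auto
    then show ?thesis using zero[OF D(7,3) fin(1)] fin eb D(3) pq1
      by (intro exI[of _ "A1 \<union> set (path_edges D)"] exI[of _ p1]) (auto simp: is_path_def)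
  qed
  then obtain B1 p where B1: "finite B1" "B1 \<subseteq> edges_below f" "sum w B1 \<le> sum w A1"
    "p \<in> column f x" "conn (B1 \<union> A2) p p2" by blast
  have "\<exists>B q. finite B \<and> B \<subseteq> edges_below f \<and> sum w B \<le> sum w A3 \<and> q \<in> column f y
      \<and> conn (B \<union> A2) p2 q"
    using R
  proof
    assume "b = y"
    then show ?thesis using pq2 eb(3) by (intro exI[of _ "{}"] exI[of _ q2]) (auto
        intro!: sum_nonneg w)
  next
    assume "\<exists>c d. v \<le> c \<and> d \<le> b \<and> crossing f c d Q"
    then obtain c d D where D: "v \<le> c" "d \<le> b" "is_path f D" "\<forall>v \<in> set D. c \<le> fst v \<and> fst v \<le> d"
      "(fst (hd D), snd (hd D) + 1) \<notin> vertices_below f" "snd (last D) = 0"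
      "set (path_edges D) \<inter> Q = {}" unfolding crossing_def by auto
    have "conn (A3 \<union> set (path_edges D) \<union> A2) p3 p2"
      using pq3 pq2 le D(1,2) unfolding column_def vertical_line_def
      by (intro crossing_join[OF D(3,5,6,4) eb(3) pq3(3) _ _ _ eb(2) pq2(3)]) auto
    moreover have "conn (A3 \<union> set (path_edges D) \<union> A2) p3 q3" by (rule conn_mono[OF pq3(3)]) auto
    ultimately have "conn (A3 \<union> set (path_edges D) \<union> A2) p2 q3" using conn_sym conn_trans by blast
    then show ?thesis using zero[OF D(7,3) fin(3)] fin eb D(3) pq3
      by (intro exI[of _ "A3 \<union> set (path_edges D)"] exI[of _ q3]) (auto simp: is_path_def)
  qed
  then obtain B3 q where B3: "finite B3" "B3 \<subseteq> edges_below f" "sum w B3 \<le> sum w A3"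
    "q \<in> column f y" "conn (B3 \<union> A2) p2 q" by blast
  let ?A = "B1 \<union> A2 \<union> B3"
  have "conn ?A p q"
    using conn_trans[OF conn_mono[OF B1(5), of ?A] conn_mono[OF B3(5), of ?A]] by auto
  then have "links ?A (column f x) (column f y)" using B1 B3 by (auto simp: links_def)
  then have "strip_time f w x y \<le> sum w ?A"
    using B1 B3 eb fin le by (intro strip_time_le' w) auto
  also have "\<dots> \<le> sum w (B1 \<union> A2) + sum w B3"
    using B1 B3 eb fin w by (subst sum.union_inter[symmetric]) (auto intro!: sum_nonneg)
  also have "sum w (B1 \<union> A2) \<le> sum w B1 + sum w A2"
    using B1 B3 eb fin w by (subst sum.union_inter[symmetric]) (auto intro!: sum_nonneg)
  finally show ?thesis using A1 A2 A3 B1 B3 by linarith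
qed

end


section \<open>Agreement with passage times over paths\<close>

lemma path_edges_append: "path_edges (xs @ y # ys) = path_edges (xs @ [y]) @ path_edges (y # ys)"
proof (induction xs)
  case (Cons x xs)
  then show ?case by (cases xs) (auto simp: path_edges_Cons2 path_edges_single)
qed (simp add: path_edges_single)

lemma path_edges_snoc: "xs \<noteq> [] \<Longrightarrow> path_edges (xs @ [v]) = path_edges xs @ [{last xs, v}]"
proof (induction xs)
  case (Cons x xs)
  then show ?case by (cases xs) (auto simp: path_edges_Cons2 path_edges_single)
qed simp

lemma path_edges_subset: "e \<in> set (path_edges xs) \<Longrightarrow> e \<subseteq> set xs"
proof (induction xs)
  case (Cons x xs)
  then show ?case by (cases xs) (auto simp: path_edges_Cons2 path_edges_single)
qed (simp add: path_edges_def)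

lemma distinct_path_edges: "distinct xs \<Longrightarrow> distinct (path_edges xs)"
proof (induction xs)
  case (Cons x xs)
  then show ?case using path_edges_subset[of "{x, hd xs}" xs]
    by (cases xs) (auto simp: path_edges_Cons2 path_edges_single)
qed (simp add: path_edges_def)

text \<open>Loops are erased on the way: a step back to a visited vertex cuts the list there.
  Distinct vertices make the path time a sum over a set of edges.\<close>

lemma conn_imp_path:
  assumes "conn A x y" "A \<subseteq> edges_below f" "x \<in> vertices_below f"
  shows "\<exists>xs. is_path f xs \<and> hd xs = x \<and> last xs = y \<and> set (path_edges xs) \<subseteq> A \<and> distinct xs"
  using assms(1)
proof (induction rule: conn_induct)
  case refl
  show ?case using assms by (intro exI[of _ "[x]"]) (auto simp: is_path_def path_edges_single)
next
  case (step u v)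
  then obtain xs where xs: "is_path f xs" "hd xs = x" "last xs
      = u" "set (path_edges xs) \<subseteq> A" "distinct xs"
    by blast
  have ne: "xs \<noteq> []" using xs by (simp add: is_path_def)
  have e: "{u, v} \<in> edges_below f" using step assms by auto
  show ?case
  proof (cases "v \<in> set xs")
    case False
    then show ?thesis using xs ne e step
      by (intro exI[of _ "xs @ [v]"]) (auto simp: is_path_def path_edges_snoc edges_below_def)
  next
    case True
    then obtain ys zs where "xs = ys @ v # zs" by (auto simp: in_set_conv_decomp)
    then show ?thesis using xs
      by (intro exI[of _ "ys @ [v]"])
        (auto simp: is_path_def path_edges_append[of ys v zs] hd_append)
  qed
qed

lemma path_time_nonneg:
  assumes w: "\<And>e. e \<in> edges_below f \<Longrightarrow> 0 \<le> w e" and "is_path f xs"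
  shows "0 \<le> path_time w xs"
proof -
  have "set (path_edges xs) \<subseteq> edges_below f" using assms(2) by (simp add: is_path_def)
  then show ?thesis unfolding path_time_def by (intro sum_list_nonneg) (auto intro: w)
qed

lemma sum_set_le_sum_list:
  fixes w :: "'b \<Rightarrow> real"
  assumes "\<And>x. x \<in> set xs \<Longrightarrow> 0 \<le> w x"
  shows "sum w (set xs) \<le> sum_list (map w xs)"
  using assms
proof (induction xs)
  case (Cons x xs)
  then have "sum w (set xs) \<le> sum_list (map w xs)" by simp
  then show ?case using Cons.prems[of x] by (cases "x \<in> set xs") (auto simp: insert_absorb)
qed simp

context below
begin

lemma strip_time_le_path_time:
  assumes w: "\<And>e. e \<in> edges_below f \<Longrightarrow> 0 \<le> w e"
    and xs: "is_path f xs" "hd xs \<in> column f a" "last xs \<in> column f b" and le: "0 \<le> a" "a \<le> b"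
  shows "strip_time f w a b \<le> path_time w xs"
proof -
  have ne: "xs \<noteq> []" and eb: "set (path_edges xs) \<subseteq> edges_below f" using xs
      by (auto simp: is_path_def)
  have "links (set (path_edges xs)) (column f a) (column f b)"
    using xs ne unfolding links_def by (metis conn_path last_in_set)
  then have "strip_time f w a b \<le> sum w (set (path_edges xs))"
    using eb le by (intro strip_time_le' w) auto
  also have "\<dots> \<le> path_time w xs" unfolding path_time_def
    using eb w by (intro sum_set_le_sum_list) auto
  finally show ?thesis .
qed

lemma connected_below:
  assumes "x \<in> vertices_below f" "y \<in> vertices_below f"
  shows "\<exists>xs. is_path f xs \<and> hd xs = x \<and> last xs = y"
proof -
  have down: "conn (edges_below f) (i, j) (i, 0)" if "(i, j) \<in> vertices_below f" for i j
  proof -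
    have "0 \<le> j" using that by (auto simp: vertices_below_def)
    then show ?thesis using that
    proof (induction j rule: int_ge_induct)
      case (step k)
      have k: "(i, k) \<in> vertices_below f" using step by (auto simp: vertices_below_def)
      have "{(i, k + 1), (i, k)} \<in> edges_below f"
        using step k by (auto simp: edges_below_def edges_Z2_iff)
      then show ?case using step.IH[OF k] conn_step[OF conn_refl] conn_trans by blast
    qed simp
  qed
  have axis: "conn (edges_below f) (0, 0) (i, 0)" if "0 \<le> i" for i
    using that
  proof (induction i rule: int_ge_induct)
    case (step k)
    have "{(k, 0), (k + 1, 0)} \<in> edges_below f"
      using step f_nonneg[of "real_of_int k"] f_nonneg[of "real_of_int (k + 1)"]
      by (auto simp: edges_below_def edges_Z2_iff vertices_below_def)
    then show ?case using step conn_step by blast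
  qed simp
  have "conn (edges_below f) z (0, 0)" if "z \<in> vertices_below f" for z
    using down[of "fst z" "snd z"] axis[of "fst z"] that conn_sym conn_trans
    by (metis (no_types, lifting) case_prodD mem_Collect_eq prod.collapse vertices_below_def)
  then have "conn (edges_below f) x y" using assms conn_sym conn_trans by blast
  from conn_imp_path[OF this subset_refl assms(1)] show ?thesis by blast
qed

text \<open>The nested infima of reals need nonempty sets of competitors and lower bounds at each
  level. The edges of a path form a linking set, which counts repetitions only once; conversely a
  minimiser contains a path without repetitions.\<close>

lemma passage_time_between_eq:
  assumes w: "\<And>e. e \<in> edges_below f \<Longrightarrow> 0 \<le> w e" and le: "0 \<le> a" "a \<le> b"
  shows "passage_time_between f w (vertical_line a) (vertical_line b) = strip_time f w a b"
proof -
  let ?P = "\<lambda>x y. {xs. is_path f xs \<and> hd xs = x \<and> last xs = y}"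
  have col: "vertical_line c \<inter> vertices_below f = column f c" for c by (auto simp: column_def)
  have bdd1: "bdd_below (path_time w ` ?P x y)" for x y
    using path_time_nonneg[OF w] by (intro bdd_belowI2[of _ 0]) auto
  have pt0: "0 \<le> passage_time f w x y" if "x \<in> vertices_below f" "y \<in> vertices_below f" for x y
    unfolding passage_time_def using connected_below[OF that] path_time_nonneg[OF w]
    by (intro cINF_greatest) auto
  have ne: "column f a \<noteq> {}" "column f b \<noteq> {}" using axis_in[of a] axis_in[of b] le by auto
  have ptt0: "0 \<le> passage_time_to f w x (vertical_line b)" if "x \<in> vertices_below f" for x
    unfolding passage_time_to_def col using ne pt0[OF that]
    by (intro cINF_greatest) (auto simp: column_def)
  have lower: "strip_time f w a b \<le> passage_time f w x y" if "x \<in> column f a" "y \<in> column f b"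
      for x y
    unfolding passage_time_def
  proof (intro cINF_greatest)
    show "?P x y \<noteq> {}" using connected_below[of x y] that by (auto simp: column_def)
  qed (use that strip_time_le_path_time[OF w _ _ _ le] in auto)
  have bdd2: "bdd_below (passage_time f w x ` column f b)" if "x \<in> vertices_below f" for x
    using pt0[OF that] by (intro bdd_belowI2[of _ 0]) (auto simp: column_def)
  have bdd3: "bdd_below ((\<lambda>x. passage_time_to f w x (vertical_line b)) ` column f a)"
    using ptt0 by (intro bdd_belowI2[of _ 0]) (auto simp: column_def)
  show ?thesis
  proof (rule antisym)
    show "strip_time f w a b \<le> passage_time_between f w (vertical_line a) (vertical_line b)"
      unfolding passage_time_between_def passage_time_to_def col
      using ne lower by (intro cINF_greatest) auto
    obtain A where A: "A \<subseteq> strip f a b" "links A (column f a) (column f b)" "strip_time f w a b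
        = sum w A"
      using strip_time_attained[OF le] by metis
    then obtain x y where xy: "x \<in> column f a" "y \<in> column f b" "conn A x y"
        by (auto simp: links_def)
    have V: "x \<in> vertices_below f" using xy by (auto simp: column_def)
    have Ae: "A \<subseteq> edges_below f" using A strip_subset by blast
    obtain xs where xs: "is_path f xs" "hd xs = x" "last xs
        = y" "set (path_edges xs) \<subseteq> A" "distinct xs"
      using conn_imp_path[OF xy(3) Ae V] by blast
    have "passage_time_between f w (vertical_line a) (vertical_line b)
        \<le> passage_time_to f w x (vertical_line b)"
      unfolding passage_time_between_def col by (rule cINF_lower[OF bdd3 xy(1)])
    also have "\<dots> \<le> passage_time f w x y"
      unfolding passage_time_to_def col by (rule cINF_lower[OF bdd2[OF V] xy(2)])
    also have "\<dots> \<le> path_time w xs"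
      unfolding passage_time_def using xs by (intro cINF_lower[OF bdd1]) auto
    also have "\<dots> = sum w (set (path_edges xs))"
      unfolding path_time_def using distinct_path_edges[OF xs(5)]
          by (rule sum_list_distinct_conv_sum_set)
    also have "\<dots> \<le> sum w A"
      using xs(4) Ae A(1) finite_strip by (intro sum_mono2 w) (auto intro: finite_subset)
    finally show "passage_time_between f w (vertical_line a) (vertical_line b) \<le> strip_time f w a b"
      using A(3) by simp
  qed
qed

text \<open>The assumption \<open>f 0 = 0\<close> reduces column 0 to the origin.\<close>

lemma passage_time_to_eq:
  assumes w: "\<And>e. e \<in> edges_below f \<Longrightarrow> 0 \<le> w e" and "f 0 = 0" "0 \<le> b"
  shows "passage_time_to f w (0, 0) (vertical_line b) = strip_time f w 0 b"
proof -
  have "vertical_line 0 \<inter> vertices_below f = {(0, 0)}"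
    using assms(2) by (auto simp: vertical_line_def vertices_below_def)
  then have "passage_time_between f w (vertical_line 0) (vertical_line b)
      = passage_time_to f w (0, 0) (vertical_line b)"
    unfolding passage_time_between_def by simp
  then show ?thesis using passage_time_between_eq[OF w order_refl assms(3)] by simp
qed

end

section \<open>Exploration of the Bernoulli weights\<close>

definition btime :: "(real \<Rightarrow> real) \<Rightarrow> edge set \<Rightarrow> int \<Rightarrow> int \<Rightarrow> nat" where
  "btime f Q a b = strip_time f (\<lambda>e. of_bool (e \<in> Q)) a b"

text \<open>The edges of the strip that have to be inspected to learn that the explored set is
  \<open>S\<close>.\<close>

definition touching :: "(real \<Rightarrow> real) \<Rightarrow> int \<Rightarrow> int \<Rightarrow> vertex set \<Rightarrow> edge set" where
  "touching f a b S = {e \<in> strip f a b. e \<inter> S \<noteq> {}}"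

definition outer_boundary :: "(real \<Rightarrow> real) \<Rightarrow> int \<Rightarrow> int \<Rightarrow> vertex set \<Rightarrow> vertex set" where
  "outer_boundary f a b S = {y. y \<notin> S \<and> (\<exists>x \<in> S. {x, y} \<in> strip f a b)}"

text \<open>The open ball of radius \<open>m\<close> around column \<open>a\<close> in the
  pseudometric that counts closed edges.\<close>

definition explored :: "(real \<Rightarrow> real) \<Rightarrow> edge set \<Rightarrow> int \<Rightarrow> int \<Rightarrow> nat \<Rightarrow> vertex set" where
  "explored f Q a b m =
     {x. \<exists>A \<subseteq> strip f a b. links A (column f a) {x} \<and> card (A \<inter> Q) < m}"

text \<open>A lower bound on a distance, stated without the minimum, which would range over the
  empty set when \<open>E\<close> does not link \<open>S\<close> to \<open>S'\<close>; the bound is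
  then vacuously true.\<close>

definition far :: "edge set \<Rightarrow> edge set \<Rightarrow> vertex set \<Rightarrow> vertex set \<Rightarrow> nat \<Rightarrow> bool" where
  "far Q E S S' m \<longleftrightarrow> (\<forall>A \<subseteq> E. links A S S' \<longrightarrow> m \<le> card (A \<inter> Q))"

lemma farD: "far Q E S S' m \<Longrightarrow> A \<subseteq> E \<Longrightarrow> links A S S' \<Longrightarrow> m \<le> card (A \<inter> Q)"
  by (simp add: far_def)

lemma far_cong: "far Q E S S' m \<longleftrightarrow> far (Q \<inter> E) E S S' m"
proof -
  have "A \<inter> Q = A \<inter> (Q \<inter> E)" if "A \<subseteq> E" for A using that by auto
  then show ?thesis unfolding far_def by metis
qed

lemma sum_of_bool_card: "finite A \<Longrightarrow> sum (\<lambda>e. of_bool (e \<in> Q)) A = card (A \<inter> Q)"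
  using sum_of_bool_eq[of A "\<lambda>e. e \<in> Q"] by simp

lemma strip_time_cong:
  assumes "\<And>e. e \<in> strip f a b \<Longrightarrow> w e = w' e"
  shows "strip_time f w a b = strip_time f w' a b"
  unfolding strip_time_def using assms by (intro arg_cong[of _ _ Min] image_cong sum.cong) auto

lemma btime_cong: "strip f a b \<subseteq> I \<Longrightarrow> btime f Q a b = btime f (Q \<inter> I) a b"
  unfolding btime_def by (intro strip_time_cong) auto

text \<open>A bound uniform in \<open>Q\<close> and \<open>m\<close> makes the decomposition over
  all possible explored sets a finite sum.\<close>

lemma finite_explored:
  obtains V where "finite V" "\<And>Q m. explored f Q a b m \<subseteq> V"
proof
  have "finite (column f a)"
  proof (rule finite_subset)
    show "column f a \<subseteq> {a} \<times> {0..\<lfloor>f (real_of_int a)\<rfloor>}"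
      by (auto simp: column_def vertical_line_def vertices_below_def le_floor_iff)
  qed simp
  moreover have "finite e" if "e \<in> strip f a b" for e
  proof -
    have "e \<in> edges_Z2" using that by (auto simp: strip_def slab_def edges_below_def)
    then show ?thesis by (auto simp: edges_Z2_def)
  qed
  ultimately show "finite (column f a \<union> \<Union>(strip f a b))" using finite_strip by auto
  show "explored f Q a b m \<subseteq> column f a \<union> \<Union>(strip f a b)" for Q m
  proof
    fix x assume "x \<in> explored f Q a b m"
    then obtain A p where A: "A \<subseteq> strip f a b" "p \<in> column f a" "conn A p x"
      by (auto simp: explored_def links_def)
    from A(3) show "x \<in> column f a \<union> \<Union>(strip f a b)"
      by (induction rule: conn_induct) (use A in auto)
  qed
qed

lemma column_explored: "0 < m \<Longrightarrow> column f a \<subseteq> explored f Q a b m"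
proof
  fix x assume "0 < m" "x \<in> column f a"
  then show "x \<in> explored f Q a b m"
    unfolding explored_def links_def by (auto intro!: exI[of _ "{}"] bexI[of _ x])
qed

text \<open>A set of edges with fewer than \<open>m\<close> members in \<open>Q\<close> reaches only
  vertices of \<open>S\<close>, so its edges touching \<open>S\<close> already suffice, and there
  \<open>Q\<close> and \<open>Q'\<close> agree. For \<open>Q'\<close> it has to be shown along the
  connection, edge by edge, that \<open>S\<close> is never left.\<close>

lemma explored_cong:
  assumes m: "0 < m" and S: "S = explored f Q a b m"
    and Q: "Q \<inter> touching f a b S = Q' \<inter> touching f a b S"
  shows "explored f Q' a b m = S"
proof -
  have card: "card (A \<inter> touching f a b S \<inter> Q) = card (A \<inter> touching f a b S \<inter> Q')" for A
    using Q by (metis inf_assoc inf_commute)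
  have le: "card (A \<inter> touching f a b S \<inter> R) \<le> card (A \<inter> R)" if "A \<subseteq> strip f a b" for A R
    using finite_subset[OF that finite_strip] by (intro card_mono) auto
  show ?thesis
  proof
    show "S \<subseteq> explored f Q' a b m"
    proof
      fix x assume "x \<in> S"
      then obtain A p where A: "A \<subseteq> strip f a b" "p \<in> column f a" "conn A p x" "card (A \<inter> Q) < m"
        by (auto simp: S explored_def links_def)
      let ?A = "A \<inter> touching f a b S"
      from A(3) have "conn ?A p x"
      proof (induction rule: conn_induct)
        case (step u v)
        have "u \<in> S" using A step(1) unfolding S explored_def links_def by blast
        then have "{u, v} \<in> ?A" using step A by (auto simp: touching_def)
        then show ?case using step.IH conn_step by blast
      qed simp
      moreover have "card (?A \<inter> Q') < m" using card[of A] le[OF A(1), of Q] A(4) by simp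
      ultimately show "x \<in> explored f Q' a b m"
        using A(1,2) unfolding explored_def links_def by blast
    qed
    show "explored f Q' a b m \<subseteq> S"
    proof
      fix x assume "x \<in> explored f Q' a b m"
      then obtain A p where A: "A \<subseteq> strip f a b" "p \<in> column f a" "conn A p x" "card (A \<inter> Q') < m"
        by (auto simp: explored_def links_def)
      let ?A = "A \<inter> touching f a b S"
      have cQ: "card (?A \<inter> Q) < m" using card[of A] le[OF A(1), of Q'] A(4) by simp
      from A(3) have "conn ?A p x \<and> x \<in> S"
      proof (induction rule: conn_induct)
        case refl
        then show ?case using column_explored[OF m, of f a Q b] A S by auto
      next
        case (step u v)
        then have "{u, v} \<in> ?A" using A by (auto simp: touching_def)
        then have c: "conn ?A p v" using step.IH conn_step by blast
        moreover have "v \<in> S" using A(1,2) c cQ unfolding S explored_def links_def by blast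
        ultimately show ?case by simp
      qed
      then show "x \<in> S" by simp
    qed
  qed
qed

section \<open>The Bernoulli time in terms of the explored set\<close>

context below
begin

lemma btime_ge_iff:
  assumes "0 \<le> a" "a \<le> b"
  shows "m \<le> btime f Q a b \<longleftrightarrow> far Q (strip f a b) (column f a) (column f b) m"
proof
  assume m: "m \<le> btime f Q a b"
  show "far Q (strip f a b) (column f a) (column f b) m" unfolding far_def
  proof (intro allI impI)
    fix A assume A: "A \<subseteq> strip f a b" "links A (column f a) (column f b)"
    have "finite A" using A finite_strip finite_subset by blast
    then show "m \<le> card (A \<inter> Q)"
      using strip_time_le[OF A, of "\<lambda>e. of_bool (e \<in> Q) :: nat"] m
          by (simp add: btime_def sum_of_bool_card)
  qed
next
  assume far: "far Q (strip f a b) (column f a) (column f b) m"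
  obtain A where A: "A \<subseteq> strip f a b" "links A (column f a) (column f b)"
    "strip_time f (\<lambda>e. of_bool (e \<in> Q) :: nat) a b = sum (\<lambda>e. of_bool (e \<in> Q)) A"
    using strip_time_attained[OF assms] by metis
  have "finite A" using A finite_strip finite_subset by blast
  then show "m \<le> btime f Q a b" using A far by (simp add: btime_def sum_of_bool_card far_def)
qed

lemma btime_ge_iff_explored:
  assumes "0 \<le> a" "a \<le> b"
  shows "m \<le> btime f Q a b \<longleftrightarrow> explored f Q a b m \<inter> column f b = {}"
proof -
  have eq: "links A S S' \<longleftrightarrow> (\<exists>x \<in> S'. links A S {x})" for A S S' by (auto simp: links_def)
  have "far Q (strip f a b) (column f a) (column f b) m \<longleftrightarrow>
      (\<forall>A \<subseteq> strip f a b. \<forall>x \<in> column f b. links A (column f a) {x} \<longrightarrow> \<not> card (A \<inter> Q) < m)"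
    unfolding far_def eq[of _ _ "column f b"] not_less by blast
  also have "\<dots> \<longleftrightarrow> explored f Q a b m \<inter> column f b = {}" unfolding explored_def by blast
  finally show ?thesis unfolding btime_ge_iff[OF assms] .
qed

lemma far_beyond_explored:
  assumes "0 \<le> a" "a \<le> b" and bt: "m + n \<le> btime f Q a b" and S: "S = explored f Q a b m"
  shows "far Q (strip f a b - touching f a b S) (outer_boundary f a b S) (column f b) n"
  unfolding far_def
proof (intro allI impI)
  fix A assume A: "A \<subseteq> strip f a b - touching f a b S"
    and l: "links A (outer_boundary f a b S) (column f b)"
  from l obtain x y q where xy: "x \<in> S" "{x, y} \<in> strip f a b" "q \<in> column f b" "conn A y q"
    by (auto simp: links_def outer_boundary_def)
  obtain A0 p where A0: "A0 \<subseteq> strip f a b" "p \<in> column f a" "conn A0 p x" "card (A0 \<inter> Q) < m"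
    using xy(1) by (auto simp: S explored_def links_def)
  let ?B = "A0 \<union> {{x, y}} \<union> A"
  have "conn ?B p x" by (rule conn_mono[OF A0(3)]) auto
  then have "conn ?B p y" by (rule conn_step) auto
  moreover have "conn ?B y q" by (rule conn_mono[OF xy(4)]) auto
  ultimately have "links ?B (column f a) (column f b)"
    using A0(2) xy(3) conn_trans unfolding links_def by blast
  then have "m + n \<le> card (?B \<inter> Q)"
    using A A0(1) xy(2) by (intro farD[OF bt[unfolded btime_ge_iff[OF assms(1,2)]]]) blast+
  also have "?B \<inter> Q = A0 \<inter> Q \<union> ({{x, y}} \<inter> Q \<union> A \<inter> Q)" by auto
  also have "card \<dots> \<le> card (A0 \<inter> Q) + (card ({{x, y}} \<inter> Q) + card (A \<inter> Q))"
    by (meson card_Un_le order_trans add_left_mono)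
  \<comment> \<open>The edge leaving \<open>S\<close> may be closed; its cost is covered by the
    strict inequality in \<open>explored\<close>.\<close>
  also have "card ({{x, y}} \<inter> Q) \<le> 1" using card_mono[of "{{x, y}}" "{{x, y}} \<inter> Q"] by simp
  finally show "n \<le> card (A \<inter> Q)" using A0(4) by simp
qed

text \<open>Follow a connection backwards from column \<open>b\<close>. Before the edge that enters
  \<open>S\<close> for the first time it uses no edge touching \<open>S\<close>, and the vertex from
  which it enters belongs to the outer boundary.\<close>

lemma far_imp_btime_ge:
  assumes "0 \<le> a" "a \<le> b" and S: "column f a \<subseteq> S" "S \<inter> column f b = {}"
    and far: "far Q (strip f a b - touching f a b S) (outer_boundary f a b S) (column f b) n"
  shows "n \<le> btime f Q a b"
  unfolding btime_ge_iff[OF assms(1,2)] far_def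
proof (intro allI impI)
  fix A assume A: "A \<subseteq> strip f a b" and l: "links A (column f a) (column f b)"
  then obtain p q where pq: "p \<in> column f a" "q \<in> column f b" "conn A p q" by (auto simp: links_def)
  let ?B = "A - touching f a b S"
  have "(conn ?B q p \<and> p \<notin> S) \<or> (\<exists>y \<in> outer_boundary f a b S. conn ?B q y)"
    using conn_sym[OF pq(3)]
  proof (induction rule: conn_induct)
    case refl
    then show ?case using S pq by auto
  next
    case (step u v)
    from step(3) show ?case
    proof
      assume u: "conn ?B q u \<and> u \<notin> S"
      have e: "{v, u} \<in> strip f a b" using step(2) A by (auto simp: insert_commute)
      show ?thesis
      proof (cases "v \<in> S")
        case True
        then have "u \<in> outer_boundary f a b S" using u e by (auto simp: outer_boundary_def)
        then show ?thesis using u by blast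
      next
        case False
        then have "{u, v} \<in> ?B" using u step(2) by (auto simp: touching_def)
        then have "conn ?B q v" using u conn_step by blast
        then show ?thesis using False by simp
      qed
    qed auto
  qed
  then obtain y where y: "y \<in> outer_boundary f a b S" "conn ?B q y" using S pq by auto
  then have "links ?B (outer_boundary f a b S) (column f b)"
    using conn_sym pq unfolding links_def by blast
  moreover have "?B \<subseteq> strip f a b - touching f a b S" using A by blast
  ultimately have "n \<le> card (?B \<inter> Q)" using farD[OF far] by blast
  also have "\<dots> \<le> card (A \<inter> Q)"
    using finite_subset[OF A finite_strip] by (intro card_mono) auto
  finally show "n \<le> card (A \<inter> Q)" .
qed

end

section \<open>Random weights\<close>

lemma (in prob_space) prob_closed_set:
  fixes X :: "edge \<Rightarrow> 'a \<Rightarrow> real"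
  assumes ind: "indep_vars (\<lambda>_. borel) X edges_Z2"
    and q: "\<And>e. e \<in> edges_Z2 \<Longrightarrow> prob {\<omega> \<in> space M. 0 < X e \<omega>} = q"
    and I: "finite I" "I \<subseteq> edges_Z2" and A: "A \<subseteq> I"
  shows "{\<omega> \<in> space M. {e \<in> I. 0 < X e \<omega>} = A} \<in> events"
    and "prob {\<omega> \<in> space M. {e \<in> I. 0 < X e \<omega>} = A} = q ^ card A * (1 - q) ^ card (I - A)"
proof -
  have rv: "random_variable borel (X e)" if "e \<in> edges_Z2" for e
    using ind that by (auto simp: indep_vars_def)
  define B :: "edge \<Rightarrow> real set" where "B = (\<lambda>e. if e \<in> A then {0<..} else {..0})"
  have B: "{\<omega> \<in> space M. X e \<omega> \<in> B e} \<in> events" if "e \<in> I" for e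
    using rv[of e] I that by (auto simp: B_def)
  have eq: "{\<omega> \<in> space M. {e \<in> I. 0 < X e \<omega>} = A} = {\<omega> \<in> space M. \<forall>e \<in> I. X e \<omega> \<in> B e}"
    using A by (auto simp: B_def not_less split: if_splits)
  show "{\<omega> \<in> space M. {e \<in> I. 0 < X e \<omega>} = A} \<in> events"
    unfolding eq using B I by (intro sets.sets_Collect_finite_All) auto
  have q': "prob {\<omega> \<in> space M. X e \<omega> \<in> B e} = (if e \<in> A then q else 1 - q)" if e: "e \<in> I" for e
  proof (cases "e \<in> A")
    case True
    then show ?thesis using q[of e] e I by (auto simp: B_def)
  next
    case False
    have "{\<omega> \<in> space M. X e \<omega> \<in> B e} = space M - {\<omega> \<in> space M. 0 < X e \<omega>}"
      using False by (auto simp: B_def)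
    moreover have "{\<omega> \<in> space M. 0 < X e \<omega>} \<in> events" using rv[of e] I e by auto
    ultimately show ?thesis using q[of e] e I False by (auto simp: prob_compl)
  qed
  show "prob {\<omega> \<in> space M. {e \<in> I. 0 < X e \<omega>} = A} = q ^ card A * (1 - q) ^ card (I - A)"
  proof (cases "I = {}")
    case True
    then show ?thesis using A by (simp add: prob_space)
  next
    case False
    have "{\<omega> \<in> space M. \<forall>e \<in> I. X e \<omega> \<in> B e} = (\<Inter>e\<in>I. X e -` B e \<inter> space M)"
      using False by auto
    also have "prob \<dots> = (\<Prod>e\<in>I. prob (X e -` B e \<inter> space M))"
      using False I by (intro indep_varsD[OF ind]) (auto simp: B_def)
    also have "\<dots> = (\<Prod>e\<in>I. if e \<in> A then q else 1 - q)"
      using q' by (intro prod.cong) (auto simp: vimage_def Int_def conj_commute)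
    also have "\<dots> = q ^ card A * (1 - q) ^ card (I - A)"
      using I A by (simp add: prod.If_cases Int_absorb1 Diff_eq)
    finally show ?thesis unfolding eq .
  qed
qed

text \<open>The point of the formula is that its right-hand side involves the weights only through
  \<open>q\<close>, so that two families of weights can be compared by it.\<close>

lemma (in prob_space) expectation_closed_set:
  fixes X :: "edge \<Rightarrow> 'a \<Rightarrow> real" and \<phi> :: "edge set \<Rightarrow> real"
  assumes ind: "indep_vars (\<lambda>_. borel) X edges_Z2"
    and q: "\<And>e. e \<in> edges_Z2 \<Longrightarrow> prob {\<omega> \<in> space M. 0 < X e \<omega>} = q"
    and I: "finite I" "I \<subseteq> edges_Z2"
  shows "expectation (\<lambda>\<omega>. \<phi> {e \<in> I. 0 < X e \<omega>})
    = (\<Sum>A\<in>Pow I. \<phi> A * (q ^ card A * (1 - q) ^ card (I - A)))"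
proof -
  let ?E = "\<lambda>A. {\<omega> \<in> space M. {e \<in> I. 0 < X e \<omega>} = A}"
  note ev = prob_closed_set[OF ind q I]
  have "expectation (\<lambda>\<omega>. \<phi> {e \<in> I. 0 < X e \<omega>})
      = expectation (\<lambda>\<omega>. \<Sum>A\<in>Pow I. \<phi> A * indicator (?E A) \<omega>)"
  proof (intro Bochner_Integration.integral_cong refl)
    fix \<omega> assume w: "\<omega> \<in> space M"
    have "(\<Sum>A\<in>Pow I. \<phi> A * indicator (?E A) \<omega>)
        = (\<Sum>A\<in>Pow I. if A = {e \<in> I. 0 < X e \<omega>} then \<phi> A else 0)"
      using w by (intro sum.cong) (auto simp: indicator_def)
    also have "\<dots> = \<phi> {e \<in> I. 0 < X e \<omega>}" using I by (subst sum.delta) auto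
    finally show "\<phi> {e \<in> I. 0 < X e \<omega>} = (\<Sum>A\<in>Pow I. \<phi> A * indicator (?E A) \<omega>)" by simp
  qed
  also have "\<dots> = (\<Sum>A\<in>Pow I. \<phi> A * prob (?E A))"
  proof -
    have "integrable M (\<lambda>\<omega>. \<phi> A * indicator (?E A) \<omega>)" if "A \<in> Pow I" for A
      using ev(1)[of A] that by (intro integrable_mult_right integrable_real_indicator) (auto
          simp: emeasure_eq_measure)
    then show ?thesis using ev(1)
      by (subst Bochner_Integration.integral_sum) (auto intro!: sum.cong simp:
          Int_absorb2 sets.sets_into_space)
  qed
  also have "\<dots> = (\<Sum>A\<in>Pow I. \<phi> A * (q ^ card A * (1 - q) ^ card (I - A)))"
    using ev(2) by (intro sum.cong) auto
  finally show ?thesis .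
qed

text \<open>
  The assumption \<open>F 0 = F \<delta>\<close> means that a weight either vanishes or exceeds \<open>\<delta>\<close>; \<open>q\<close> is the
  probability of the second alternative, and \<open>s\<close> bounds the second moments of the weights.
\<close>

locale fpp = below f + prob_space M for f :: "real \<Rightarrow> real" and M :: "'a measure" +
  fixes \<tau> :: "edge \<Rightarrow> 'a \<Rightarrow> real" and \<delta> q s :: real
  assumes indep: "indep_vars (\<lambda>_. borel) \<tau> edges_Z2"
    and \<delta>_pos: "0 < \<delta>" and q_pos: "0 < q" and s_nonneg: "0 \<le> s"
    and weight_values: "e \<in> edges_Z2 \<Longrightarrow> \<tau> e \<omega> = 0 \<or> \<delta> < \<tau> e \<omega>"
    and prob_pos: "e \<in> edges_Z2 \<Longrightarrow> prob {\<omega> \<in> space M. 0 < \<tau> e \<omega>} = q"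
    and second_moment: "e \<in> edges_Z2 \<Longrightarrow> (\<integral>\<^sup>+\<omega>. ennreal ((\<tau> e \<omega>)\<^sup>2) \<partial>M) \<le> ennreal s"
begin

section \<open>Random variables determined by the weights of a set of edges\<close>

lemma measurable_weight: "e \<in> edges_Z2 \<Longrightarrow> random_variable borel (\<tau> e)"
  using indep by (auto simp: indep_vars_def)

lemma weight_nonneg: "e \<in> edges_Z2 \<Longrightarrow> 0 \<le> \<tau> e \<omega>"
  using weight_values[of e \<omega>] \<delta>_pos by linarith

lemma weight_nonneg': "e \<in> edges_below f \<Longrightarrow> 0 \<le> \<tau> e \<omega>"
  using weight_nonneg edges_below_subset by blast

definition closed_edges :: "'a \<Rightarrow> edge set" where
  "closed_edges \<omega> = {e \<in> edges_Z2. 0 < \<tau> e \<omega>}"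

definition T :: "int \<Rightarrow> int \<Rightarrow> 'a \<Rightarrow> real" where
  "T a b \<omega> = strip_time f (\<lambda>e. \<tau> e \<omega>) a b"

definition B :: "int \<Rightarrow> int \<Rightarrow> 'a \<Rightarrow> nat" where
  "B a b \<omega> = btime f (closed_edges \<omega>) a b"

text \<open>An explicit measurable factorisation, valid at every point, so that independence follows
  from disjointness of the edge sets.\<close>

definition based_on :: "edge set \<Rightarrow> 'b measure \<Rightarrow> ('a \<Rightarrow> 'b) \<Rightarrow> bool" where
  "based_on I N X \<longleftrightarrow> (\<exists>g \<in> measurable (PiM I (\<lambda>_. borel)) N.
     \<forall>\<omega>. X \<omega> = g (restrict (\<lambda>e. \<tau> e \<omega>) I))"

lemma based_onI:
  assumes "g \<in> measurable (PiM I (\<lambda>_. borel)) N" "\<And>\<omega>. X \<omega> = g (restrict (\<lambda>e. \<tau> e \<omega>) I)"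
  shows "based_on I N X"
  using assms unfolding based_on_def by blast

lemma based_on_mono: "based_on I N X \<Longrightarrow> I \<subseteq> J \<Longrightarrow> based_on J N X"
proof -
  assume "based_on I N X" and IJ: "I \<subseteq> J"
  then obtain g where g: "g \<in> measurable (PiM I (\<lambda>_. borel)) N"
    "\<And>\<omega>. X \<omega> = g (restrict (\<lambda>e. \<tau> e \<omega>) I)" unfolding based_on_def by blast
  show "based_on J N X"
  proof (rule based_onI)
    show "(\<lambda>w. g (restrict w I)) \<in> measurable (PiM J (\<lambda>_. borel)) N"
      by (rule measurable_compose[OF measurable_restrict_subset[OF IJ] g(1)])
    show "X \<omega> = g (restrict (restrict (\<lambda>e. \<tau> e \<omega>) J) I)" for \<omega>
      using g(2) IJ by (simp add: Int_absorb1)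
  qed
qed

lemma based_on_compose: "based_on I N X \<Longrightarrow> h \<in> measurable N N' \<Longrightarrow> based_on I N' (\<lambda>\<omega>. h (X \<omega>))"
  unfolding based_on_def by (auto intro: measurable_compose)

lemma based_on_pair:
  assumes "based_on I N X" "based_on I N' Y"
  shows "based_on I (N \<Otimes>\<^sub>M N') (\<lambda>\<omega>. (X \<omega>, Y \<omega>))"
proof -
  obtain g where g: "g \<in> measurable (PiM I (\<lambda>_. borel)) N"
    "\<And>\<omega>. X \<omega> = g (restrict (\<lambda>e. \<tau> e \<omega>) I)" using assms(1) unfolding based_on_def by blast
  obtain h where h: "h \<in> measurable (PiM I (\<lambda>_. borel)) N'"
    "\<And>\<omega>. Y \<omega> = h (restrict (\<lambda>e. \<tau> e \<omega>) I)" using assms(2) unfolding based_on_def by blast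
  show ?thesis
    by (rule based_onI[of "\<lambda>w. (g w, h w)"]) (use g h in auto)
qed

lemma based_on_add:
  fixes X Y :: "'a \<Rightarrow> real"
  assumes "based_on I borel X" "based_on I borel Y"
  shows "based_on I borel (\<lambda>\<omega>. X \<omega> + Y \<omega>)"
proof -
  have "based_on I borel (\<lambda>\<omega>. (\<lambda>p. fst p + snd p :: real) (X \<omega>, Y \<omega>))"
    by (rule based_on_compose[OF based_on_pair[OF assms]]) measurable
  then show ?thesis by simp
qed

lemma based_on_measurable: "I \<subseteq> edges_Z2 \<Longrightarrow> based_on I N X \<Longrightarrow> random_variable N X"
proof -
  assume I: "I \<subseteq> edges_Z2" and "based_on I N X"
  then obtain g where g: "g \<in> measurable (PiM I (\<lambda>_. borel)) N"
    "\<And>\<omega>. X \<omega> = g (restrict (\<lambda>e. \<tau> e \<omega>) I)" unfolding based_on_def by blast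
  have "(\<lambda>\<omega>. restrict (\<lambda>e. \<tau> e \<omega>) I) \<in> measurable M (PiM I (\<lambda>_. borel))"
    using I by (intro measurable_restrict measurable_weight) auto
  moreover have "X = (\<lambda>\<omega>. g (restrict (\<lambda>e. \<tau> e \<omega>) I))" using g(2) by (rule ext)
  ultimately show ?thesis using measurable_compose g(1) by metis
qed

lemma based_on_weight: "based_on {e} borel (\<tau> e)"
  by (rule based_onI[of "\<lambda>w. w e"]) auto

lemma indep_var_based:
  assumes "based_on I N X" "based_on J N' Y" "I \<inter> J = {}" "I \<subseteq> edges_Z2" "J \<subseteq> edges_Z2"
  shows "indep_var N X N' Y"
proof -
  obtain g where g: "g \<in> measurable (PiM I (\<lambda>_. borel)) N"
    "\<And>\<omega>. X \<omega> = g (restrict (\<lambda>e. \<tau> e \<omega>) I)" using assms(1) unfolding based_on_def by blast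
  obtain h where h: "h \<in> measurable (PiM J (\<lambda>_. borel)) N'"
    "\<And>\<omega>. Y \<omega> = h (restrict (\<lambda>e. \<tau> e \<omega>) J)" using assms(2) unfolding based_on_def by blast
  have "indep_var N (g \<circ> (\<lambda>\<omega>. restrict (\<lambda>e. \<tau> e \<omega>) I)) N' (h \<circ> (\<lambda>\<omega>. restrict (\<lambda>e. \<tau> e \<omega>) J))"
    by (rule indep_var_compose[OF indep_var_restrict[OF indep assms(3-5)] g(1) h(1)])
  moreover have "g \<circ> (\<lambda>\<omega>. restrict (\<lambda>e. \<tau> e \<omega>) I) = X" "h \<circ> (\<lambda>\<omega>. restrict (\<lambda>e. \<tau> e \<omega>) J) = Y"
    using g h by auto
  ultimately show ?thesis by simp
qed

text \<open>The set of closed edges inside \<open>I\<close> takes finitely many values, so every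
  function of it is measurable.\<close>

lemma based_on_closed_edges:
  assumes I: "finite I" "I \<subseteq> edges_Z2" and \<phi>: "\<And>Q. \<phi> Q = \<phi> (Q \<inter> I)" and N: "space N = UNIV"
  shows "based_on I N (\<lambda>\<omega>. \<phi> (closed_edges \<omega>))"
proof (rule based_onI)
  let ?P = "PiM I (\<lambda>_. borel) :: (edge \<Rightarrow> real) measure"
  define c where "c = (\<lambda>w :: edge \<Rightarrow> real. {e \<in> I. 0 < w e})"
  have "c \<in> measurable ?P (count_space (Pow I))"
  proof (subst measurable_count_space_eq2)
    show "finite (Pow I)" using I by simp
    have "c -` {A} \<inter> space ?P \<in> sets ?P" if A: "A \<subseteq> I" for A
    proof -
      have "c -` {A} \<inter> space ?P = {w \<in> space ?P. \<forall>e \<in> I. if e \<in> A then 0 < w e else \<not> 0 < w e}"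
        using A by (auto simp: c_def split: if_splits)
      also have "\<dots> \<in> sets ?P"
      proof (intro sets.sets_Collect_finite_All I(1))
        fix e assume e: "e \<in> I"
        have [measurable]: "(\<lambda>w. w e) \<in> borel_measurable ?P" using e by measurable
        show "{w \<in> space ?P. if e \<in> A then 0 < w e else \<not> 0 < w e} \<in> sets ?P"
          by (cases "e \<in> A") auto
      qed
      finally show ?thesis .
    qed
    then show "c \<in> space ?P \<rightarrow> Pow I \<and> (\<forall>a\<in>Pow I. c -` {a} \<inter> space ?P \<in> sets ?P)"
      by (auto simp: c_def)
  qed
  moreover have "\<phi> \<in> measurable (count_space (Pow I)) N" using N by simp
  ultimately show "(\<lambda>w. \<phi> (c w)) \<in> measurable ?P N" by (rule measurable_compose)
  show "\<phi> (closed_edges \<omega>) = \<phi> (c (\<lambda>e\<in>I. \<tau> e \<omega>))" for \<omega>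
  proof -
    have "closed_edges \<omega> \<inter> I = c (\<lambda>e\<in>I. \<tau> e \<omega>)" using I by (auto simp: c_def closed_edges_def)
    then show ?thesis using \<phi>[of "closed_edges \<omega>"] by simp
  qed
qed

lemma based_on_B: "strip f a b \<subseteq> I \<Longrightarrow> finite I \<Longrightarrow> I \<subseteq> edges_Z2 \<Longrightarrow> space N = UNIV \<Longrightarrow>
    based_on I N (\<lambda>\<omega>. h (B a b \<omega>))"
  unfolding B_def
  by (rule based_on_closed_edges) (auto intro!: arg_cong[of _ _ h] btime_cong)

lemma strip_edges_Z2: "strip f a b \<subseteq> edges_Z2"
  using strip_subset edges_below_subset by blast

lemma slab_edges_Z2: "slab f a b \<subseteq> edges_Z2"
  using slab_subset edges_below_subset by blast

lemma based_on_T: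
  shows "based_on (strip f a b) borel (T a b)"
proof (rule based_onI)
  let ?S = "{A. A \<subseteq> strip f a b \<and> links A (column f a) (column f b)}"
  have fin: "finite ?S" by (rule finite_subset[of _ "Pow (strip f a b)"]) (auto simp: finite_strip)
  have "(\<lambda>w. Min ((\<lambda>A. sum w A) ` ?S)) \<in> borel_measurable (PiM (strip f a b) (\<lambda>_. borel ::
      real measure))"
  proof (rule borel_measurable_Min[OF fin, of "\<lambda>A w. sum w A"])
    fix A assume A: "A \<in> ?S"
    show "(\<lambda>w. sum w A) \<in> borel_measurable (PiM (strip f a b) (\<lambda>_. borel :: real measure))"
      using A by (intro borel_measurable_sum measurable_component_singleton) auto
  qed
  then show "(\<lambda>w. strip_time f w a b) \<in> borel_measurable (PiM (strip f a b) (\<lambda>_. borel ::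
      real measure))"
    unfolding strip_time_def .
  show "T a b \<omega> = strip_time f (\<lambda>e\<in>strip f a b. \<tau> e \<omega>) a b" for \<omega>
    unfolding T_def by (rule strip_time_cong) auto
qed

lemma measurable_T [measurable]: "random_variable borel (T a b)"
  using based_on_measurable[OF strip_edges_Z2 based_on_T] by blast

lemma measurable_B: "space N = UNIV \<Longrightarrow> random_variable N (\<lambda>\<omega>. h (B a b \<omega>))"
  by (rule based_on_measurable[OF strip_edges_Z2 based_on_B[OF subset_refl]])
    (auto simp: finite_strip strip_edges_Z2)

lemma prob_indep_based:
  assumes "based_on I (count_space UNIV) P" "based_on J (count_space UNIV) R"
    and IJ: "I \<inter> J = {}" "I \<subseteq> edges_Z2" "J \<subseteq> edges_Z2"
  shows "prob {\<omega> \<in> space M. P \<omega> \<and> R \<omega>} = prob {\<omega> \<in> space M. P \<omega>} * prob {\<omega> \<in> space M. R \<omega>}"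
  using prob_indep_random_variable[OF indep_var_based[OF assms], of "{True}" "{True}"]
  by simp

end

section \<open>Moments of the Bernoulli passage times\<close>

text \<open>The series is dominated by the fourth formal derivative of the geometric series, whose
  coefficients are \<open>(n + 1) (n + 2) (n + 3) (n + 4)\<close>.\<close>

lemma summable_power4_geometric:
  fixes x :: real
  assumes "0 \<le> x" "x < 1"
  shows "summable (\<lambda>n. (real n + 1) ^ 4 * x ^ n)"
proof -
  have 0: "summable (\<lambda>n. (\<lambda>_. 1) n * y ^ n)" if "norm y < 1" for y :: real
    using that by (simp add: summable_geometric)
  have 1: "summable (\<lambda>n. diffs c n * y ^ n)"
    if "\<forall>y. norm y < 1 \<longrightarrow> summable (\<lambda>n. c n * y ^ n)" "norm y < 1"
    for c and y :: real
    using that termdiff_converges[of y 1 c] by blast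
  have "summable (\<lambda>n. diffs (diffs (diffs (diffs (\<lambda>_. 1)))) n * x ^ n)"
    using assms by (intro 1 allI impI 0) auto
  then show ?thesis
  proof (rule summable_comparison_test'[where N = 0])
    fix n :: nat
    let ?r = "real n + 1"
    have "?r ^ 4 = ?r * (?r * (?r * ?r))" by (simp add: power4_eq_xxxx)
    also have "\<dots> \<le> ?r * ((?r + 1) * ((?r + 2) * (?r + 3)))"
      by (intro mult_mono) auto
    also have "\<dots> = diffs (diffs (diffs (diffs (\<lambda>_. 1 :: real)))) n"
      by (simp add: diffs_def algebra_simps)
    finally show "norm (?r ^ 4 * x ^ n) \<le> diffs (diffs (diffs (diffs (\<lambda>_. 1)))) n * x ^ n"
      using assms by (simp add: mult_right_mono)
  qed
qed

lemma (in prob_space) indep_var_nn_integral: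
  fixes X Y :: "'a \<Rightarrow> ennreal"
  assumes "indep_var borel X borel Y"
  shows "(\<integral>\<^sup>+\<omega>. X \<omega> * Y \<omega> \<partial>M) = (\<integral>\<^sup>+\<omega>. X \<omega> \<partial>M) * (\<integral>\<^sup>+\<omega>. Y \<omega> \<partial>M)"
proof -
  have b: "(\<lambda>_. borel) = case_bool borel borel" by (rule ext) (simp split: bool.split)
  have "indep_vars (\<lambda>_. borel) (case_bool X Y) UNIV" using assms unfolding indep_var_def b .
  from indep_vars_nn_integral[OF finite this] show ?thesis by (simp add: UNIV_bool mult.commute)
qed

lemma term_le_suminf: "g j \<le> suminf g" for g :: "nat \<Rightarrow> ennreal"
  using sum_le_suminf[of g "{j}"] by simp

context fpp
begin

text \<open>Decompose by the value \<open>S\<close> of the explored set. This value is decided by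
  the edges touching \<open>S\<close>, and the cost beyond \<open>S\<close> by the remaining edges,
  so the probabilities factorise. A cost of at least \<open>n\<close> beyond \<open>S\<close> forces
  the whole time to be at least \<open>n\<close>, which bounds the second factor uniformly in
  \<open>S\<close>.\<close>

lemma B_submultiplicative:
  assumes ab: "0 \<le> a" "a \<le> b"
  shows "prob {\<omega> \<in> space M. m + n \<le> B a b \<omega>}
    \<le> prob {\<omega> \<in> space M. m \<le> B a b \<omega>} * prob {\<omega> \<in> space M. n \<le> B a b \<omega>}"
proof (cases "m = 0")
  case True
  then show ?thesis by (simp add: prob_space)
next
  case False
  then have m: "0 < m" by simp
  obtain V where V: "finite V" "\<And>Q m. explored f Q a b m \<subseteq> V" using finite_explored[of f a b]
      by blast
  let ?E = "strip f a b"
  let ?t = "\<lambda>S. touching f a b S"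
  \<comment> \<open>The sets \<open>S\<close> that can occur when the time is at least
    \<open>m\<close>, that is, when the exploration at level \<open>m\<close> does not reach column
    \<open>b\<close>.\<close>
  define K where "K = {S \<in> Pow V. column f a \<subseteq> S \<and> S \<inter> column f b = {}}"
  have K: "finite K" using V by (simp add: K_def)
  define P where "P = (\<lambda>S Q. explored f Q a b m = S)"
  define R where "R = (\<lambda>S Q. far Q (?E - ?t S) (outer_boundary f a b S) (column f b) n)"
  have tE: "?t S \<subseteq> ?E" for S by (auto simp: touching_def)
  have fin: "finite (?t S)" "finite (?E - ?t S)" for S
    using finite_subset[OF tE finite_strip] finite_strip by auto
  have tZ: "?t S \<subseteq> edges_Z2" and EZ: "?E - ?t S \<subseteq> edges_Z2" for S
    using tE strip_edges_Z2 by blast+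
  have P_loc: "P S Q = P S (Q \<inter> ?t S)" for S Q
  proof
    have t: "Q \<inter> ?t S = Q \<inter> ?t S \<inter> ?t S" by simp
    show "P S Q \<Longrightarrow> P S (Q \<inter> ?t S)"
      unfolding P_def by (rule explored_cong[OF m _ t]) simp
    show "P S (Q \<inter> ?t S) \<Longrightarrow> P S Q"
      unfolding P_def by (rule explored_cong[OF m _ t[symmetric]]) simp
  qed
  have R_loc: "R S Q = R S (Q \<inter> (?E - ?t S))" for S Q
    unfolding R_def by (rule far_cong)
  have bP: "based_on (?t S) (count_space UNIV) (\<lambda>\<omega>. P S (closed_edges \<omega>))" for S
    using P_loc fin tZ by (intro based_on_closed_edges) auto
  have bR: "based_on (?E - ?t S) (count_space UNIV) (\<lambda>\<omega>. R S (closed_edges \<omega>))" for S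
    using R_loc fin EZ by (intro based_on_closed_edges) auto
  have mP: "{\<omega> \<in> space M. P S (closed_edges \<omega>)} \<in> events" for S
    using based_on_measurable[OF tZ bP, of S] by (simp add: pred_def)
  have mR: "{\<omega> \<in> space M. R S (closed_edges \<omega>)} \<in> events" for S
    using based_on_measurable[OF EZ bR, of S] by (simp add: pred_def)
  have mB: "{\<omega> \<in> space M. k \<le> B a b \<omega>} \<in> events" for k
    using measurable_B[of "count_space UNIV" "\<lambda>j. k \<le> j" a b] by (simp add: pred_def)
  have disj: "disjoint_family_on (\<lambda>S. {\<omega> \<in> space M. P S (closed_edges \<omega>)}) K"
    by (auto simp: disjoint_family_on_def P_def)
  have "prob {\<omega> \<in> space M. m + n \<le> B a b \<omega>}
      \<le> prob (\<Union>S\<in>K. {\<omega> \<in> space M. P S (closed_edges \<omega>) \<and> R S (closed_edges \<omega>)})"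
  proof (intro finite_measure_mono)
    show "{\<omega> \<in> space M. m + n \<le> B a b \<omega>}
        \<subseteq> (\<Union>S\<in>K. {\<omega> \<in> space M. P S (closed_edges \<omega>) \<and> R S (closed_edges \<omega>)})"
    proof
      fix \<omega> assume w: "\<omega> \<in> {\<omega> \<in> space M. m + n \<le> B a b \<omega>}"
      define S where "S = explored f (closed_edges \<omega>) a b m"
      have bt: "m + n \<le> btime f (closed_edges \<omega>) a b" using w by (simp add: B_def)
      then have "m \<le> btime f (closed_edges \<omega>) a b" by simp
      then have "S \<in> K"
        using V(2) column_explored[OF m] unfolding btime_ge_iff_explored[OF ab]
            by (auto simp: K_def S_def)
      moreover have "R S (closed_edges \<omega>)"
        unfolding R_def by (rule far_beyond_explored[OF ab bt S_def])
      ultimately show "\<omega> \<in> (\<Union>S\<in>K. {\<omega> \<in> space M. P S (closed_edges \<omega>) \<and> R S (closed_edges \<omega>)})"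
        using w by (auto simp: P_def S_def)
    qed
    show "(\<Union>S\<in>K. {\<omega> \<in> space M. P S (closed_edges \<omega>) \<and> R S (closed_edges \<omega>)}) \<in> events"
      using K mP mR by (intro sets.finite_UN sets.sets_Collect_conj) auto
  qed
  also have "\<dots> \<le> (\<Sum>S\<in>K. prob {\<omega> \<in> space M. P S (closed_edges \<omega>) \<and> R S (closed_edges \<omega>)})"
    using K mP mR by (intro finite_measure_subadditive_finite) (auto intro!: sets.sets_Collect_conj)
  also have "\<dots> = (\<Sum>S\<in>K. prob {\<omega> \<in> space M. P S (closed_edges \<omega>)} * prob {\<omega> \<in> space M. R
      S (closed_edges \<omega>)})"
    using tZ EZ by (intro sum.cong refl prob_indep_based[OF bP bR]) auto
  also have "\<dots> \<le> (\<Sum>S\<in>K. prob {\<omega> \<in> space M. P S (closed_edges \<omega>)} * prob {\<omega> \<in> space M. n \<le> B a b \<omega>})"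
  proof (intro sum_mono mult_left_mono finite_measure_mono mB)
    fix S assume "S \<in> K"
    then show "{\<omega> \<in> space M. R S (closed_edges \<omega>)} \<subseteq> {\<omega> \<in> space M. n \<le> B a b \<omega>}"
      using far_imp_btime_ge[OF ab, of S] by (auto simp: K_def R_def B_def)
  qed simp
  also have "\<dots> = prob (\<Union>S\<in>K. {\<omega> \<in> space M. P S (closed_edges \<omega>)}) * prob {\<omega> \<in> space M. n \<le> B a b \<omega>}"
    using K mP disj by (subst finite_measure_finite_Union) (auto simp: sum_distrib_right)
  also have "\<dots> \<le> prob {\<omega> \<in> space M. m \<le> B a b \<omega>} * prob {\<omega> \<in> space M. n \<le> B a b \<omega>}"
    using mB by (intro mult_right_mono finite_measure_mono)
      (auto simp: K_def P_def B_def btime_ge_iff_explored[OF ab])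
  finally show ?thesis .
qed

lemma B_bounded: "0 \<le> a \<Longrightarrow> a \<le> b \<Longrightarrow> B a b \<omega> \<le> card (strip f a b)"
proof -
  assume ab: "0 \<le> a" "a \<le> b"
  have "B a b \<omega> \<le> (\<Sum>e\<in>strip f a b. of_bool (e \<in> closed_edges \<omega>))"
    unfolding B_def btime_def by (rule strip_time_le[OF subset_refl strip_links[OF ab]])
  also have "\<dots> \<le> (\<Sum>e\<in>strip f a b. 1)" by (intro sum_mono) auto
  finally show ?thesis by simp
qed

lemma integrable_B:
  fixes h :: "nat \<Rightarrow> real"
  assumes "0 \<le> a" "a \<le> b"
  shows "integrable M (\<lambda>\<omega>. h (B a b \<omega>))"
proof (rule integrable_const_bound)
  show "AE \<omega> in M. norm (h (B a b \<omega>)) \<le> Max ((\<lambda>j. norm (h j)) ` {..card (strip f a b)})"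
    using B_bounded[OF assms] by (intro AE_I2 Max_ge) auto
qed (rule measurable_B, simp)

text \<open>Bounds the fourth moment, in units of \<open>N ^ 4\<close>, of a variable whose tail at
  \<open>j * N\<close> is at most \<open>(1 / 2) ^ j\<close>.\<close>

definition moment_const :: real where
  "moment_const = (\<Sum>j. (real j + 1) ^ 4 * (1 / 2) ^ j)"

lemma B_fourth_moment:
  assumes ab: "0 \<le> a" "a \<le> b" and \<mu>: "expectation (\<lambda>\<omega>. real (B a b \<omega>)) \<le> \<mu>" "0 \<le> \<mu>"
  shows "(\<integral>\<^sup>+\<omega>. ennreal (real (B a b \<omega>) ^ 4) \<partial>M) \<le> ennreal (moment_const * (2 * \<mu> + 2) ^ 4)"
proof -
  \<comment> \<open>At twice the mean Markov's inequality leaves probability at most 1/2, which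
    submultiplicativity turns into a geometric tail; the added 1 keeps \<open>N\<close> positive
    when \<open>\<mu>\<close> is 0.\<close>
  define N where "N = nat \<lceil>2 * \<mu>\<rceil> + 1"
  have N: "2 * \<mu> \<le> real N" "real N \<le> 2 * \<mu> + 2" "0 < N"
    unfolding N_def using \<mu>(2) by (auto simp: of_nat_nat) linarith+
  have mB [measurable]: "{\<omega> \<in> space M. k \<le> B a b \<omega>} \<in> events" for k
    using measurable_B[of "count_space UNIV" "\<lambda>j. k \<le> j" a b] by (simp add: pred_def)
  have "prob {\<omega> \<in> space M. N \<le> B a b \<omega>} \<le> 1 / 2"
  proof -
    have "prob {\<omega> \<in> space M. real N \<le> real (B a b \<omega>)} \<le> expectation (\<lambda>\<omega>. real (B a b \<omega>)) / real N"
      using N(3) by (intro integral_Markov_inequality_measure[where A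
          = "{}"] integrable_B[OF ab]) auto
    also have "\<dots> \<le> 1 / 2" using \<mu> N by (simp add: field_simps)
    finally show ?thesis by simp
  qed
  then have tail: "prob {\<omega> \<in> space M. j * N \<le> B a b \<omega>} \<le> (1 / 2) ^ j" for j
  proof (induction j)
    case (Suc j)
    have "prob {\<omega> \<in> space M. Suc j * N \<le> B a b \<omega>}
        \<le> prob {\<omega> \<in> space M. N \<le> B a b \<omega>} * prob {\<omega> \<in> space M. j * N \<le> B a b \<omega>}"
      using B_submultiplicative[OF ab, of N "j * N"] by simp
    also have "\<dots> \<le> 1 / 2 * (1 / 2) ^ j" using Suc by (intro mult_mono) auto
    finally show ?case by simp
  qed simp
  have sm: "summable (\<lambda>j. (real j + 1) ^ 4 * (1 / 2) ^ j)" by (rule summable_power4_geometric) auto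
  have "(\<integral>\<^sup>+\<omega>. ennreal (real (B a b \<omega>) ^ 4) \<partial>M)
      \<le> (\<integral>\<^sup>+\<omega>. (\<Sum>j. ennreal (((real j + 1) * real N) ^ 4) * indicator {\<omega> \<in> space M. j * N
          \<le> B a b \<omega>} \<omega>) \<partial>M)"
  proof (rule nn_integral_mono)
    fix \<omega> assume w: "\<omega> \<in> space M"
    let ?g = "\<lambda>j. ennreal (((real j + 1) * real N) ^ 4) * indicator {\<omega> \<in> space M. j * N
        \<le> B a b \<omega>} \<omega>"
    define j where "j = B a b \<omega> div N"
    have jN: "j * N \<le> B a b \<omega>" by (simp add: j_def)
    have "B a b \<omega> = j * N + B a b \<omega> mod N" by (simp add: j_def)
    also have "\<dots> \<le> (j + 1) * N" using mod_less_divisor[OF N(3), of "B a b \<omega>"]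
      by (simp add: add_mult_distrib)
    finally have "B a b \<omega> \<le> (j + 1) * N" .
    then have "real (B a b \<omega>) \<le> real ((j + 1) * N)" by (rule of_nat_mono)
    then have "real (B a b \<omega>) ^ 4 \<le> ((real j + 1) * real N) ^ 4"
        by (intro power_mono) (auto simp: algebra_simps)
    then have "ennreal (real (B a b \<omega>) ^ 4) \<le> ?g j" using w jN by (simp add: ennreal_leI)
    also have "\<dots> \<le> (\<Sum>j. ?g j)" by (rule term_le_suminf)
    finally show "ennreal (real (B a b \<omega>) ^ 4) \<le> (\<Sum>j. ?g j)" .
  qed
  also have "\<dots> = (\<Sum>j. ennreal (((real j + 1) * real N) ^ 4) * emeasure M {\<omega> \<in> space M. j * N
      \<le> B a b \<omega>})"
    by (subst nn_integral_suminf) (auto simp: nn_integral_cmult_indicator)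
  also have "\<dots> \<le> (\<Sum>j. ennreal (((real j + 1) ^ 4 * (1 / 2) ^ j) * real N ^ 4))"
  proof (intro suminf_le summableI)
    fix j
    have "ennreal (((real j + 1) * real N) ^ 4) * emeasure M {\<omega> \<in> space M. j * N \<le> B a b \<omega>}
        = ennreal (((real j + 1) * real N) ^ 4 * prob {\<omega> \<in> space M. j * N \<le> B a b \<omega>})"
      by (simp add: emeasure_eq_measure ennreal_mult)
    also have "\<dots> \<le> ennreal (((real j + 1) * real N) ^ 4 * (1 / 2) ^ j)"
      using tail[of j] by (intro ennreal_leI mult_left_mono) auto
    also have "\<dots> = ennreal (((real j + 1) ^ 4 * (1 / 2) ^ j) * real N ^ 4)"
      by (simp add: power_mult_distrib mult_ac)
    finally show "ennreal (((real j + 1) * real N) ^ 4) * emeasure M {\<omega> \<in> space M. j * N \<le> B a b \<omega>}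
        \<le> ennreal (((real j + 1) ^ 4 * (1 / 2) ^ j) * real N ^ 4)" .
  qed
  also have "\<dots> = ennreal (moment_const * real N ^ 4)"
    unfolding moment_const_def using sm by (subst suminf_ennreal2) (auto intro!:
        summable_mult2 simp: suminf_mult2)
  also have "\<dots> \<le> ennreal (moment_const * (2 * \<mu> + 2) ^ 4)"
    unfolding moment_const_def using N sm by (intro ennreal_leI mult_left_mono
        power_mono suminf_nonneg) auto
  finally show ?thesis .
qed

end

section \<open>Passage across a random gap\<close>

context fpp
begin

text \<open>Choosing for \<open>Q \<inter> strip f a b\<close> instead of \<open>Q\<close> makes the
  selection a function of finitely many edge states, hence measurable.\<close>

lemma exists_geodesic:
  assumes "0 \<le> a" "a \<le> b"
  obtains G where "\<And>Q. G Q \<subseteq> strip f a b" "\<And>Q. links (G Q) (column f a) (column f b)"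
    "\<And>Q. btime f Q a b = card (G Q \<inter> Q)" "\<And>Q. G Q = G (Q \<inter> strip f a b)"
proof -
  have "\<exists>A \<subseteq> strip f a b. links A (column f a) (column f b) \<and> btime f Q a b = card (A \<inter> Q)" for Q
  proof -
    obtain A where A: "A \<subseteq> strip f a b" "links A (column f a) (column f b)"
      "strip_time f (\<lambda>e. of_bool (e \<in> Q) :: nat) a b = sum (\<lambda>e. of_bool (e \<in> Q)) A"
      using strip_time_attained[OF assms] by metis
    have "finite A" using A finite_strip finite_subset by blast
    then show ?thesis using A by (intro exI[of _ A]) (simp add: btime_def sum_of_bool_card)
  qed
  then obtain G where G: "\<And>Q. G Q \<subseteq> strip f a b" "\<And>Q. links (G Q) (column f a) (column f b)"
    "\<And>Q. btime f Q a b = card (G Q \<inter> Q)" by metis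
  show ?thesis
  proof (rule that[of "\<lambda>Q. G (Q \<inter> strip f a b)"])
    fix Q
    have "G (Q \<inter> strip f a b) \<inter> (Q \<inter> strip f a b) = G (Q \<inter> strip f a b) \<inter> Q"
      using G(1)[of "Q \<inter> strip f a b"] by auto
    then show "btime f Q a b = card (G (Q \<inter> strip f a b) \<inter> Q)"
      using G(3)[of "Q \<inter> strip f a b"] btime_cong[of f a b "strip f a b" Q] by simp
  qed (use G in \<open>auto simp: Int_assoc\<close>)
qed

text \<open>
  Along a geodesic of the Bernoulli weights that is selected from these weights alone, the positive
  weights are independent of the selection.
\<close>

lemma T_second_moment_le:
  fixes g :: "edge set \<Rightarrow> ennreal"
  assumes ab: "0 \<le> a" "a \<le> b" and I: "finite I" "I \<subseteq> edges_Z2" "strip f a b \<subseteq> I"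
    and g: "\<And>Q. g Q = g (Q \<inter> I)"
  shows "(\<integral>\<^sup>+\<omega>. g (closed_edges \<omega>) * ennreal ((T a b \<omega>)\<^sup>2) \<partial>M)
    \<le> ennreal (s / q) * (\<integral>\<^sup>+\<omega>. g (closed_edges \<omega>) * ennreal ((real (B a b \<omega>))\<^sup>2) \<partial>M)"
proof -
  let ?E = "strip f a b"
  obtain G where G: "\<And>Q. G Q \<subseteq> ?E" "\<And>Q. links (G Q) (column f a) (column f b)"
    "\<And>Q. btime f Q a b = card (G Q \<inter> Q)" "\<And>Q. G Q = G (Q \<inter> ?E)" using exists_geodesic[OF ab]
        by metis
  have EI: "Q \<inter> I \<inter> ?E = Q \<inter> ?E" for Q using I by auto
  have GI: "G Q = G (Q \<inter> I)" for Q using G(4)[of Q] G(4)[of "Q \<inter> I"] EI by simp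
  have bI: "btime f Q a b = btime f (Q \<inter> I) a b" for Q using I(3) by (rule btime_cong)
  \<comment> \<open>Summed over the edges of the strip, \<open>H\<close> gives \<open>g\<close>
    times the square of the Bernoulli time: one factor is the number of terms in the Cauchy-Schwarz
    inequality, the other counts the closed edges of the geodesic.\<close>
  define H where "H = (\<lambda>e Q. g Q * ennreal (real (btime f Q a b)) * indicator (G Q \<inter> Q) e)"
  have HI: "H e Q = H e (Q \<inter> I)" if "e \<in> I" for e Q
    using that g[of Q] bI[of Q] GI[of Q] by (auto simp: H_def indicator_def)
  have mH: "(\<lambda>\<omega>. H e (closed_edges \<omega>)) \<in> borel_measurable M" if "e \<in> ?E" for e
  proof (rule based_on_measurable[OF I(2)], rule based_on_closed_edges[OF I(1,2)])
    show "H e Q = H e (Q \<inter> I)" for Q using HI that I(3) by blast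
  qed simp
  have mw: "random_variable borel (\<tau> e)" if "e \<in> ?E" for e
    using that strip_edges_Z2 by (intro measurable_weight) auto
  have pt: "g (closed_edges \<omega>) * ennreal ((T a b \<omega>)\<^sup>2)
      \<le> (\<Sum>e\<in>?E. H e (closed_edges \<omega>) * ennreal ((\<tau> e \<omega>)\<^sup>2))" for \<omega>
  proof -
    let ?Q = "closed_edges \<omega>"
    let ?A = "G ?Q \<inter> ?Q"
    have fin: "finite (G ?Q)" using G(1) finite_strip finite_subset by blast
    have GZ: "G ?Q \<subseteq> edges_Z2" using G(1)[of ?Q] strip_edges_Z2 by blast
    have "T a b \<omega> \<le> (\<Sum>e\<in>G ?Q. \<tau> e \<omega>)" unfolding T_def by (rule strip_time_le[OF G(1,2)])
    also have "\<dots> = (\<Sum>e\<in>?A. \<tau> e \<omega>)"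
    proof (rule sum.mono_neutral_right[OF fin])
      show "\<forall>e\<in>G ?Q - ?A. \<tau> e \<omega> = 0" using GZ weight_nonneg[of _ \<omega>]
          by (fastforce simp: closed_edges_def)
    qed auto
    finally have "T a b \<omega> \<le> (\<Sum>e\<in>?A. \<tau> e \<omega>)" .
    moreover have "0 \<le> T a b \<omega>" unfolding T_def by (rule strip_time_nonneg[OF weight_nonneg' ab])
    ultimately have "(T a b \<omega>)\<^sup>2 \<le> (\<Sum>e\<in>?A. \<tau> e \<omega>)\<^sup>2" by (rule power_mono)
    also have "\<dots> \<le> (\<Sum>e\<in>?A. (\<tau> e \<omega>)\<^sup>2) * card ?A" by (rule sum_squared_le_sum_of_squares)
    also have "\<dots> = real (btime f ?Q a b) * (\<Sum>e\<in>?A. (\<tau> e \<omega>)\<^sup>2)" by (simp add: G(3) mult.commute)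
    finally have "ennreal ((T a b \<omega>)\<^sup>2) \<le> ennreal (real (btime f ?Q a b)) * (\<Sum>e\<in>?A. ennreal ((\<tau>
        e \<omega>)\<^sup>2))"
      by (subst sum_ennreal) (auto simp: ennreal_mult[symmetric] sum_nonneg intro!: ennreal_leI)
    also have "(\<Sum>e\<in>?A. ennreal ((\<tau> e \<omega>)\<^sup>2)) = (\<Sum>e\<in>?E. indicator ?A e * ennreal ((\<tau> e \<omega>)\<^sup>2))"
      using G(1)[of ?Q] by (intro sum.mono_neutral_cong_left finite_strip) (auto
          simp: indicator_def)
    finally have "g ?Q * ennreal ((T a b \<omega>)\<^sup>2)
        \<le> g ?Q * (ennreal (real (btime f ?Q a b)) * (\<Sum>e\<in>?E. indicator ?A e * ennreal ((\<tau> e \<omega>)\<^sup>2)))"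
      by (rule mult_left_mono) simp
    then show ?thesis by (simp add: H_def sum_distrib_left mult.assoc)
  qed
  have one: "(\<integral>\<^sup>+\<omega>. H e (closed_edges \<omega>) * ennreal ((\<tau> e \<omega>)\<^sup>2) \<partial>M)
      \<le> ennreal (s / q) * (\<integral>\<^sup>+\<omega>. H e (closed_edges \<omega>) \<partial>M)" if e: "e \<in> ?E" for e
  proof -
    have eI: "e \<in> I" "e \<in> edges_Z2" using e I by auto
    \<comment> \<open>Declaring \<open>e\<close> closed removes the dependence on
      \<open>\<tau> e\<close>. Nothing changes where \<open>\<tau> e\<close> is positive, and
      elsewhere its square vanishes.\<close>
    define H' where "H' = (\<lambda>Q. H e (insert e Q))"
    have "H' Q = H' (Q \<inter> (I - {e}))" for Q
    proof -
      have "insert e Q \<inter> I = insert e (Q \<inter> (I - {e})) \<inter> I" using eI by auto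
      then show ?thesis unfolding H'_def using HI[OF eI(1)] by metis
    qed
    then have bH': "based_on (I - {e}) borel (\<lambda>\<omega>. H' (closed_edges \<omega>))"
      using I by (intro based_on_closed_edges) auto
    then have mH': "(\<lambda>\<omega>. H' (closed_edges \<omega>)) \<in> borel_measurable M"
      using I by (intro based_on_measurable[OF _ bH']) auto
    have ind: "indep_var borel (\<lambda>\<omega>. H' (closed_edges \<omega>)) borel (\<lambda>\<omega>. h (\<tau> e \<omega>))"
      if "h \<in> borel_measurable borel" for h :: "real \<Rightarrow> ennreal"
      using eI I by (intro indep_var_based[OF bH' based_on_compose[OF based_on_weight that]]) auto
    have "(\<integral>\<^sup>+\<omega>. H e (closed_edges \<omega>) * ennreal ((\<tau> e \<omega>)\<^sup>2) \<partial>M)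
        = (\<integral>\<^sup>+\<omega>. H' (closed_edges \<omega>) * ennreal ((\<tau> e \<omega>)\<^sup>2) \<partial>M)"
    proof (rule nn_integral_cong)
      fix \<omega>
      show "H e (closed_edges \<omega>) * ennreal ((\<tau> e \<omega>)\<^sup>2) = H' (closed_edges \<omega>) * ennreal ((\<tau> e \<omega>)\<^sup>2)"
      proof (cases "e \<in> closed_edges \<omega>")
        case True
        then show ?thesis by (simp add: H'_def insert_absorb)
      next
        case False
        then have "\<tau> e \<omega> = 0" using eI weight_nonneg[of e \<omega>] by (auto simp: closed_edges_def)
        then show ?thesis by simp
      qed
    qed
    also have "\<dots> = (\<integral>\<^sup>+\<omega>. H' (closed_edges \<omega>) \<partial>M) * (\<integral>\<^sup>+\<omega>. ennreal ((\<tau> e \<omega>)\<^sup>2) \<partial>M)"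
      by (rule indep_var_nn_integral[OF ind]) measurable
    also have "\<dots> \<le> (\<integral>\<^sup>+\<omega>. H' (closed_edges \<omega>) \<partial>M) * ennreal s"
      using second_moment[OF eI(2)] by (rule mult_left_mono) simp
    also have "ennreal s = ennreal q * ennreal (s / q)"
      using q_pos s_nonneg by (simp add: ennreal_mult[symmetric])
    \<comment> \<open>The probability that \<open>e\<close> is closed is put back, which turns
      \<open>H'\<close> into \<open>H\<close> again; the price is the factor
      \<open>1 / q\<close>.\<close>
    also have "ennreal q = (\<integral>\<^sup>+\<omega>. indicator {0<..} (\<tau> e \<omega>) \<partial>M)"
    proof -
      have "(\<integral>\<^sup>+\<omega>. indicator {0<..} (\<tau> e \<omega>) \<partial>M) = (\<integral>\<^sup>+\<omega>. indicator {\<omega> \<in> space M. 0 < \<tau> e \<omega>} \<omega> \<partial>M)"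
        by (intro nn_integral_cong) (auto simp: indicator_def)
      also have "\<dots> = emeasure M {\<omega> \<in> space M. 0 < \<tau> e \<omega>}"
        using mw[OF e] by (intro nn_integral_indicator) measurable
      finally show ?thesis using prob_pos[OF eI(2)] by (simp add: emeasure_eq_measure)
    qed
    also have "(\<integral>\<^sup>+\<omega>. H' (closed_edges \<omega>) \<partial>M) * ((\<integral>\<^sup>+\<omega>. indicator {0<..} (\<tau> e \<omega>) \<partial>M) * ennreal (s
        / q))
        = ennreal (s / q) * (\<integral>\<^sup>+\<omega>. H' (closed_edges \<omega>) * indicator {0<..} (\<tau> e \<omega>) \<partial>M)"
      by (subst indep_var_nn_integral[OF ind]) (auto simp: mult_ac)
    also have "(\<integral>\<^sup>+\<omega>. H' (closed_edges \<omega>) * indicator {0<..} (\<tau> e \<omega>) \<partial>M)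
        = (\<integral>\<^sup>+\<omega>. H e (closed_edges \<omega>) \<partial>M)"
      by (intro nn_integral_cong)
        (use eI in \<open>auto simp: indicator_def H'_def H_def closed_edges_def insert_absorb\<close>)
    finally show ?thesis .
  qed
  have "(\<integral>\<^sup>+\<omega>. g (closed_edges \<omega>) * ennreal ((T a b \<omega>)\<^sup>2) \<partial>M)
      \<le> (\<integral>\<^sup>+\<omega>. (\<Sum>e\<in>?E. H e (closed_edges \<omega>) * ennreal ((\<tau> e \<omega>)\<^sup>2)) \<partial>M)"
    by (intro nn_integral_mono pt)
  also have "\<dots> = (\<Sum>e\<in>?E. \<integral>\<^sup>+\<omega>. H e (closed_edges \<omega>) * ennreal ((\<tau> e \<omega>)\<^sup>2) \<partial>M)"
    using mH mw by (intro nn_integral_sum) auto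
  also have "\<dots> \<le> (\<Sum>e\<in>?E. ennreal (s / q) * (\<integral>\<^sup>+\<omega>. H e (closed_edges \<omega>) \<partial>M))"
    by (intro sum_mono one)
  also have "\<dots> = ennreal (s / q) * (\<integral>\<^sup>+\<omega>. (\<Sum>e\<in>?E. H e (closed_edges \<omega>)) \<partial>M)"
    using mH by (simp add: nn_integral_sum sum_distrib_left)
  also have "(\<integral>\<^sup>+\<omega>. (\<Sum>e\<in>?E. H e (closed_edges \<omega>)) \<partial>M)
      = (\<integral>\<^sup>+\<omega>. g (closed_edges \<omega>) * ennreal ((real (B a b \<omega>))\<^sup>2) \<partial>M)"
  proof (rule nn_integral_cong)
    fix \<omega>
    let ?Q = "closed_edges \<omega>"
    have "(\<Sum>e\<in>?E. indicator (G ?Q \<inter> ?Q) e :: ennreal) = of_nat (card (G ?Q \<inter> ?Q))"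
    proof -
      have "(\<Sum>e\<in>?E. indicator (G ?Q \<inter> ?Q) e :: ennreal) = of_nat (card (?E \<inter> (G ?Q \<inter> ?Q)))"
        unfolding indicator_def by (subst sum_of_bool_eq) (simp_all add: finite_strip Int_def)
      also have "?E \<inter> (G ?Q \<inter> ?Q) = G ?Q \<inter> ?Q" using G(1)[of ?Q] by auto
      finally show ?thesis .
    qed
    also have "\<dots> = ennreal (real (B a b \<omega>))" by (simp add: B_def G(3) ennreal_of_nat_eq_real_of_nat)
    finally have "(\<Sum>e\<in>?E. indicator (G ?Q \<inter> ?Q) e :: ennreal) = ennreal (real (B a b \<omega>))" .
    then show "(\<Sum>e\<in>?E. H e ?Q) = g ?Q * ennreal ((real (B a b \<omega>))\<^sup>2)"
      unfolding H_def sum_distrib_left[symmetric]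
      by (simp add: B_def[symmetric] mult.assoc ennreal_mult[symmetric] power2_eq_square)
  qed
  finally show ?thesis .
qed

text \<open>The sum of the series that will bound the second moment of a gap. It involves neither
  the graph nor the columns, only \<open>q\<close>, \<open>s\<close>, \<open>c\<close> and
  \<open>\<rho>\<close>; this makes the final constants uniform in \<open>f\<close> and
  \<open>r\<close>.\<close>

definition gap_const :: "real \<Rightarrow> real \<Rightarrow> real" where
  "gap_const c \<rho> = s / q * (\<Sum>l. moment_const * (4 * c) ^ 4 / 2 * ((real l + 1) ^ 4 * sqrt \<rho> ^ l)
      + sqrt \<rho> ^ l)"

lemma moment_const_nonneg: "0 \<le> moment_const"
  unfolding moment_const_def by (intro suminf_nonneg summable_power4_geometric) auto

lemma gap_summable:
  assumes "0 < \<rho>" "\<rho> < 1"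
  shows "summable (\<lambda>l. moment_const * (4 * c) ^ 4 / 2 * ((real l + 1) ^ 4 * sqrt \<rho> ^ l)
      + sqrt \<rho> ^ l)"
  using assms by (intro summable_add summable_mult summable_power4_geometric
      summable_geometric) auto

lemma gap_const_nonneg:
  assumes "0 < \<rho>" "\<rho> < 1"
  shows "0 \<le> gap_const c \<rho>"
  unfolding gap_const_def using assms q_pos s_nonneg moment_const_nonneg
  by (intro mult_nonneg_nonneg suminf_nonneg gap_summable) auto

text \<open>
  \<open>H l\<close> is the event that no open crossing is found in the first \<open>l\<close> trials. Hoelder's inequality is
  replaced by \<open>2 x\<^sup>2 1\<^sub>H \<le> \<theta>\<^sup>l x\<^sup>4 + \<theta>\<^sup>-\<^sup>l 1\<^sub>H\<close> with \<open>\<theta> = sqrt \<rho>\<close>.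
\<close>

lemma gap_second_moment:
  fixes a b :: "nat \<Rightarrow> int" and X :: "'a \<Rightarrow> real"
  assumes ab: "\<And>l. 0 \<le> a l" "\<And>l. a l \<le> b l"
    and c: "1 \<le> c" and \<rho>: "0 < \<rho>" "\<rho> < 1"
    and mean: "\<And>l. expectation (\<lambda>\<omega>. real (B (a l) (b l) \<omega>)) \<le> c * (real l + 1)"
    and I: "\<And>l. finite (I l)" "\<And>l. I l \<subseteq> edges_Z2"
    and H: "\<And>l Q. H l Q = H l (Q \<inter> I l)" "\<And>Q. H 0 Q"
    and PH: "\<And>l. prob {\<omega> \<in> space M. H l (closed_edges \<omega>)} \<le> 2 * \<rho> ^ l"
    and X: "X \<in> borel_measurable M" "\<And>\<omega>. 0 \<le> X \<omega>"
    and le: "\<And>l \<omega>. \<not> H (Suc l) (closed_edges \<omega>) \<Longrightarrow> X \<omega> \<le> T (a l) (b l) \<omega>"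
  shows "(\<integral>\<^sup>+\<omega>. ennreal ((X \<omega>)\<^sup>2) \<partial>M) \<le> ennreal (gap_const c \<rho>)"
proof -
  define \<theta> where "\<theta> = sqrt \<rho>"
  have \<theta>: "0 < \<theta>" "\<theta> < 1" "\<theta>\<^sup>2 = \<rho>" using \<rho> by (auto simp: \<theta>_def)
  let ?H = "\<lambda>l. {\<omega> \<in> space M. H l (closed_edges \<omega>)}"
  have bH: "based_on (I l) (count_space UNIV) (\<lambda>\<omega>. H l (closed_edges \<omega>))" for l
    using I H(1) by (intro based_on_closed_edges) auto
  have mH [measurable]: "?H l \<in> events" for l
    using based_on_measurable[OF I(2) bH, of l] by (simp add: pred_def)
  have ae: "AE \<omega> in M. \<exists>l. \<not> H (Suc l) (closed_edges \<omega>)"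
  proof -
    have "prob (\<Inter>l. ?H (Suc l)) \<le> 2 * \<rho> ^ Suc l" for l
      by (rule order_trans[OF finite_measure_mono PH]) auto
    moreover have "(\<lambda>l. 2 * \<rho> ^ Suc l) \<longlonglongrightarrow> 2 * 0"
      using \<rho> by (intro tendsto_mult tendsto_const LIMSEQ_Suc LIMSEQ_realpow_zero) auto
    ultimately have "prob (\<Inter>l. ?H (Suc l)) \<le> 0"
      by (intro LIMSEQ_le_const[of "\<lambda>l. 2 * \<rho> ^ Suc l"]) auto
    then have "prob (\<Inter>l. ?H (Suc l)) = 0" using measure_nonneg[of M] by (simp add: antisym)
    then have "AE \<omega> in M. \<omega> \<notin> (\<Inter>l. ?H (Suc l))"
      by (intro AE_not_in) (auto simp: emeasure_eq_measure null_sets_def)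
    then show ?thesis by (rule AE_mp) auto
  qed
  have "(\<integral>\<^sup>+\<omega>. ennreal ((X \<omega>)\<^sup>2) \<partial>M)
      \<le> (\<integral>\<^sup>+\<omega>. (\<Sum>l. indicator (?H l) \<omega> * ennreal ((T (a l) (b l) \<omega>)\<^sup>2)) \<partial>M)"
  proof (rule nn_integral_mono_AE, use ae AE_space in eventually_elim)
    fix \<omega> assume ex: "\<exists>l. \<not> H (Suc l) (closed_edges \<omega>)" and w: "\<omega> \<in> space M"
    \<comment> \<open>The first success comes with trial \<open>l\<close>, so the trials before it
      failed and the indicator of \<open>H l\<close> equals 1. Bounding by the sum over all
      \<open>l\<close> disposes of the random index.\<close>
    define l where "l = (LEAST l. \<not> H (Suc l) (closed_edges \<omega>))"
    have l: "\<not> H (Suc l) (closed_edges \<omega>)" unfolding l_def using ex by (rule LeastI_ex)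
    have "H l (closed_edges \<omega>)"
    proof (cases l)
      case (Suc k)
      then have "k < l" by simp
      then show ?thesis using not_less_Least[of k "\<lambda>l. \<not> H (Suc l) (closed_edges \<omega>)"] Suc
          unfolding l_def by auto
    qed (simp add: H(2))
    then have "ennreal ((X \<omega>)\<^sup>2) \<le> indicator (?H l) \<omega> * ennreal ((T (a l) (b l) \<omega>)\<^sup>2)"
      using w le[OF l] X(2) by (auto intro!: ennreal_leI power_mono)
    also have "\<dots> \<le> (\<Sum>l. indicator (?H l) \<omega> * ennreal ((T (a l) (b l) \<omega>)\<^sup>2))"
      by (rule term_le_suminf)
    finally show "ennreal ((X \<omega>)\<^sup>2) \<le> (\<Sum>l. indicator (?H l) \<omega> * ennreal ((T (a l) (b l) \<omega>)\<^sup>2))" .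
  qed
  also have "\<dots> = (\<Sum>l. \<integral>\<^sup>+\<omega>. indicator (?H l) \<omega> * ennreal ((T (a l) (b l) \<omega>)\<^sup>2) \<partial>M)"
    by (intro nn_integral_suminf) measurable
  also have "\<dots> \<le> (\<Sum>l. ennreal (s / q) * ennreal (moment_const * (4 * c) ^ 4 / 2 * ((real l
      + 1) ^ 4 * \<theta> ^ l) + \<theta> ^ l))"
  proof (intro suminf_le summableI)
    fix l
    let ?J = "I l \<union> strip f (a l) (b l)"
    have J: "finite ?J" "?J \<subseteq> edges_Z2" using I finite_strip strip_edges_Z2 by auto
    have "(\<integral>\<^sup>+\<omega>. indicator (?H l) \<omega> * ennreal ((T (a l) (b l) \<omega>)\<^sup>2) \<partial>M)
        = (\<integral>\<^sup>+\<omega>. indicator {Q. H l Q} (closed_edges \<omega>) * ennreal ((T (a l) (b l) \<omega>)\<^sup>2) \<partial>M)"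
      by (intro nn_integral_cong) (auto simp: indicator_def)
    also have "\<dots> \<le> ennreal (s / q) *
        (\<integral>\<^sup>+\<omega>. indicator {Q. H l Q} (closed_edges \<omega>) * ennreal ((real (B (a l) (b l) \<omega>))\<^sup>2) \<partial>M)"
    proof (rule T_second_moment_le[OF ab J])
      fix Q
      have "Q \<inter> ?J \<inter> I l = Q \<inter> I l" by auto
      then have "H l Q = H l (Q \<inter> ?J)" using H(1)[of l Q] H(1)[of l "Q \<inter> ?J"] by simp
      then show "indicator {Q. H l Q} Q = (indicator {Q. H l Q} (Q \<inter> ?J) :: ennreal)"
        by (simp add: indicator_def)
    qed simp
    also have "(\<integral>\<^sup>+\<omega>. indicator {Q. H l Q} (closed_edges \<omega>) * ennreal ((real (B (a l) (b l)
        \<omega>))\<^sup>2) \<partial>M)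
        \<le> (\<integral>\<^sup>+\<omega>. ennreal (\<theta> ^ l / 2) * ennreal (real (B (a l) (b l) \<omega>) ^ 4)
            + ennreal (1 / (2 * \<theta> ^ l)) * indicator (?H l) \<omega> \<partial>M)"
    proof (rule nn_integral_mono)
      fix \<omega> assume w: "\<omega> \<in> space M"
      let ?x = "real (B (a l) (b l) \<omega>)"
      have "?x\<^sup>2 \<le> \<theta> ^ l / 2 * ?x ^ 4 + 1 / (2 * \<theta> ^ l)"
      proof -
        have "0 \<le> (\<theta> ^ l * ?x\<^sup>2 - 1)\<^sup>2 / (2 * \<theta> ^ l)" using \<theta> by simp
        also have "\<dots> = \<theta> ^ l / 2 * ?x ^ 4 + 1 / (2 * \<theta> ^ l) - ?x\<^sup>2"
          using \<theta> by (simp add: power2_diff field_simps power2_eq_square power4_eq_xxxx)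
        finally show ?thesis by simp
      qed
      then show "indicator {Q. H l Q} (closed_edges \<omega>) * ennreal (?x\<^sup>2)
          \<le> ennreal (\<theta> ^ l / 2) * ennreal (?x ^ 4) + ennreal (1 / (2 * \<theta> ^ l)) * indicator (?H l) \<omega>"
        using w \<theta> by (auto simp: indicator_def ennreal_mult[symmetric] ennreal_plus[symmetric]
            simp del: ennreal_plus intro!: ennreal_leI)
    qed
    also have "\<dots> = ennreal (\<theta> ^ l / 2) * (\<integral>\<^sup>+\<omega>. ennreal (real (B (a l) (b l) \<omega>) ^ 4) \<partial>M)
        + ennreal (1 / (2 * \<theta> ^ l)) * emeasure M (?H l)"
    proof -
      have mB: "(\<lambda>\<omega>. ennreal (real (B (a l) (b l) \<omega>) ^ 4)) \<in> borel_measurable M"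
        by (rule measurable_B) simp
      have "(\<lambda>\<omega>. ennreal (\<theta> ^ l / 2) * ennreal (real (B (a l) (b l) \<omega>) ^ 4)) \<in> borel_measurable M"
        by (rule measurable_B) simp
      then show ?thesis using mH[of l]
        by (subst nn_integral_add) (auto simp: nn_integral_cmult[OF mB] nn_integral_cmult_indicator)
    qed
    also have "\<dots> \<le> ennreal (\<theta> ^ l / 2) * ennreal (moment_const * (4 * c * (real l + 1)) ^ 4)
        + ennreal (1 / (2 * \<theta> ^ l)) * ennreal (2 * \<rho> ^ l)"
    proof (intro add_mono mult_left_mono)
      have "(\<integral>\<^sup>+\<omega>. ennreal (real (B (a l) (b l) \<omega>) ^ 4) \<partial>M)
          \<le> ennreal (moment_const * (2 * (c * (real l + 1)) + 2) ^ 4)"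
        using c by (intro B_fourth_moment ab mean) auto
      also have "\<dots> \<le> ennreal (moment_const * (4 * c * (real l + 1)) ^ 4)"
      proof -
        \<comment> \<open>This absorbs the additive 2, because \<open>2 * x + 2 \<le> 4 * x\<close>
          for \<open>x \<ge> 1\<close>; here \<open>x\<close> is
          \<open>c * (real l + 1)\<close>.\<close>
        have "1 * 1 \<le> c * (real l + 1)" using c by (intro mult_mono) auto
        then show ?thesis using c moment_const_nonneg
          by (intro ennreal_leI mult_left_mono power_mono) (auto simp: algebra_simps)
      qed
      finally show "(\<integral>\<^sup>+\<omega>. ennreal (real (B (a l) (b l) \<omega>) ^ 4) \<partial>M)
          \<le> ennreal (moment_const * (4 * c * (real l + 1)) ^ 4)" .
      show "emeasure M (?H l) \<le> ennreal (2 * \<rho> ^ l)"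
        using PH[of l] by (simp add: emeasure_eq_measure ennreal_leI)
    qed simp_all
    also have "\<dots> = ennreal (moment_const * (4 * c) ^ 4 / 2 * ((real l + 1) ^ 4 * \<theta> ^ l) + \<theta> ^ l)"
    proof -
      have "1 / (2 * \<theta> ^ l) * (2 * \<rho> ^ l) = \<theta> ^ l"
        using \<theta>(1) unfolding \<theta>(3)[symmetric] by (simp add:
            power_mult[symmetric] power_add[symmetric] field_simps
            power_mult_distrib power2_eq_square)
      moreover have "\<theta> ^ l / 2 * (moment_const * (4 * c * (real l + 1)) ^ 4)
          = moment_const * (4 * c) ^ 4 / 2 * ((real l + 1) ^ 4 * \<theta> ^ l)"
        by (simp add: power_mult_distrib)
      ultimately show ?thesis using \<theta>(1) \<rho>(1) c moment_const_nonneg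
        by (subst ennreal_mult[symmetric], simp, simp)+ (simp add: ennreal_plus[symmetric]
            del: ennreal_plus)
    qed
    finally show "(\<integral>\<^sup>+\<omega>. indicator (?H l) \<omega> * ennreal ((T (a l) (b l) \<omega>)\<^sup>2) \<partial>M)
        \<le> ennreal (s / q) * ennreal (moment_const * (4 * c) ^ 4 / 2 * ((real l + 1) ^ 4 * \<theta> ^ l)
            + \<theta> ^ l)"
      by (simp add: mult_left_mono)
  qed
  also have "\<dots> = ennreal (gap_const c \<rho>)"
  proof -
    let ?u = "\<lambda>l. moment_const * (4 * c) ^ 4 / 2 * ((real l + 1) ^ 4 * \<theta> ^ l) + \<theta> ^ l"
    have nn: "0 \<le> ?u l" for l using \<theta> moment_const_nonneg by auto
    have sm: "summable ?u" unfolding \<theta>_def by (rule gap_summable[OF \<rho>])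
    have "(\<Sum>l. ennreal (s / q) * ennreal (?u l)) = ennreal (s / q) * ennreal (\<Sum>l. ?u l)"
      using suminf_ennreal2[OF nn sm] by (simp add: ennreal_suminf_cmult)
    also have "\<dots> = ennreal (gap_const c \<rho>)"
      unfolding gap_const_def \<theta>_def[symmetric] using nn sm s_nonneg q_pos
      by (intro ennreal_mult[symmetric] suminf_nonneg) auto
    finally show ?thesis .
  qed
  finally show ?thesis .
qed

end

section \<open>Square integrable random variables\<close>

context prob_space
begin

definition sq_integrable :: "('a \<Rightarrow> real) \<Rightarrow> bool" where
  "sq_integrable X \<longleftrightarrow> random_variable borel X \<and> integrable M (\<lambda>\<omega>. (X \<omega>)\<^sup>2)"

lemma sq_integrable_integrable: "sq_integrable X \<Longrightarrow> integrable M X"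
  unfolding sq_integrable_def by (auto intro: square_integrable_imp_integrable)

lemma sq_integrable_mult:
  assumes "sq_integrable X" "sq_integrable Y"
  shows "integrable M (\<lambda>\<omega>. X \<omega> * Y \<omega>)"
proof (rule Bochner_Integration.integrable_bound)
  show "integrable M (\<lambda>\<omega>. (X \<omega>)\<^sup>2 + (Y \<omega>)\<^sup>2)" using assms by (auto simp: sq_integrable_def)
  show "(\<lambda>\<omega>. X \<omega> * Y \<omega>) \<in> borel_measurable M"
    using assms by (intro borel_measurable_times) (auto simp: sq_integrable_def)
  have "\<bar>x * y\<bar> \<le> x\<^sup>2 + y\<^sup>2" for x y :: real
  proof -
    have "0 \<le> \<bar>x\<bar> * \<bar>y\<bar>" by simp
    moreover have "2 * (\<bar>x\<bar> * \<bar>y\<bar>) \<le> x\<^sup>2 + y\<^sup>2"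
      using sum_squares_bound[of "\<bar>x\<bar>" "\<bar>y\<bar>"] by (simp only: power2_abs mult.assoc)
    ultimately show ?thesis unfolding abs_mult by linarith
  qed
  then show "AE \<omega> in M. norm (X \<omega> * Y \<omega>) \<le> norm ((X \<omega>)\<^sup>2 + (Y \<omega>)\<^sup>2)" by auto
qed

lemma sq_integrable_const: "sq_integrable (\<lambda>_. c)"
  by (simp add: sq_integrable_def)

lemma sq_integrable_cmult: "sq_integrable X \<Longrightarrow> sq_integrable (\<lambda>\<omega>. c * X \<omega>)"
  by (auto simp: sq_integrable_def power_mult_distrib)

lemma sq_integrable_add:
  assumes "sq_integrable X" "sq_integrable Y"
  shows "sq_integrable (\<lambda>\<omega>. X \<omega> + Y \<omega>)"
  using assms sq_integrable_mult[OF assms] unfolding sq_integrable_def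
  by (auto simp: power2_sum mult.assoc)

lemma sq_integrable_diff:
  assumes "sq_integrable X" "sq_integrable Y"
  shows "sq_integrable (\<lambda>\<omega>. X \<omega> - Y \<omega>)"
  using sq_integrable_add[OF assms(1) sq_integrable_cmult[OF assms(2), of "-1"]] by simp

lemma sq_integrable_nn_integral:
  assumes X: "random_variable borel X" and le: "(\<integral>\<^sup>+\<omega>. ennreal ((X \<omega>)\<^sup>2) \<partial>M) \<le> ennreal c"
      and c: "0 \<le> c"
  shows "sq_integrable X" "expectation (\<lambda>\<omega>. (X \<omega>)\<^sup>2) \<le> c"
proof -
  have "(\<integral>\<^sup>+\<omega>. ennreal ((X \<omega>)\<^sup>2) \<partial>M) < \<infinity>" using le by (auto intro: le_less_trans)
  then have i: "integrable M (\<lambda>\<omega>. (X \<omega>)\<^sup>2)" using X by (intro integrableI_nonneg) auto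
  then show "sq_integrable X" using X by (simp add: sq_integrable_def)
  show "expectation (\<lambda>\<omega>. (X \<omega>)\<^sup>2) \<le> c"
    using le nn_integral_eq_integral[OF i] c by (simp add: ennreal_le_iff)
qed

lemma variance_sq_integrable:
  assumes "sq_integrable X"
  shows "variance X = expectation (\<lambda>\<omega>. (X \<omega>)\<^sup>2) - (expectation X)\<^sup>2"
proof (rule variance_eq)
  show "integrable M (\<lambda>\<omega>. (X \<omega>)\<^sup>2)" using assms by (simp add: sq_integrable_def)
qed (rule sq_integrable_integrable[OF assms])

lemma variance_cmult:
  fixes X :: "'a \<Rightarrow> real"
  shows "variance (\<lambda>\<omega>. c * X \<omega>) = c\<^sup>2 * variance X"
  by (simp add: right_diff_distrib[symmetric] power_mult_distrib)

lemma expectation_le_sqrt: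
  assumes "sq_integrable X" "expectation (\<lambda>\<omega>. (X \<omega>)\<^sup>2) \<le> c\<^sup>2" "0 \<le> c"
  shows "expectation X \<le> c"
proof -
  have "(expectation X)\<^sup>2 \<le> expectation (\<lambda>\<omega>. (X \<omega>)\<^sup>2)"
  proof -
    have "0 \<le> variance X" by (rule variance_positive)
    then show ?thesis using variance_sq_integrable[OF assms(1)] by simp
  qed
  then have "(expectation X)\<^sup>2 \<le> c\<^sup>2" using assms(2) by simp
  then show ?thesis using assms(3) by (rule power2_le_imp_le)
qed

lemma variance_le_second_moment: "sq_integrable X \<Longrightarrow> variance X \<le> expectation (\<lambda>\<omega>. (X \<omega>)\<^sup>2)"
proof -
  assume X: "sq_integrable X"
  have "variance X = expectation (\<lambda>\<omega>. (X \<omega>)\<^sup>2) - (expectation X)\<^sup>2"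
    by (rule variance_sq_integrable[OF X])
  also have "\<dots> \<le> expectation (\<lambda>\<omega>. (X \<omega>)\<^sup>2)" by simp
  finally show ?thesis .
qed

lemma variance_sum_eq:
  assumes "sq_integrable X" "sq_integrable Y"
  shows "variance (\<lambda>\<omega>. X \<omega> + Y \<omega>) = variance X + variance Y
    + 2 * (expectation (\<lambda>\<omega>. X \<omega> * Y \<omega>) - expectation X * expectation Y)"
proof -
  note i = sq_integrable_integrable[OF assms(1)] sq_integrable_integrable[OF assms(2)]
  have sq: "integrable M (\<lambda>\<omega>. (X \<omega>)\<^sup>2)" "integrable M (\<lambda>\<omega>. (Y \<omega>)\<^sup>2)"
    using assms by (auto simp: sq_integrable_def)
  note m = sq_integrable_mult[OF assms]
  have s: "integrable M (\<lambda>\<omega>. (X \<omega> + Y \<omega>)\<^sup>2)"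
    using sq_integrable_add[OF assms] by (simp add: sq_integrable_def)
  have e: "expectation (\<lambda>\<omega>. (X \<omega> + Y \<omega>)\<^sup>2)
      = expectation (\<lambda>\<omega>. (X \<omega>)\<^sup>2) + expectation (\<lambda>\<omega>. (Y \<omega>)\<^sup>2) + 2 * expectation (\<lambda>\<omega>. X \<omega> * Y \<omega>)"
    using sq m by (simp add: power2_sum mult.assoc)
  have "variance (\<lambda>\<omega>. X \<omega> + Y \<omega>) = expectation (\<lambda>\<omega>. (X \<omega> + Y \<omega>)\<^sup>2) - (expectation (\<lambda>\<omega>. X \<omega>
      + Y \<omega>))\<^sup>2"
    using i s by (intro variance_eq) auto
  then show ?thesis
    using e i variance_eq[OF i(1) sq(1)] variance_eq[OF i(2) sq(2)]
        by (simp add: power2_sum algebra_simps)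
qed

lemma variance_add_indep:
  assumes "sq_integrable X" "sq_integrable Y" "indep_var borel X borel Y"
  shows "variance (\<lambda>\<omega>. X \<omega> + Y \<omega>) = variance X + variance Y"
  using variance_sum_eq[OF assms(1,2)] indep_var_lebesgue_integral[OF
      assms(3) sq_integrable_integrable[OF assms(1)]
      sq_integrable_integrable[OF assms(2)]] by simp

text \<open>Minkowski's inequality for standard deviations, in terms of upper bounds only:
  nonnegativity of the variance of \<open>t * X - Y\<close> at \<open>t = c / \<sigma>\<close>
  bounds the covariance by \<open>\<sigma> * c\<close>.\<close>

lemma variance_minkowski:
  assumes X: "sq_integrable X" and Y: "sq_integrable Y"
    and "variance X \<le> \<sigma>\<^sup>2" "expectation (\<lambda>\<omega>. (Y \<omega>)\<^sup>2) \<le> c\<^sup>2" "0 < \<sigma>" "0 < c"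
  shows "variance (\<lambda>\<omega>. X \<omega> + Y \<omega>) \<le> (\<sigma> + c)\<^sup>2"
proof -
  let ?t = "c / \<sigma>"
  have vY: "variance Y \<le> c\<^sup>2" using variance_le_second_moment[OF Y] assms(4) by linarith
  have t: "0 < ?t" using assms by simp
  have "0 \<le> variance (\<lambda>\<omega>. ?t * X \<omega> + - 1 * Y \<omega>)" by (rule variance_positive)
  also have "\<dots> = ?t\<^sup>2 * variance X + variance Y - 2 * ?t * (expectation (\<lambda>\<omega>. X \<omega> * Y \<omega>)
      - expectation X * expectation Y)"
    unfolding variance_sum_eq[OF sq_integrable_cmult[OF X] sq_integrable_cmult[OF Y], of ?t "-1"]
      variance_cmult by (simp add: algebra_simps)
  finally have "2 * ?t * (expectation (\<lambda>\<omega>. X \<omega> * Y \<omega>) - expectation X * expectation Y)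
      \<le> ?t\<^sup>2 * variance X + variance Y"
    by simp
  also have "\<dots> \<le> ?t\<^sup>2 * \<sigma>\<^sup>2 + c\<^sup>2" using assms vY by (intro add_mono mult_left_mono) auto
  also have "\<dots> = 2 * ?t * (\<sigma> * c)" using assms
      by (simp add: power_divide field_simps power2_eq_square)
  finally have "expectation (\<lambda>\<omega>. X \<omega> * Y \<omega>) - expectation X * expectation Y \<le> \<sigma> * c"
    using t by (elim mult_left_le_imp_le) simp
  then show ?thesis using variance_sum_eq[OF X Y] assms(3) vY by (simp add: power2_sum)
qed

end

section \<open>Pathwise relations of passage times, and crossings of separate slabs\<close>

context below
begin

lemma strip_time_same:
  assumes w: "\<And>e. e \<in> edges_below f \<Longrightarrow> 0 \<le> w e" and "0 \<le> a"
  shows "strip_time f w a a = 0"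
proof (rule order.antisym)
  have "links {} (column f a) (column f a)"
    unfolding links_def using axis_in[OF assms(2)] conn_refl by blast
  then show "strip_time f w a a \<le> 0" using strip_time_le[of "{}" a a w] by simp
  show "0 \<le> strip_time f w a a" using assms(2) by (intro strip_time_nonneg w) auto
qed

end

context fpp
begin

lemma T_nonneg: "0 \<le> a \<Longrightarrow> a \<le> b \<Longrightarrow> 0 \<le> T a b \<omega>"
  unfolding T_def by (rule strip_time_nonneg[OF weight_nonneg'])

lemma T_superadditive:
  "0 \<le> x \<Longrightarrow> x \<le> u \<Longrightarrow> u \<le> v \<Longrightarrow> v \<le> y \<Longrightarrow> T x u \<omega> + T u v \<omega> + T v y \<omega> \<le> T x y \<omega>"
  unfolding T_def by (rule strip_time_superadditive[OF weight_nonneg'])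

lemma T_mono: "0 \<le> x \<Longrightarrow> x \<le> u \<Longrightarrow> u \<le> v \<Longrightarrow> v \<le> y \<Longrightarrow> T u v \<omega> \<le> T x y \<omega>"
  unfolding T_def by (rule strip_time_mono[OF weight_nonneg'])

lemma T_same: "0 \<le> a \<Longrightarrow> T a a \<omega> = 0"
  unfolding T_def by (rule strip_time_same[OF weight_nonneg'])

lemma T_glue:
  assumes "0 \<le> x" "x \<le> a" "a \<le> u" "u \<le> v" "v \<le> b" "b \<le> y"
    and "a = x \<or> (\<exists>c d. a \<le> c \<and> d \<le> u \<and> crossing f c d (closed_edges \<omega>))"
    and "b = y \<or> (\<exists>c d. v \<le> c \<and> d \<le> b \<and> crossing f c d (closed_edges \<omega>))"
  shows "T x y \<omega> \<le> T x u \<omega> + T a b \<omega> + T v y \<omega>"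
  unfolding T_def
proof (rule strip_time_glue[OF weight_nonneg' _ assms])
  fix e assume "e \<in> edges_below f" "e \<notin> closed_edges \<omega>"
  then show "\<tau> e \<omega> = 0"
    using weight_nonneg'[of e \<omega>] edges_below_subset by (fastforce simp: closed_edges_def)
qed

lemma B_superadditive:
  "0 \<le> x \<Longrightarrow> x \<le> u \<Longrightarrow> u \<le> v \<Longrightarrow> v \<le> y \<Longrightarrow> B x u \<omega> + B u v \<omega> + B v y \<omega> \<le> B x y \<omega>"
  unfolding B_def btime_def by (rule strip_time_superadditive) auto

text \<open>A minimiser for \<open>T\<close> contains at least \<open>B\<close> closed edges, each
  of weight above \<open>\<delta>\<close>.\<close>

lemma T_ge_B:
  assumes "0 \<le> a" "a \<le> b"
  shows "\<delta> * real (B a b \<omega>) \<le> T a b \<omega>"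
proof -
  let ?Q = "closed_edges \<omega>"
  obtain A where A: "A \<subseteq> strip f a b" "links A (column f a) (column f b)" "T a b \<omega> = (\<Sum>e\<in>A. \<tau> e \<omega>)"
    unfolding T_def using strip_time_attained[OF assms] by metis
  have fin: "finite A" using A finite_strip finite_subset by blast
  have "B a b \<omega> \<le> (\<Sum>e\<in>A. of_bool (e \<in> ?Q))"
    unfolding B_def btime_def by (rule strip_time_le[OF A(1,2)])
  then have "real (B a b \<omega>) \<le> (\<Sum>e\<in>A. of_bool (e \<in> ?Q))"
    using of_nat_mono[where 'a = real] by fastforce
  then have "\<delta> * real (B a b \<omega>) \<le> (\<Sum>e\<in>A. \<delta> * of_bool (e \<in> ?Q))"
    using \<delta>_pos by (simp add: sum_distrib_left[symmetric])
  also have "\<dots> \<le> (\<Sum>e\<in>A. \<tau> e \<omega>)"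
  proof (rule sum_mono)
    fix e assume "e \<in> A"
    then have "e \<in> edges_Z2" using A(1) strip_edges_Z2 by blast
    then show "\<delta> * of_bool (e \<in> ?Q) \<le> \<tau> e \<omega>"
      using weight_values[of e \<omega>] weight_nonneg[of e \<omega>] by (auto simp: closed_edges_def)
  qed
  finally show ?thesis using A(3) by simp
qed

text \<open>For integrability the crude bound of the Bernoulli time by the number of edges is
  enough.\<close>

lemma sq_integrable_T:
  assumes "0 \<le> a" "a \<le> b"
  shows "sq_integrable (T a b)"
proof (rule sq_integrable_nn_integral(1))
  show "random_variable borel (T a b)" by (rule measurable_T)
  let ?n = "real (card (strip f a b))"
  have "(\<integral>\<^sup>+\<omega>. ennreal ((T a b \<omega>)\<^sup>2) \<partial>M) = (\<integral>\<^sup>+\<omega>. 1 * ennreal ((T a b \<omega>)\<^sup>2) \<partial>M)" by simp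
  also have "\<dots> \<le> ennreal (s / q) * (\<integral>\<^sup>+\<omega>. 1 * ennreal ((real (B a b \<omega>))\<^sup>2) \<partial>M)"
    by (rule T_second_moment_le[OF assms finite_strip strip_edges_Z2 subset_refl]) simp
  also have "\<dots> \<le> ennreal (s / q) * (\<integral>\<^sup>+\<omega>. ennreal (?n\<^sup>2) \<partial>M)"
    using B_bounded[OF assms] by (intro mult_left_mono nn_integral_mono) (auto intro!:
        ennreal_leI power_mono)
  also have "\<dots> = ennreal (s / q * ?n\<^sup>2)"
    using s_nonneg q_pos
    by (simp add: emeasure_space_1 ennreal_mult[symmetric] del: times_divide_eq_left)
  finally show "(\<integral>\<^sup>+\<omega>. ennreal ((T a b \<omega>)\<^sup>2) \<partial>M) \<le> ennreal (s / q * ?n\<^sup>2)" .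
  show "0 \<le> s / q * ?n\<^sup>2" using s_nonneg q_pos by simp
qed

lemma crossing_local:
  assumes "slab f c d \<subseteq> I"
  shows "crossing f c d Q = crossing f c d (Q \<inter> I)"
proof -
  have "Q \<inter> I \<inter> slab f c d = Q \<inter> slab f c d" using assms by auto
  then show ?thesis using crossing_slab[of f c d Q] crossing_slab[of f c d "Q \<inter> I"] by simp
qed

lemma based_on_crossing: "based_on (slab f c d) (count_space UNIV) (\<lambda>\<omega>. h (crossing f c
    d (closed_edges \<omega>)))"
  using crossing_local[OF subset_refl, of c d] finite_slab slab_edges_Z2
  by (intro based_on_closed_edges) auto

lemma prob_no_crossing:
  assumes \<rho>: "\<And>i. i < l \<Longrightarrow> 1 - \<rho> \<le> prob {\<omega> \<in> space M. crossing f (c i) (d i) (closed_edges \<omega>)}"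
    and disj: "\<And>i j. i < j \<Longrightarrow> j < l \<Longrightarrow> slab f (c i) (d i) \<inter> slab f (c j) (d j) = {}"
    and "0 \<le> \<rho>"
  shows "prob {\<omega> \<in> space M. \<forall>i<l. \<not> crossing f (c i) (d i) (closed_edges \<omega>)} \<le> \<rho> ^ l"
  using \<rho> disj
proof (induction l)
  case (Suc l)
  let ?C = "\<lambda>i Q. crossing f (c i) (d i) Q"
  let ?J = "\<Union>i<l. slab f (c i) (d i)"
  have J: "finite ?J" "?J \<subseteq> edges_Z2" using finite_slab slab_edges_Z2 by (auto, blast)
  have "based_on ?J (count_space UNIV) (\<lambda>\<omega>. \<forall>i<l. \<not> ?C i (closed_edges \<omega>))"
  proof (rule based_on_closed_edges[OF J])
    fix Q
    have "?C i Q = ?C i (Q \<inter> ?J)" if "i < l" for i using that by (intro crossing_local) auto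
    then show "(\<forall>i<l. \<not> ?C i Q) = (\<forall>i<l. \<not> ?C i (Q \<inter> ?J))" by auto
  qed simp
  moreover have "?J \<inter> slab f (c l) (d l) = {}" using Suc.prems(2) by blast
  ultimately have "prob {\<omega> \<in> space M. (\<forall>i<l. \<not> ?C i (closed_edges \<omega>)) \<and> \<not> ?C l (closed_edges \<omega>)}
      = prob {\<omega> \<in> space M. \<forall>i<l. \<not> ?C i (closed_edges \<omega>)} * prob {\<omega> \<in> space M. \<not> ?C l
          (closed_edges \<omega>)}"
    using J slab_edges_Z2 by (intro prob_indep_based[OF _ based_on_crossing]) auto
  moreover have "prob {\<omega> \<in> space M. \<not> ?C l (closed_edges \<omega>)} \<le> \<rho>"
  proof -
    have "{\<omega> \<in> space M. ?C l (closed_edges \<omega>)} \<in> events"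
      using based_on_measurable[OF slab_edges_Z2 based_on_crossing[of "c l" "d l" "\<lambda>x. x"]]
          by (simp add: pred_def)
    then have "prob {\<omega> \<in> space M. \<not> ?C l (closed_edges \<omega>)}
        = 1 - prob {\<omega> \<in> space M. ?C l (closed_edges \<omega>)}"
      by (rule prob_neg)
    then show ?thesis using Suc.prems(1)[of l] by simp
  qed
  moreover have "prob {\<omega> \<in> space M. \<forall>i<l. \<not> ?C i (closed_edges \<omega>)} \<le> \<rho> ^ l"
    using Suc.prems by (intro Suc.IH) auto
  ultimately have "prob {\<omega> \<in> space M. (\<forall>i<l. \<not> ?C i (closed_edges \<omega>)) \<and> \<not> ?C l (closed_edges \<omega>)}
      \<le> \<rho> ^ l * \<rho>"
    using assms(3) by (simp add: mult_mono)
  moreover have "{\<omega> \<in> space M. \<forall>i<Suc l. \<not> ?C i (closed_edges \<omega>)}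
      = {\<omega> \<in> space M. (\<forall>i<l. \<not> ?C i (closed_edges \<omega>)) \<and> \<not> ?C l (closed_edges \<omega>)}"
    by (auto simp: less_Suc_eq)
  ultimately show ?case by (simp add: mult.commute)
qed (simp add: prob_space)

end

section \<open>Blocks of columns\<close>

text \<open>The assumptions A1 and A2 in uniform form. The sequence \<open>u\<close> will be
  \<open>r\<close> with finitely many terms dropped, and \<open>mean_B\<close> comes from A2 because
  superadditivity bounds the mean over some blocks by a difference of means from column 0.\<close>

locale fpp_blocks = fpp +
  fixes u :: "nat \<Rightarrow> int" and \<rho> K :: real
  assumes u_mono: "strict_mono u" and u_0: "0 \<le> u 0"
    and \<rho>: "0 < \<rho>" "\<rho> < 1" and K: "1 \<le> K"
    and prob_crossing: "1 - \<rho> \<le> prob {\<omega> \<in> space M. crossing f (u j) (u (Suc j)) (closed_edges \<omega>)}"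
    and mean_B: "i \<le> j \<Longrightarrow> expectation (\<lambda>\<omega>. real (B (u i) (u j) \<omega>)) \<le> K * (real j - real i)"
begin

lemma u_le: "i \<le> j \<Longrightarrow> u i \<le> u j"
  using u_mono by (simp add: strict_mono_less_eq)

lemma u_less: "i < j \<Longrightarrow> u i < u j"
  using u_mono by (simp add: strict_mono_less)

lemma u_nonneg: "0 \<le> u i"
  using u_le[of 0 i] u_0 by simp

lemma u_le_iff: "u i \<le> u j \<longleftrightarrow> i \<le> j"
  using u_mono by (simp add: strict_mono_less_eq)

text \<open>If the search on both sides ends within \<open>l + 1\<close> trials, at most
  \<open>4 * (l + 1)\<close> blocks are spanned, whence the argument \<open>4 * K\<close>. The added
  1 makes \<open>C\<close> positive.\<close>

definition C :: real where
  "C = sqrt (gap_const (4 * K) \<rho>) + 1"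

lemma C_pos: "0 < C"
  unfolding C_def using gap_const_nonneg[OF \<rho>, of "4 * K"] by (simp add: add_nonneg_pos)

lemma gap_const_le: "gap_const (4 * K) \<rho> \<le> C\<^sup>2"
  unfolding C_def using gap_const_nonneg[OF \<rho>, of "4 * K"] by (simp add: power2_sum)

text \<open>Since all of block \<open>k\<close> is left out, the two subtracted times are
  independent of this block as well as of each other, and the gap is at least the crossing time of
  the block.\<close>

definition gap :: "nat \<Rightarrow> nat \<Rightarrow> nat \<Rightarrow> 'a \<Rightarrow> real" where
  "gap i k j \<omega> = T (u i) (u j) \<omega> - T (u i) (u k) \<omega> - T (u (Suc k)) (u j) \<omega>"

lemma gap_nonneg:
  assumes "i \<le> k" "k < j"
  shows "T (u k) (u (Suc k)) \<omega> \<le> gap i k j \<omega>" "0 \<le> gap i k j \<omega>"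
proof -
  show "T (u k) (u (Suc k)) \<omega> \<le> gap i k j \<omega>"
    using T_superadditive[of "u i" "u k" "u (Suc k)" "u j" \<omega>] u_nonneg u_le[of i k] u_le[of k
        "Suc k"] u_le[of "Suc k" j] assms
    by (simp add: gap_def)
  moreover have "0 \<le> T (u k) (u (Suc k)) \<omega>" using u_nonneg u_le by (intro T_nonneg) auto
  ultimately show "0 \<le> gap i k j \<omega>" by simp
qed

text \<open>Adjacent slabs share the vertical edges of their common column, which a crossing may
  use; therefore only every other block is tried.\<close>

lemma slab_blocks_disjoint: "Suc i < j \<Longrightarrow> slab f (u i) (u (Suc i)) \<inter> slab f (u j) (u (Suc j)) = {}"
  by (rule slab_disjoint) (rule u_less)

lemma prob_no_crossing_right:
  "prob {\<omega> \<in> space M. \<forall>i<l. \<not> crossing f (u (k + 2 * i)) (u (Suc (k + 2 * i))) (closed_edges \<omega>)}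
      \<le> \<rho> ^ l"
  using prob_crossing \<rho> by (intro prob_no_crossing slab_blocks_disjoint) auto

text \<open>The condition \<open>2 * i < k\<close> says that there is still a block to be tried, and
  it keeps the truncated subtractions exact. When the blocks run out the event is empty, so the
  search counts as ended.\<close>

lemma prob_no_crossing_left:
  "prob {\<omega> \<in> space M. \<forall>i<l. 2 * i < k \<and> \<not> crossing f (u (k - 1 - 2 * i)) (u (k - 2 *
      i)) (closed_edges \<omega>)} \<le> \<rho> ^ l"
proof (cases "\<forall>i<l. 2 * i < k")
  case True
  then have S: "k - 2 * i = Suc (k - 1 - 2 * i)" if "i < l" for i using that by fastforce
  have "prob {\<omega> \<in> space M. \<forall>i<l. \<not> crossing f (u (k - 1 - 2 * i)) (u (k - 2 * i)) (closed_edges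
      \<omega>)} \<le> \<rho> ^ l"
  proof (rule prob_no_crossing)
    fix i assume "i < l"
    then show "1 - \<rho> \<le> prob {\<omega> \<in> space M. crossing f (u (k - 1 - 2 * i)) (u (k - 2 *
        i)) (closed_edges \<omega>)}"
      using prob_crossing S by simp
  next
    fix i j assume ij: "i < j" "j < l"
    then have "2 * j < k" using True by simp
    then have "slab f (u (k - 1 - 2 * j)) (u (Suc (k - 1 - 2 * j))) \<inter>
        slab f (u (k - 1 - 2 * i)) (u (Suc (k - 1 - 2 * i))) = {}"
      using ij by (intro slab_blocks_disjoint) auto
    then show "slab f (u (k - 1 - 2 * i)) (u (k - 2 * i)) \<inter> slab f (u (k - 1 - 2 * j)) (u (k - 2
        * j)) = {}"
      using S[of i] S[of j] ij by (simp add: Int_commute)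
  qed (use \<rho> in simp)
  then show ?thesis using True by simp
next
  case False
  then have "{\<omega> \<in> space M. \<forall>i<l. 2 * i < k \<and> \<not> crossing f (u (k - 1 - 2 * i)) (u (k - 2 *
      i)) (closed_edges \<omega>)} = {}"
    by auto
  then show ?thesis using \<rho> by (simp only: measure_empty) simp
qed

lemma gap_second_moment_le:
  assumes "i \<le> k" "k < j"
  shows "(\<integral>\<^sup>+\<omega>. ennreal ((gap i k j \<omega>)\<^sup>2) \<partial>M) \<le> ennreal (C\<^sup>2)"
proof -
  \<comment> \<open>The window containing the first \<open>l + 1\<close> trials on either side, in
    the blocks \<open>k - 1 - 2 * i\<close> and \<open>k + 1 + 2 * i\<close> with
    \<open>i \<le> l\<close>. On the left, truncated subtraction stops it at
    \<open>u 0\<close>.\<close>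
  let ?a = "\<lambda>l. u (k - (1 + 2 * l))" and ?b = "\<lambda>l. u (k + 2 + 2 * l)"
  define HR where "HR = (\<lambda>l Q. \<forall>i<l. \<not> crossing f (u (Suc k + 2 * i)) (u (Suc (Suc k + 2 * i))) Q)"
  define HL where "HL = (\<lambda>l Q. \<forall>i<l. 2 * i < k
      \<and> \<not> crossing f (u (k - 1 - 2 * i)) (u (k - 2 * i)) Q)"
  let ?I = "\<lambda>l. slab f (u 0) (u (k + 2 + 2 * l))"
  have sub: "slab f (u i) (u j) \<subseteq> ?I l" if "j \<le> k + 2 + 2 * l" for i j l
    using that u_le by (intro slab_mono) auto
  have loc: "HR l Q = HR l (Q \<inter> ?I l)" "HL l Q = HL l (Q \<inter> ?I l)" for l Q
  proof -
    have "crossing f (u (Suc k + 2 * i)) (u (Suc (Suc k + 2 * i))) Q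
        = crossing f (u (Suc k + 2 * i)) (u (Suc (Suc k + 2 * i))) (Q \<inter> ?I l)" if "i < l" for i
      using that by (intro crossing_local sub) auto
    then show "HR l Q = HR l (Q \<inter> ?I l)" by (simp add: HR_def)
    have "crossing f (u (k - 1 - 2 * i)) (u (k - 2 * i)) Q
        = crossing f (u (k - 1 - 2 * i)) (u (k - 2 * i)) (Q \<inter> ?I l)" for i
      by (intro crossing_local sub) auto
    then show "HL l Q = HL l (Q \<inter> ?I l)" by (simp add: HL_def)
  qed
  have meas: "{\<omega> \<in> space M. P (closed_edges \<omega>)} \<in> events" if "\<And>Q. P Q = P (Q \<inter> ?I l)" for P l
    using based_on_measurable[OF slab_edges_Z2 based_on_closed_edges[of "?I l" P
        "count_space UNIV"]] that finite_slab slab_edges_Z2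
    by (simp add: pred_def)
  have "(\<integral>\<^sup>+\<omega>. ennreal ((gap i k j \<omega>)\<^sup>2) \<partial>M) \<le> ennreal (gap_const (4 * K) \<rho>)"
  proof (rule gap_second_moment[where a = ?a and b = ?b and H = "\<lambda>l Q. HR l Q \<or> HL l Q" and I = ?I])
    show "0 \<le> ?a l" "?a l \<le> ?b l" for l using u_nonneg u_le by auto
    show "1 \<le> 4 * K" "0 < \<rho>" "\<rho> < 1" using K \<rho> by auto
    show "expectation (\<lambda>\<omega>. real (B (?a l) (?b l) \<omega>)) \<le> 4 * K * (real l + 1)" for l
    proof -
      have "expectation (\<lambda>\<omega>. real (B (?a l) (?b l) \<omega>)) \<le> K * (real (k + 2 + 2 * l) - real (k - (1
          + 2 * l)))"
        by (rule mean_B) simp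
      also have "\<dots> \<le> K * (4 * (real l + 1))" using K by (intro mult_left_mono) auto
      finally show ?thesis by (simp add: mult_ac)
    qed
    show "finite (?I l)" "?I l \<subseteq> edges_Z2" for l using finite_slab slab_edges_Z2 by auto
    show "(HR l Q \<or> HL l Q) = (HR l (Q \<inter> ?I l) \<or> HL l (Q \<inter> ?I l))" for l Q using loc by simp
    show "HR 0 Q \<or> HL 0 Q" for Q by (simp add: HR_def)
    show "prob {\<omega> \<in> space M. HR l (closed_edges \<omega>) \<or> HL l (closed_edges \<omega>)} \<le> 2 * \<rho> ^ l" for l
    proof -
      have "{\<omega> \<in> space M. HR l (closed_edges \<omega>) \<or> HL l (closed_edges \<omega>)}
          = {\<omega> \<in> space M. HR l (closed_edges \<omega>)} \<union> {\<omega> \<in> space M. HL l (closed_edges \<omega>)}" by auto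
      also have "prob \<dots> \<le> prob {\<omega> \<in> space M. HR l (closed_edges \<omega>)}
          + prob {\<omega> \<in> space M. HL l (closed_edges \<omega>)}"
        by (intro measure_Un_le meas[of _ l] loc)
      also have "\<dots> \<le> \<rho> ^ l + \<rho> ^ l"
        unfolding HR_def HL_def by (intro add_mono prob_no_crossing_left prob_no_crossing_right)
      finally show ?thesis by simp
    qed
    show "gap i k j \<in> borel_measurable M" unfolding gap_def by measurable
    show "0 \<le> gap i k j \<omega>" for \<omega> by (rule gap_nonneg[OF assms])
    show "gap i k j \<omega> \<le> T (?a l) (?b l) \<omega>" if nH: "\<not> (HR (Suc l) (closed_edges \<omega>) \<or> HL (Suc
        l) (closed_edges \<omega>))" for l \<omega>
    proof -
      from nH obtain i1 where i1: "i1 \<le> l"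
        "crossing f (u (Suc k + 2 * i1)) (u (Suc (Suc k + 2 * i1))) (closed_edges \<omega>)"
        by (auto simp: HR_def less_Suc_eq_le)
      from nH obtain i2 where i2: "i2 \<le> l"
        "2 * i2 < k \<longrightarrow> crossing f (u (k - 1 - 2 * i2)) (u (k - 2 * i2)) (closed_edges \<omega>)"
        by (auto simp: HL_def less_Suc_eq_le)
      let ?a' = "max (u i) (?a l)" and ?b' = "min (u j) (?b l)"
      have L: "?a' = u i \<or> (\<exists>c d. ?a' \<le> c \<and> d \<le> u k \<and> crossing f c d (closed_edges \<omega>))"
      proof (cases "?a l \<le> u i")
        case False
        then have "i < k - (1 + 2 * l)" unfolding u_le_iff by simp
        then have "2 * i2 < k" "k - (1 + 2 * l) \<le> k - 1 - 2 * i2" using i2(1) by auto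
        then show ?thesis using i2(2) False u_le
          by (intro disjI2 exI[of _ "u (k - 1 - 2 * i2)"] exI[of _ "u (k - 2 * i2)"]) auto
      qed auto
      have R: "?b' = u j \<or> (\<exists>c d. u (Suc k) \<le> c \<and> d \<le> ?b' \<and> crossing f c d (closed_edges \<omega>))"
      proof (cases "u j \<le> ?b l")
        case False
        then have b: "?b' = ?b l" by simp
        show ?thesis unfolding b using i1 u_le
          by (intro disjI2 exI[of _ "u (Suc k + 2 * i1)"] exI[of _ "u (Suc (Suc k + 2 * i1))"]) auto
      qed auto
      have "T (u i) (u j) \<omega> \<le> T (u i) (u k) \<omega> + T ?a' ?b' \<omega> + T (u (Suc k)) (u j) \<omega>"
        using assms u_le u_nonneg by (intro T_glue L R) (auto simp: u_le_iff)
      moreover have "T ?a' ?b' \<omega> \<le> T (?a l) (?b l) \<omega>"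
      proof (rule T_mono)
        have "u i \<le> u k" "?a l \<le> u k" "u k \<le> u j" "u k \<le> ?b l" using assms u_le by auto
        then show "?a' \<le> ?b'" by auto
      qed (use u_nonneg in auto)
      ultimately show ?thesis by (simp add: gap_def)
    qed
  qed
  also have "\<dots> \<le> ennreal (C\<^sup>2)" using gap_const_le by (rule ennreal_leI)
  finally show ?thesis .
qed

lemma sq_integrable_T_u: "i \<le> j \<Longrightarrow> sq_integrable (T (u i) (u j))"
  using u_nonneg u_le by (intro sq_integrable_T) auto

lemma gap_bounds:
  assumes "i \<le> k" "k < j"
  shows "sq_integrable (gap i k j)" "expectation (\<lambda>\<omega>. (gap i k j \<omega>)\<^sup>2)
      \<le> C\<^sup>2" "expectation (gap i k j) \<le> C"
proof -
  have m: "gap i k j \<in> borel_measurable M" unfolding gap_def by measurable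
  show 1: "sq_integrable (gap i k j)" and 2: "expectation (\<lambda>\<omega>. (gap i k j \<omega>)\<^sup>2) \<le> C\<^sup>2"
    using sq_integrable_nn_integral[OF m gap_second_moment_le[OF assms]] by auto
  show "expectation (gap i k j) \<le> C" using expectation_le_sqrt[OF 1 2] C_pos by simp
qed

section \<open>Linear upper bounds for variance and mean\<close>

fun \<sigma> :: "nat \<Rightarrow> real" where
  "\<sigma> 0 = C" |
  "\<sigma> (Suc n) = sqrt 2 * \<sigma> n + C"

lemma \<sigma>_pos: "0 < \<sigma> n"
  using C_pos by (induction n) (auto intro: add_pos_pos)

text \<open>The fixed point of the recursion is \<open>- (1 + sqrt 2) * C\<close>, and the distance
  to it grows by the factor \<open>sqrt 2\<close>.\<close>

lemma \<sigma>_eq: "\<sigma> n = (2 + sqrt 2) * C * sqrt 2 ^ n - (1 + sqrt 2) * C"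
proof (induction n)
  case (Suc n)
  have "\<sigma> (Suc n) = sqrt 2 * ((2 + sqrt 2) * C * sqrt 2 ^ n - (1 + sqrt 2) * C) + C"
    by (simp only: Suc \<sigma>.simps)
  also have "\<dots> = (2 + sqrt 2) * C * sqrt 2 ^ Suc n - (sqrt 2 * sqrt 2 + sqrt 2 - 1) * C"
    by (simp add: algebra_simps)
  finally show ?case by (simp add: algebra_simps)
qed (simp add: algebra_simps)

lemma indep_T_u:
  assumes "i \<le> k" "k \<le> k'" "k' \<le> j"
  shows "indep_var borel (T (u i) (u k)) borel (T (u k') (u j))"
  using strip_disjoint[OF u_le[OF assms(2)]] strip_edges_Z2
  by (intro indep_var_based[OF based_on_T based_on_T]) auto

text \<open>
  Splitting at the middle block costs an \<open>L\<^sup>2\<close> error of at most \<open>C\<close>, hence the standard deviation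
  over \<open>2\<^sup>n\<^sup>+\<^sup>1\<close> blocks is at most \<open>sqrt 2\<close> times the one over \<open>2\<^sup>n\<close> blocks plus \<open>C\<close>.
\<close>

lemma variance_T_dyadic:
  assumes "i \<le> j" "j \<le> i + 2 ^ n"
  shows "variance (T (u i) (u j)) \<le> (\<sigma> n)\<^sup>2"
  using assms
proof (induction n arbitrary: i j)
  case 0
  show ?case
  proof (cases "j = i")
    case True
    have "T (u i) (u j) = (\<lambda>_. 0)" using True T_same[OF u_nonneg] by auto
    then show ?thesis by simp
  next
    case False
    then have j: "j = Suc i" using 0 by simp
    \<comment> \<open>For a single block both subtracted times vanish, so the gap is the crossing
      time itself.\<close>
    have "gap i i j = T (u i) (u j)"
      using T_same[OF u_nonneg] by (auto simp: gap_def j)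
    then show ?thesis
      using gap_bounds[of i i j] variance_le_second_moment[of "gap i i j"] j by simp
  qed
next
  case (Suc n)
  show ?case
  proof (cases "j = i")
    case True
    have "T (u i) (u j) = (\<lambda>_. 0)" using True T_same[OF u_nonneg] by auto
    then show ?thesis by simp
  next
    case False
    define k where "k = i + (j - i) div 2"
    have k: "i \<le> k" "k < j" "k \<le> i + 2 ^ n" "j \<le> Suc k + 2 ^ n"
      using False Suc.prems by (auto simp: k_def)
    let ?U = "T (u i) (u k)" and ?V = "T (u (Suc k)) (u j)"
    have sq: "sq_integrable ?U" "sq_integrable ?V" using k by (auto intro!: sq_integrable_T_u)
    have "variance (\<lambda>\<omega>. ?U \<omega> + ?V \<omega>) = variance ?U + variance ?V"
      using k by (intro variance_add_indep sq indep_T_u) auto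
    also have "\<dots> \<le> (\<sigma> n)\<^sup>2 + (\<sigma> n)\<^sup>2" using k by (intro add_mono Suc.IH) auto
    also have "\<dots> = (sqrt 2 * \<sigma> n)\<^sup>2" by (simp add: power_mult_distrib)
    finally have "variance (\<lambda>\<omega>. (?U \<omega> + ?V \<omega>) + gap i k j \<omega>) \<le> (sqrt 2 * \<sigma> n + C)\<^sup>2"
      using k \<sigma>_pos C_pos by (intro variance_minkowski sq_integrable_add sq gap_bounds) auto
    moreover have eq: "T (u i) (u j) = (\<lambda>\<omega>. (?U \<omega> + ?V \<omega>) + gap i k j \<omega>)" by (auto simp: gap_def)
    ultimately show ?thesis unfolding eq \<sigma>.simps by blast
  qed
qed

lemma exists_dyadic: "0 < m \<Longrightarrow> \<exists>n. m \<le> 2 ^ n \<and> 2 ^ n \<le> 2 * m" for m :: nat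
proof (induction m)
  case (Suc m)
  show ?case
  proof (cases "m = 0")
    case False
    then obtain n where n: "m \<le> 2 ^ n" "2 ^ n \<le> 2 * m" using Suc by auto
    show ?thesis
    proof (cases "m = 2 ^ n")
      case True
      then show ?thesis using False by (intro exI[of _ "Suc n"]) auto
    qed (use n in \<open>intro exI[of _ n], auto\<close>)
  qed (auto intro: exI[of _ 0])
qed simp

text \<open>The standard deviations grow like \<open>sqrt 2 ^ n\<close>, whose square
  \<open>2 ^ n\<close> is at most \<open>2 * m\<close> for the smallest dyadic number of blocks that
  suffices.\<close>

lemma variance_T_le:
  assumes "0 < m"
  shows "variance (T (u 0) (u m)) \<le> 2 * ((2 + sqrt 2) * C)\<^sup>2 * real m"
proof -
  obtain n where n: "m \<le> 2 ^ n" "2 ^ n \<le> 2 * m" using exists_dyadic[OF assms] by auto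
  have "variance (T (u 0) (u m)) \<le> (\<sigma> n)\<^sup>2" using n by (intro variance_T_dyadic) auto
  also have "\<dots> \<le> ((2 + sqrt 2) * C * sqrt 2 ^ n)\<^sup>2"
    using \<sigma>_pos[of n] C_pos by (intro power_mono) (auto simp: \<sigma>_eq)
  also have "\<dots> = ((2 + sqrt 2) * C)\<^sup>2 * 2 ^ n"
  proof -
    have "(sqrt 2 ^ n)\<^sup>2 = (2::real) ^ n" by (simp add: power_mult[symmetric] mult.commute[of
        n] power_mult)
    then show ?thesis by (simp add: power_mult_distrib)
  qed
  also have "\<dots> \<le> ((2 + sqrt 2) * C)\<^sup>2 * (2 * real m)"
    using of_nat_mono[OF n(2), where 'a = real] by (intro mult_left_mono) auto
  finally show ?thesis by (simp add: mult_ac)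
qed

lemma expectation_T_le: "expectation (T (u 0) (u m)) \<le> C * real m"
proof (induction m)
  case 0
  have "T (u 0) (u 0) = (\<lambda>_. 0)" using T_same[OF u_nonneg] by auto
  then show ?case by simp
next
  case (Suc m)
  have "T (u 0) (u (Suc m)) = (\<lambda>\<omega>. T (u 0) (u m) \<omega> + gap 0 m (Suc m) \<omega>)"
    using T_same[OF u_nonneg] by (auto simp: gap_def)
  then have "expectation (T (u 0) (u (Suc m))) = expectation (T (u 0) (u m))
      + expectation (gap 0 m (Suc m))"
    using sq_integrable_integrable[OF sq_integrable_T_u[of 0 m]]
        sq_integrable_integrable[OF gap_bounds(1)[of 0 m "Suc m"]]
    by simp
  then show ?case using Suc gap_bounds(3)[of 0 m "Suc m"] by (simp add: algebra_simps)
qed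

section \<open>Linear lower bounds by counting slow blocks\<close>

definition slow :: "nat \<Rightarrow> nat \<Rightarrow> 'a \<Rightarrow> real" where
  "slow m k \<omega> = of_bool (m \<le> B (u k) (u (Suc k)) \<omega>)"

lemma based_on_slow: "based_on (strip f (u k) (u (Suc k))) borel (slow m k)"
  unfolding slow_def by (rule based_on_B) (auto simp: finite_strip strip_edges_Z2)

lemma sq_integrable_slow: "sq_integrable (slow m k)"
proof -
  have "random_variable borel (slow m k)" by (rule based_on_measurable[OF
      strip_edges_Z2 based_on_slow])
  moreover have "(\<lambda>\<omega>. (slow m k \<omega>)\<^sup>2) = slow m k" by (auto simp: slow_def)
  moreover have "integrable M (slow m k)"
    using calculation(1) by (intro integrable_const_bound[where B = 1]) (auto simp: slow_def)
  ultimately show ?thesis unfolding sq_integrable_def by simp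
qed

lemma expectation_slow: "expectation (slow m k) = prob {\<omega> \<in> space M. m \<le> B (u k) (u (Suc k)) \<omega>}"
proof -
  have ev: "{\<omega> \<in> space M. m \<le> B (u k) (u (Suc k)) \<omega>} \<in> events"
    using measurable_B[of "count_space UNIV" "\<lambda>j. m \<le> j" "u k" "u (Suc k)"] by (simp add: pred_def)
  have "expectation (slow m k) = expectation (indicator {\<omega> \<in> space M. m \<le> B (u k) (u (Suc k)) \<omega>})"
    by (intro Bochner_Integration.integral_cong) (auto simp: slow_def indicator_def)
  then show ?thesis using ev by simp
qed

lemma expectation_T_block_ge:
  "\<delta> * real m * expectation (slow m k) \<le> expectation (T (u k) (u (Suc k)))"
proof -
  have "\<delta> * real m * slow m k \<omega> \<le> T (u k) (u (Suc k)) \<omega>" for \<omega>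
  proof -
    have "\<delta> * real m * slow m k \<omega> \<le> \<delta> * real (B (u k) (u (Suc k)) \<omega>)"
      using \<delta>_pos by (auto simp: slow_def)
    also have "\<dots> \<le> T (u k) (u (Suc k)) \<omega>" using u_nonneg u_le by (intro T_ge_B) auto
    finally show ?thesis .
  qed
  then have "expectation (\<lambda>\<omega>. \<delta> * real m * slow m k \<omega>) \<le> expectation (T (u k) (u (Suc k)))"
    using sq_integrable_integrable[OF sq_integrable_slow]
        sq_integrable_integrable[OF sq_integrable_T_u[of k "Suc k"]]
    by (intro integral_mono) auto
  then show ?thesis by simp
qed

lemma expectation_T_ge:
  assumes "\<And>k. \<kappa> \<le> expectation (slow 1 k)"
  shows "\<delta> * \<kappa> * real n \<le> expectation (T (u 0) (u n))"
proof (induction n)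
  case 0
  have "T (u 0) (u 0) = (\<lambda>_. 0)" using T_same[OF u_nonneg] by auto
  then show ?case by simp
next
  case (Suc n)
  note i = sq_integrable_integrable[OF sq_integrable_T_u]
  have "\<delta> * \<kappa> \<le> \<delta> * real 1 * expectation (slow 1 n)" using assms[of n] \<delta>_pos by simp
  also have "\<dots> \<le> expectation (T (u n) (u (Suc n)))" by (rule expectation_T_block_ge)
  finally have "\<delta> * \<kappa> * real (Suc n) \<le> expectation (T (u 0) (u n))
      + expectation (T (u n) (u (Suc n)))"
    using Suc by (simp add: algebra_simps)
  also have "\<dots> = expectation (\<lambda>\<omega>. T (u 0) (u n) \<omega> + T (u n) (u (Suc n)) \<omega>)" using i by simp
  also have "\<dots> \<le> expectation (T (u 0) (u (Suc n)))"
  proof (intro integral_mono)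
    show "T (u 0) (u n) \<omega> + T (u n) (u (Suc n)) \<omega> \<le> T (u 0) (u (Suc n)) \<omega>" for \<omega>
      using gap_nonneg(1)[of 0 n "Suc n" \<omega>] T_same[OF u_nonneg] by (simp add: gap_def)
  qed (use i in auto)
  finally show ?case .
qed

text \<open>The passage times before and after block \<open>k\<close> are independent of the block.
  The gap has mean at most \<open>C\<close>, but if the block is slow it is at least
  \<open>\<delta> * m\<close>, hence at least \<open>C + 1\<close>. The surplus of 1 makes the
  covariance at least the probability of a slow block.\<close>

lemma covariance_slow_ge:
  assumes m: "C + 1 \<le> \<delta> * real m" and k: "k < n"
  shows "expectation (T (u 0) (u n)) * expectation (slow m k) + expectation (slow m k)
    \<le> expectation (\<lambda>\<omega>. T (u 0) (u n) \<omega> * slow m k \<omega>)"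
proof -
  let ?U = "T (u 0) (u k)" and ?V = "T (u (Suc k)) (u n)" and ?S = "slow m k"
  note sq = sq_integrable_T_u[of 0 k] sq_integrable_T_u[of "Suc k" n] sq_integrable_slow[of m k]
  have sqs: "sq_integrable ?U" "sq_integrable ?V" "sq_integrable ?S" using sq k by auto
  note i = sqs[THEN sq_integrable_integrable]
  have "T (u 0) (u n) = (\<lambda>\<omega>. ?U \<omega> + ?V \<omega> + gap 0 k n \<omega>)" by (auto simp: gap_def)
  then have "expectation (T (u 0) (u n)) = expectation ?U + expectation ?V
      + expectation (gap 0 k n)"
    using i sq_integrable_integrable[OF gap_bounds(1)[of 0 k n]] k by simp
  then have ET: "expectation (T (u 0) (u n)) \<le> expectation ?U + expectation ?V + C"
    using gap_bounds(3)[of 0 k n] k by simp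
  have US: "expectation (\<lambda>\<omega>. ?U \<omega> * ?S \<omega>) = expectation ?U * expectation ?S"
    using strip_disjoint[of "u k" "u k" f "u 0" "u (Suc k)"] strip_edges_Z2
    by (intro indep_var_lebesgue_integral i indep_var_based[OF based_on_T based_on_slow]) auto
  have "indep_var borel ?V borel ?S"
    using strip_disjoint[of "u (Suc k)" "u (Suc k)" f "u k" "u n"] strip_edges_Z2
    by (intro indep_var_based[OF based_on_T based_on_slow]) auto
  then have VS: "expectation (\<lambda>\<omega>. ?V \<omega> * ?S \<omega>) = expectation ?V * expectation ?S"
    by (intro indep_var_lebesgue_integral i)
  have S0: "0 \<le> expectation ?S" by (simp add: expectation_slow)
  have "expectation (T (u 0) (u n)) * expectation ?S + expectation ?S
      \<le> (expectation ?U + expectation ?V + C) * expectation ?S + expectation ?S"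
    using ET S0 by (intro add_mono mult_right_mono) auto
  also have "\<dots> = expectation ?U * expectation ?S + expectation ?V * expectation ?S + (C
      + 1) * expectation ?S"
    by (simp add: algebra_simps)
  also have "\<dots> \<le> expectation ?U * expectation ?S + expectation ?V * expectation ?S
      + (\<delta> * real m) * expectation ?S"
    using m S0 by (intro add_left_mono mult_right_mono)
  also have "\<dots> = expectation (\<lambda>\<omega>. ?U \<omega> * ?S \<omega> + ?V \<omega> * ?S \<omega> + \<delta> * real m * ?S \<omega>)"
    using US VS i sq_integrable_mult[OF sqs(1,3)] sq_integrable_mult[OF sqs(2,3)] by simp
  also have "\<dots> \<le> expectation (\<lambda>\<omega>. T (u 0) (u n) \<omega> * ?S \<omega>)"
  proof (intro integral_mono)
    show "integrable M (\<lambda>\<omega>. ?U \<omega> * ?S \<omega> + ?V \<omega> * ?S \<omega> + \<delta> * real m * ?S \<omega>)"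
      using i sq_integrable_mult[OF sqs(1,3)] sq_integrable_mult[OF sqs(2,3)] by simp
    show "integrable M (\<lambda>\<omega>. T (u 0) (u n) \<omega> * ?S \<omega>)"
      using sqs(3) by (intro sq_integrable_mult sq_integrable_T_u) auto
    fix \<omega>
    show "?U \<omega> * ?S \<omega> + ?V \<omega> * ?S \<omega> + \<delta> * real m * ?S \<omega> \<le> T (u 0) (u n) \<omega> * ?S \<omega>"
    proof (cases "m \<le> B (u k) (u (Suc k)) \<omega>")
      case True
      have "\<delta> * real m \<le> \<delta> * real (B (u k) (u (Suc k)) \<omega>)" using True \<delta>_pos by simp
      also have "\<dots> \<le> T (u k) (u (Suc k)) \<omega>" using u_nonneg u_le by (intro T_ge_B) auto
      also have "\<dots> \<le> gap 0 k n \<omega>" using k by (intro gap_nonneg) auto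
      finally show ?thesis using True by (simp add: slow_def gap_def)
    qed (simp add: slow_def)
  qed
  finally show ?thesis .
qed

text \<open>With \<open>P\<close> the mean of the count \<open>S\<close>, the covariance of
  \<open>T\<close> and \<open>S\<close> is at least \<open>P\<close>, while the variance of
  \<open>S\<close>, a sum of independent indicators, is at most \<open>P\<close>. Nonnegativity of
  the variance of \<open>T - S\<close> thus leaves at least \<open>2 * P - P\<close> for the
  variance of \<open>T\<close>.\<close>

lemma variance_T_ge:
  assumes m: "C + 1 \<le> \<delta> * real m" and \<kappa>: "\<And>k. \<kappa> \<le> expectation (slow m k)"
  shows "\<kappa> * real n \<le> variance (T (u 0) (u n))"
proof -
  let ?T = "T (u 0) (u n)"
  define S where "S = (\<lambda>n \<omega>. \<Sum>k<n. slow m k \<omega>)"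
  define P where "P = (\<lambda>n. \<Sum>k<n. expectation (slow m k))"
  have S_Suc: "S (Suc n) = (\<lambda>\<omega>. S n \<omega> + slow m n \<omega>)" for n by (simp add: S_def)
  have bS: "based_on (\<Union>k<n. strip f (u k) (u (Suc k))) borel (S n)" for n
  proof (induction n)
    case 0
    show ?case by (rule based_onI[of "\<lambda>_. 0"]) (auto simp: S_def)
  next
    case (Suc n)
    show ?case unfolding S_Suc
    proof (rule based_on_add)
      show "based_on (\<Union>k<Suc n. strip f (u k) (u (Suc k))) borel (S n)"
        by (rule based_on_mono[OF Suc], rule UN_mono) auto
      show "based_on (\<Union>k<Suc n. strip f (u k) (u (Suc k))) borel (slow m n)"
        by (rule based_on_mono[OF based_on_slow], rule UN_upper) simp
    qed
  qed
  have sqS: "sq_integrable (S n)" for n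
  proof (induction n)
    case 0
    show ?case unfolding S_def using sq_integrable_const[of 0] by simp
  next
    case (Suc n)
    then show ?case unfolding S_Suc by (intro sq_integrable_add sq_integrable_slow)
  qed
  have VS: "variance (S n) \<le> P n" for n
  proof (induction n)
    case 0
    show ?case by (simp add: S_def P_def)
  next
    case (Suc n)
    have d: "(\<Union>k<n. strip f (u k) (u (Suc k))) \<inter> strip f (u n) (u (Suc n)) = {}"
      using strip_disjoint u_le by (simp add: UN_extend_simps)
    have e: "(\<Union>k<n. strip f (u k) (u (Suc k))) \<subseteq> edges_Z2" using strip_edges_Z2 by blast
    have "variance (S (Suc n)) = variance (S n) + variance (slow m n)"
      unfolding S_Suc
      by (intro variance_add_indep sqS sq_integrable_slow indep_var_based[OF bS based_on_slow d
          e strip_edges_Z2])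
    moreover have "variance (slow m n) \<le> expectation (slow m n)"
    proof -
      have "(\<lambda>\<omega>. (slow m n \<omega>)\<^sup>2) = slow m n" by (auto simp: slow_def)
      then show ?thesis using variance_le_second_moment[OF sq_integrable_slow[of m n]] by simp
    qed
    ultimately show ?case using Suc by (simp add: P_def)
  qed
  have sqT: "sq_integrable ?T" by (rule sq_integrable_T_u) simp
  have ES: "expectation (S n) = P n"
    unfolding S_def P_def using sq_integrable_integrable[OF sq_integrable_slow]
        by (intro Bochner_Integration.integral_sum) auto
  have cov: "expectation ?T * P n + P n \<le> expectation (\<lambda>\<omega>. ?T \<omega> * S n \<omega>)"
  proof -
    have "expectation ?T * P n + P n = (\<Sum>k<n. expectation ?T * expectation (slow m k)
        + expectation (slow m k))"
      by (simp add: P_def sum.distrib sum_distrib_left)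
    also have "\<dots> \<le> (\<Sum>k<n. expectation (\<lambda>\<omega>. ?T \<omega> * slow m k \<omega>))"
      using covariance_slow_ge[OF m] by (intro sum_mono) auto
    also have "\<dots> = expectation (\<lambda>\<omega>. \<Sum>k<n. ?T \<omega> * slow m k \<omega>)"
      using sq_integrable_mult[OF sqT sq_integrable_slow]
          by (intro Bochner_Integration.integral_sum[symmetric]) auto
    finally show ?thesis by (simp add: S_def sum_distrib_left)
  qed
  have "0 \<le> variance (\<lambda>\<omega>. ?T \<omega> + - 1 * S n \<omega>)" by (rule variance_positive)
  also have "\<dots> = variance ?T + variance (S n) - 2 * (expectation (\<lambda>\<omega>. ?T \<omega> * S n \<omega>) - expectation
      ?T * P n)"
    unfolding variance_sum_eq[OF sqT sq_integrable_cmult[OF sqS], of "-1"]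
        variance_cmult ES[symmetric]
    by (simp add: algebra_simps)
  finally have "P n \<le> variance ?T" using VS[of n] cov by simp
  moreover have "\<kappa> * real n \<le> P n" unfolding P_def
      using sum_mono[of "{..<n}" "\<lambda>_. \<kappa>" "\<lambda>k. expectation (slow m k)"] \<kappa>
    by (simp add: mult.commute)
  ultimately show ?thesis by simp
qed

end


section \<open>From the blocks to the passage time from column 0\<close>

lemma (in prob_space) variance_add_le:
  assumes X: "sq_integrable X" and Y: "sq_integrable Y"
  shows "variance (\<lambda>\<omega>. X \<omega> + Y \<omega>) \<le> 2 * variance X + 2 * expectation (\<lambda>\<omega>. (Y \<omega>)\<^sup>2)"
proof -
  have "0 \<le> variance (\<lambda>\<omega>. X \<omega> + - 1 * Y \<omega>)" by (rule variance_positive)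
  also have "\<dots> = variance X + variance Y - 2 * (expectation (\<lambda>\<omega>. X \<omega> * Y \<omega>) - expectation X
      * expectation Y)"
    unfolding variance_sum_eq[OF X sq_integrable_cmult[OF Y], of "-1"] variance_cmult
        by (simp add: algebra_simps)
  finally show ?thesis
    using variance_sum_eq[OF X Y] variance_le_second_moment[OF Y] by simp
qed

lemma square_sum3_le: "(a + b + c)\<^sup>2 \<le> 3 * (a\<^sup>2 + b\<^sup>2 + c\<^sup>2)" for a b c :: real
proof -
  have "0 \<le> (a - b)\<^sup>2 + (b - c)\<^sup>2 + (a - c)\<^sup>2" by simp
  also have "\<dots> = 3 * (a\<^sup>2 + b\<^sup>2 + c\<^sup>2) - (a + b + c)\<^sup>2"
    by (simp add: power2_eq_square algebra_simps)
  finally show ?thesis by simp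
qed

context fpp_blocks
begin

text \<open>The columns before \<open>u 0\<close> need not satisfy the uniform bounds. The long
  passage starts in column 0 itself, so a crossing is sought on the right only. The bound involves
  \<open>b\<close>, which depends on the graph, and will enter additive errors only.\<close>

lemma initial_gap:
  assumes init: "\<And>j. expectation (\<lambda>\<omega>. real (B 0 (u j) \<omega>)) \<le> b + K * real j" and b: "0 \<le> b"
  shows "(\<integral>\<^sup>+\<omega>. ennreal ((T 0 (u j) \<omega> - T (u 0) (u j) \<omega>)\<^sup>2) \<partial>M) \<le> ennreal (gap_const (b + 2 * K) \<rho>)"
proof -
  define H where "H = (\<lambda>l Q. \<forall>i<l. \<not> crossing f (u (2 * i)) (u (Suc (2 * i))) Q)"
  let ?I = "\<lambda>l. slab f (u 0) (u (2 * l))"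
  show ?thesis
  proof (rule gap_second_moment[where a = "\<lambda>_. 0" and b = "\<lambda>l. u (Suc (2 * l))" and H = H and I
      = ?I])
    show "0 \<le> u (Suc (2 * l))" for l by (rule u_nonneg)
    show "1 \<le> b + 2 * K" "0 < \<rho>" "\<rho> < 1" using K \<rho> b by auto
    show "expectation (\<lambda>\<omega>. real (B 0 (u (Suc (2 * l))) \<omega>)) \<le> (b + 2 * K) * (real l + 1)" for l
    proof -
      have "b * 1 \<le> b * (real l + 1)" using b by (intro mult_left_mono) auto
      then have "b + K * real (Suc (2 * l)) \<le> (b + 2 * K) * (real l + 1)"
        using K by (simp add: algebra_simps)
      then show ?thesis using init[of "Suc (2 * l)"] by linarith
    qed
    show "finite (?I l)" "?I l \<subseteq> edges_Z2" for l using finite_slab slab_edges_Z2 by auto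
    show "H l Q = H l (Q \<inter> ?I l)" for l Q
    proof -
      have "crossing f (u (2 * i)) (u (Suc (2 * i))) Q
          = crossing f (u (2 * i)) (u (Suc (2 * i))) (Q \<inter> ?I l)"
        if "i < l" for i using that u_le by (intro crossing_local slab_mono) auto
      then show ?thesis by (simp add: H_def)
    qed
    show "H 0 Q" for Q by (simp add: H_def)
    show "prob {\<omega> \<in> space M. H l (closed_edges \<omega>)} \<le> 2 * \<rho> ^ l" for l
    proof -
      have "prob {\<omega> \<in> space M. H l (closed_edges \<omega>)} \<le> \<rho> ^ l"
        using prob_no_crossing_right[of l 0] by (simp add: H_def)
      also have "\<dots> \<le> 2 * \<rho> ^ l" using \<rho> by simp
      finally show ?thesis .
    qed
    show "(\<lambda>\<omega>. T 0 (u j) \<omega> - T (u 0) (u j) \<omega>) \<in> borel_measurable M" by measurable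
    show "0 \<le> T 0 (u j) \<omega> - T (u 0) (u j) \<omega>" for \<omega>
      using T_mono[of 0 "u 0" "u j" "u j" \<omega>] u_0 u_le[of 0 j] by simp
    show "T 0 (u j) \<omega> - T (u 0) (u j) \<omega> \<le> T 0 (u (Suc (2 * l))) \<omega>"
        if nH: "\<not> H (Suc l) (closed_edges \<omega>)" for l \<omega>
    proof -
      from nH obtain i where i: "i \<le> l" "crossing f (u (2 * i)) (u (Suc (2 * i))) (closed_edges \<omega>)"
        by (auto simp: H_def less_Suc_eq_le)
      let ?b' = "min (u j) (u (Suc (2 * l)))"
      have R: "?b' = u j \<or> (\<exists>c d. u 0 \<le> c \<and> d \<le> ?b' \<and> crossing f c d (closed_edges \<omega>))"
      proof (cases "u j \<le> u (Suc (2 * l))")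
        case False
        then have b: "?b' = u (Suc (2 * l))" by simp
        show ?thesis unfolding b using i u_le
          by (intro disjI2 exI[of _ "u (2 * i)"] exI[of _ "u (Suc (2 * i))"]) auto
      qed auto
      \<comment> \<open>Gluing with a degenerate left piece: the first three columns of the gluing
        lemma are all 0.\<close>
      have "T 0 (u j) \<omega> \<le> T 0 0 \<omega> + T 0 ?b' \<omega> + T (u 0) (u j) \<omega>"
        using u_0 u_le by (intro T_glue R) auto
      moreover have "T 0 ?b' \<omega> \<le> T 0 (u (Suc (2 * l))) \<omega>"
        using u_nonneg by (intro T_mono) auto
      ultimately show ?thesis using T_same[of 0 \<omega>] by simp
    qed
  qed simp
qed

text \<open>Apart from the initial stretch the difference is bounded by the gaps of two final
  blocks, each with an empty right part. The window has two blocks because \<open>iota\<close>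
  locates a column only up to a pair of blocks.\<close>

lemma comparison:
  assumes init: "\<And>j. expectation (\<lambda>\<omega>. real (B 0 (u j) \<omega>)) \<le> b + K * real j" and b: "0 \<le> b"
    and x: "u n \<le> x" "x \<le> u (n + 2)"
  defines "D \<equiv> 3 * (gap_const (b + 2 * K) \<rho> + 2 * C\<^sup>2)"
  shows "expectation (\<lambda>\<omega>. (T 0 x \<omega> - T (u 0) (u n) \<omega>)\<^sup>2) \<le> D"
    and "T (u 0) (u n) \<omega> \<le> T 0 x \<omega>"
proof -
  have x0: "0 \<le> x" using x(1) u_nonneg[of n] by simp
  let ?I = "\<lambda>\<omega>. T 0 (u (n + 2)) \<omega> - T (u 0) (u (n + 2)) \<omega>"
  have mI: "?I \<in> borel_measurable M" by measurable
  have g0: "0 \<le> gap_const (b + 2 * K) \<rho>" by (rule gap_const_nonneg[OF \<rho>])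
  note I = sq_integrable_nn_integral[OF mI initial_gap[OF init b] g0]
  let ?D = "\<lambda>\<omega>. T 0 x \<omega> - T (u 0) (u n) \<omega>"
  have le: "T (u 0) (u n) \<omega> \<le> T 0 x \<omega>" for \<omega>
    using x x0 u_0 u_le[of 0 n] by (intro T_mono) auto
  then show "T (u 0) (u n) \<omega> \<le> T 0 x \<omega>" .
  have up: "?D \<omega> \<le> ?I \<omega> + gap 0 n (Suc n) \<omega> + gap 0 (Suc n) (n + 2) \<omega>" for \<omega>
  proof -
    have "T 0 x \<omega> \<le> T 0 (u (n + 2)) \<omega>" using x x0 by (intro T_mono) auto
    then show ?thesis using T_same[OF u_nonneg] by (simp add: gap_def)
  qed
  have "expectation (\<lambda>\<omega>. (?D \<omega>)\<^sup>2)
      \<le> expectation (\<lambda>\<omega>. 3 * ((?I \<omega>)\<^sup>2 + (gap 0 n (Suc n) \<omega>)\<^sup>2 + (gap 0 (Suc n) (n + 2) \<omega>)\<^sup>2))"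
  proof (rule integral_mono)
    show "integrable M (\<lambda>\<omega>. (?D \<omega>)\<^sup>2)"
      using sq_integrable_diff[OF sq_integrable_T[OF order_refl x0] sq_integrable_T_u[of 0 n]]
      by (simp add: sq_integrable_def)
    show "integrable M (\<lambda>\<omega>. 3 * ((?I \<omega>)\<^sup>2 + (gap 0 n (Suc n) \<omega>)\<^sup>2 + (gap 0 (Suc n) (n + 2) \<omega>)\<^sup>2))"
      using I(1) gap_bounds(1)[of 0 n "Suc n"] gap_bounds(1)[of 0 "Suc n" "n + 2"]
      by (simp add: sq_integrable_def)
    fix \<omega>
    have "(?D \<omega>)\<^sup>2 \<le> (?I \<omega> + gap 0 n (Suc n) \<omega> + gap 0 (Suc n) (n + 2) \<omega>)\<^sup>2"
      using le[of \<omega>] up[of \<omega>] by (intro power_mono) auto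
    also have "\<dots> \<le> 3 * ((?I \<omega>)\<^sup>2 + (gap 0 n (Suc n) \<omega>)\<^sup>2 + (gap 0 (Suc n) (n + 2) \<omega>)\<^sup>2)"
      by (rule square_sum3_le)
    finally show "(?D \<omega>)\<^sup>2 \<le> 3 * ((?I \<omega>)\<^sup>2 + (gap 0 n (Suc n) \<omega>)\<^sup>2 + (gap 0 (Suc n) (n + 2) \<omega>)\<^sup>2)" .
  qed
  also have "\<dots> = 3 * (expectation (\<lambda>\<omega>. (?I \<omega>)\<^sup>2) + expectation (\<lambda>\<omega>. (gap 0 n (Suc n) \<omega>)\<^sup>2)
      + expectation (\<lambda>\<omega>. (gap 0 (Suc n) (n + 2) \<omega>)\<^sup>2))"
    using I(1) gap_bounds(1)[of 0 n "Suc n"] gap_bounds(1)[of 0 "Suc n" "n + 2"]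
    by (simp add: sq_integrable_def)
  also have "\<dots> \<le> 3 * (gap_const (b + 2 * K) \<rho> + C\<^sup>2 + C\<^sup>2)"
    using I(2) gap_bounds(2)[of 0 n "Suc n"] gap_bounds(2)[of 0 "Suc n" "n + 2"]
    by (intro mult_left_mono add_mono) auto
  finally show "expectation (\<lambda>\<omega>. (?D \<omega>)\<^sup>2) \<le> D" by (simp add: D_def)
qed

text \<open>Replacing \<open>T (u 0) (u n)\<close> by \<open>T 0 x\<close> costs a factor 2 in the
  variance and an additive error. The coefficients of \<open>n\<close> are free of \<open>b\<close>,
  which appears in the error alone.\<close>

lemma linear_bounds:
  assumes init: "\<And>j. expectation (\<lambda>\<omega>. real (B 0 (u j) \<omega>)) \<le> b + K * real j" and b: "0 \<le> b"
    and m: "C + 1 \<le> \<delta> * real m" and \<kappa>: "\<And>k. \<kappa> \<le> prob {\<omega> \<in> space M. m \<le> B (u k) (u (Suc k)) \<omega>}"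
  shows "\<exists>D. \<forall>n x. 0 < n \<longrightarrow> u n \<le> x \<longrightarrow> x \<le> u (n + 2) \<longrightarrow>
      \<kappa> / 2 * real n - D \<le> variance (T 0 x) \<and> variance (T 0 x) \<le> 4 * ((2 + sqrt 2) * C)\<^sup>2 * real n
          + D \<and>
      \<delta> * \<kappa> * real n \<le> expectation (T 0 x) \<and> expectation (T 0 x) \<le> C * real n + D"
proof -
  define D0 where "D0 = 3 * (gap_const (b + 2 * K) \<rho> + 2 * C\<^sup>2)"
  have D0: "0 \<le> D0" using gap_const_nonneg[OF \<rho>, of "b + 2 * K"] by (simp add: D0_def)
  have \<kappa>m: "\<kappa> \<le> expectation (slow m k)" for k using \<kappa> by (simp add: expectation_slow)
  have "0 < m" using m C_pos \<delta>_pos by (cases m) auto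
  have \<kappa>1: "\<kappa> \<le> expectation (slow 1 k)" for k
  proof -
    have "expectation (slow m k) \<le> expectation (slow 1 k)"
      using sq_integrable_integrable[OF sq_integrable_slow] \<open>0 < m\<close>
      by (intro integral_mono) (auto simp: slow_def)
    then show ?thesis using \<kappa>m[of k] by linarith
  qed
  show ?thesis
  proof (intro exI[of _ "2 * D0 + sqrt D0"] allI impI)
    fix n :: nat and x assume n: "0 < n" and x: "u n \<le> x" "x \<le> u (n + 2)"
    note cmp = comparison[OF init b x, folded D0_def]
    have x0: "0 \<le> x" using x(1) u_nonneg[of n] by simp
    let ?X = "T (u 0) (u n)" and ?Y = "T 0 x"
    have sq: "sq_integrable ?X" "sq_integrable ?Y"
      using sq_integrable_T_u[of 0 n] sq_integrable_T[OF order_refl x0] by auto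
    have sqd: "sq_integrable (\<lambda>\<omega>. ?Y \<omega> - ?X \<omega>)" "sq_integrable (\<lambda>\<omega>. ?X \<omega> - ?Y \<omega>)"
      using sq by (auto intro: sq_integrable_diff)
    have sD: "0 \<le> sqrt D0" using D0 by simp
    have "variance ?Y \<le> 2 * variance ?X + 2 * D0"
      using variance_add_le[OF sq(1) sqd(1)] cmp(1) by simp
    then have 1: "variance ?Y \<le> 4 * ((2 + sqrt 2) * C)\<^sup>2 * real n + (2 * D0 + sqrt D0)"
      using variance_T_le[OF n] sD by linarith
    have "variance ?X \<le> 2 * variance ?Y + 2 * D0"
      using variance_add_le[OF sq(2) sqd(2)] cmp(1) by (simp add: power2_commute)
    then have 2: "\<kappa> / 2 * real n - (2 * D0 + sqrt D0) \<le> variance ?Y"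
      using variance_T_ge[OF m \<kappa>m, of n] sD D0 by linarith
    note i = sq[THEN sq_integrable_integrable]
    have "expectation ?X \<le> expectation ?Y" using i cmp(2) by (intro integral_mono)
    then have 3: "\<delta> * \<kappa> * real n \<le> expectation ?Y" using expectation_T_ge[OF \<kappa>1, of n] by linarith
    have "expectation (\<lambda>\<omega>. (?Y \<omega> - ?X \<omega>)\<^sup>2) \<le> (sqrt D0)\<^sup>2" using cmp(1) D0 by simp
    from expectation_le_sqrt[OF sqd(1) this sD]
    have "expectation (\<lambda>\<omega>. ?Y \<omega> - ?X \<omega>) \<le> sqrt D0" .
    then have 4: "expectation ?Y \<le> C * real n + (2 * D0 + sqrt D0)"
      using i expectation_T_le[of n] D0 by simp
    from 1 2 3 4 show "\<kappa> / 2 * real n - (2 * D0 + sqrt D0) \<le> variance ?Y \<and>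
        variance ?Y \<le> 4 * ((2 + sqrt 2) * C)\<^sup>2 * real n + (2 * D0 + sqrt D0) \<and>
        \<delta> * \<kappa> * real n \<le> expectation ?Y \<and> expectation ?Y \<le> C * real n + (2 * D0 + sqrt D0)"
      by blast
  qed
qed

end

section \<open>Transfer between the weight families\<close>

text \<open>Weights are nonnegative only almost surely, so on an exceptional set an infimum may run
  over an unbounded set. It then has a fixed value, which is enough for measurability.\<close>

lemma Inf_not_bdd_below:
  fixes X :: "real set"
  assumes "\<not> bdd_below X"
  shows "Inf X = Inf UNIV"
proof -
  have 1: "\<not> (\<forall>x \<in> uminus ` X. x \<le> z)" for z
    using assms by (auto simp: bdd_below_def) (metis minus_le_iff)
  have 2: "\<not> (\<forall>x \<in> uminus ` UNIV. x \<le> z)" for z :: real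
    by (auto intro!: exI[of _ "z + 1"])
  show ?thesis unfolding Inf_real_def Sup_real_def by (simp only: 1 2)
qed

lemma borel_measurable_INF_real:
  fixes g :: "'i \<Rightarrow> 'a \<Rightarrow> real"
  assumes I: "countable I" and g [measurable]: "\<And>i. i \<in> I \<Longrightarrow> g i \<in> borel_measurable M"
  shows "(\<lambda>\<omega>. INF i\<in>I. g i \<omega>) \<in> borel_measurable M"
proof -
  \<comment> \<open>Boundedness below is tested with countably many bounds, which makes
    \<open>S\<close> measurable.\<close>
  define S where "S = {\<omega> \<in> space M. \<exists>n::nat. \<forall>i\<in>I. - real n \<le> g i \<omega>}"
  have S [measurable]: "S \<in> sets M"
    unfolding S_def using I by measurable
  have bdd: "bdd_below ((\<lambda>i. g i \<omega>) ` I) \<longleftrightarrow> \<omega> \<in> S" if "\<omega> \<in> space M" for \<omega>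
  proof
    assume "bdd_below ((\<lambda>i. g i \<omega>) ` I)"
    then obtain c where "\<forall>i \<in> I. c \<le> g i \<omega>" by (auto simp: bdd_below_def)
    moreover obtain n :: nat where "- c \<le> real n" using real_arch_simple by blast
    ultimately show "\<omega> \<in> S" using that unfolding S_def by (auto intro!: exI[of _ n])
  qed (auto simp: S_def bdd_below_def)
  have "(\<lambda>\<omega>. INF i\<in>I. if \<omega> \<in> S then g i \<omega> else 0) \<in> borel_measurable M"
    using I
  proof (rule borel_measurable_cINF)
    show "bdd_below ((\<lambda>i. if \<omega> \<in> S then g i \<omega> else 0) ` I)" if "\<omega> \<in> space M" for \<omega>
      using bdd[OF that] by (cases "\<omega> \<in> S") (auto intro: bdd_belowI)
  qed measurable
  then have "(\<lambda>\<omega>. if \<omega> \<in> S then INF i\<in>I. if \<omega> \<in> S then g i \<omega> else 0 else Inf UNIV)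
      \<in> borel_measurable M"
    by measurable
  then show ?thesis
  proof (rule measurable_cong[THEN iffD1, rotated])
    fix \<omega> assume "\<omega> \<in> space M"
    then show "(if \<omega> \<in> S then INF i\<in>I. if \<omega> \<in> S then g i \<omega> else 0 else Inf UNIV) = (INF i\<in>I. g i \<omega>)"
      using bdd[of \<omega>] Inf_not_bdd_below[of "(\<lambda>i. g i \<omega>) ` I"] by auto
  qed
qed

context
  fixes f :: "real \<Rightarrow> real" and w :: "edge \<Rightarrow> 'a \<Rightarrow> real" and M :: "'a measure"
  assumes w: "\<And>e. e \<in> edges_Z2 \<Longrightarrow> w e \<in> borel_measurable M"
begin

lemma measurable_path_time: "is_path f xs \<Longrightarrow> (\<lambda>\<omega>. path_time (\<lambda>e. w e \<omega>) xs) \<in> borel_measurable M"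
proof -
  assume "is_path f xs"
  then have "set (path_edges xs) \<subseteq> edges_Z2" using edges_below_subset by (auto simp: is_path_def)
  moreover have "(\<lambda>\<omega>. sum_list (map (\<lambda>e. w e \<omega>) es)) \<in> borel_measurable M"
      if "set es \<subseteq> edges_Z2" for es
    using that by (induction es) (auto intro!: borel_measurable_add w)
  ultimately show ?thesis unfolding path_time_def by blast
qed

lemma measurable_passage_time: "(\<lambda>\<omega>. passage_time f (\<lambda>e. w e \<omega>) x y) \<in> borel_measurable M"
  unfolding passage_time_def by (intro borel_measurable_INF_real measurable_path_time) auto

lemma measurable_passage_time_to: "(\<lambda>\<omega>. passage_time_to f (\<lambda>e. w e \<omega>) x S) \<in> borel_measurable M"
  unfolding passage_time_to_def by (intro borel_measurable_INF_real measurable_passage_time) auto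

lemma measurable_passage_time_between: "(\<lambda>\<omega>. passage_time_between f (\<lambda>e. w e \<omega>) S S')
    \<in> borel_measurable M"
  unfolding passage_time_between_def by (intro borel_measurable_INF_real
      measurable_passage_time_to) auto

end

lemma countable_edges_Z2: "countable edges_Z2"
proof -
  have "edges_Z2 \<subseteq> (\<lambda>(x, y). {x, y}) ` UNIV" by (auto simp: edges_Z2_def)
  then show ?thesis by (rule countable_subset) simp
qed

section \<open>From the Bernoulli family to the closed edges of \<open>\<tau>\<close>\<close>

lemma (in below) strip_time_of_bool:
  assumes "0 \<le> a" "a \<le> b"
  shows "strip_time f (\<lambda>e. of_bool (e \<in> Q)) a b = real (btime f Q a b)"
proof -
  let ?S = "{A. A \<subseteq> strip f a b \<and> links A (column f a) (column f b)}"
  have fin: "finite ?S" by (rule finite_subset[of _ "Pow (strip f a b)"]) (auto simp: finite_strip)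
  have "real (btime f Q a b) = Min (real ` sum (\<lambda>e. of_bool (e \<in> Q)) ` ?S)"
    unfolding btime_def strip_time_def using fin strip_links[OF assms]
    by (intro mono_Min_commute) (auto simp: mono_def)
  then show ?thesis by (simp add: strip_time_def image_image)
qed

text \<open>The absolute value makes being closed the exact negation of
  \<open>t e \<omega> = 0\<close> at every \<open>\<omega>\<close>, also where
  \<open>t e \<omega>\<close> is neither 0 nor 1.\<close>

lemma (in prob_space) bernoulli_closed:
  assumes t: "iid_bernoulli_weights M t p"
  shows "indep_vars (\<lambda>_. borel) (\<lambda>e \<omega>. \<bar>t e \<omega>\<bar>) edges_Z2"
    and "e \<in> edges_Z2 \<Longrightarrow> prob {\<omega> \<in> space M. 0 < \<bar>t e \<omega>\<bar>} = 1 - p"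
    and "AE \<omega> in M. \<forall>e \<in> edges_Z2. t e \<omega> = 0 \<or> t e \<omega> = 1"
proof -
  have ind: "indep_vars (\<lambda>_. borel) t edges_Z2"
    and p: "\<And>e. e \<in> edges_Z2 \<Longrightarrow> prob {\<omega> \<in> space M. t e \<omega> = 0} = p"
      "\<And>e. e \<in> edges_Z2 \<Longrightarrow> prob {\<omega> \<in> space M. t e \<omega> = 1} = 1 - p"
    using t by (auto simp: iid_bernoulli_weights_def)
  have rv [measurable]: "random_variable borel (t e)" if "e \<in> edges_Z2" for e
    using ind that by (auto simp: indep_vars_def)
  show "indep_vars (\<lambda>_. borel) (\<lambda>e \<omega>. \<bar>t e \<omega>\<bar>) edges_Z2"
    by (rule indep_vars_compose2[OF ind]) simp
  show "prob {\<omega> \<in> space M. 0 < \<bar>t e \<omega>\<bar>} = 1 - p" if e: "e \<in> edges_Z2" for e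
  proof -
    have "{\<omega> \<in> space M. 0 < \<bar>t e \<omega>\<bar>} = {\<omega> \<in> space M. \<not> t e \<omega> = 0}" by auto
    moreover have "{\<omega> \<in> space M. t e \<omega> = 0} \<in> events" using rv[OF e] by measurable
    ultimately show ?thesis using prob_neg[of "\<lambda>\<omega>. t e \<omega> = 0"] p(1)[OF e] by simp
  qed
  have "AE \<omega> in M. t e \<omega> = 0 \<or> t e \<omega> = 1" if e: "e \<in> edges_Z2" for e
  proof -
    have [measurable]: "random_variable borel (t e)" by (rule rv[OF e])
    have "prob {\<omega> \<in> space M. t e \<omega> = 0 \<or> t e \<omega> = 1}
        = prob ({\<omega> \<in> space M. t e \<omega> = 0} \<union> {\<omega> \<in> space M. t e \<omega> = 1})"
      by (intro arg_cong[of _ _ prob]) auto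
    also have "\<dots> = p + (1 - p)" using p[OF e] by (subst finite_measure_Union) auto
    finally show ?thesis by (subst prob_Collect_eq_1[symmetric]) auto
  qed
  then show "AE \<omega> in M. \<forall>e \<in> edges_Z2. t e \<omega> = 0 \<or> t e \<omega> = 1"
    using countable_edges_Z2 by (subst AE_ball_countable) auto
qed

lemma crossing_iff_top_down:
  "crossing f (r i) (r (Suc i)) {e \<in> edges_Z2. 0 < \<bar>w e\<bar>} \<longleftrightarrow>
    (\<exists>xs. top_down_crossing f r i xs \<and> open_path w xs)"
  unfolding crossing_def
proof (intro ex_cong1)
  fix D
  have O: "set (path_edges D) \<inter> {e \<in> edges_Z2. 0 < \<bar>w e\<bar>} = {} \<longleftrightarrow> open_path w D" if "is_path f D"
  proof -
    have "set (path_edges D) \<subseteq> edges_Z2" using that edges_below_subset by (auto simp: is_path_def)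
    then show ?thesis by (auto simp: open_path_def)
  qed
  have R: "(\<forall>v \<in> set D. r i \<le> fst v \<and> fst v \<le> r (Suc i)) \<and>
      (fst (hd D), snd (hd D) + 1) \<notin> vertices_below f \<and> snd (last D) = 0 \<longleftrightarrow>
      set D \<subseteq> region f r i \<and> hd D \<in> {(x1, x2) \<in> region f r i. (x1, x2 + 1) \<notin> region f r i} \<and>
      last D \<in> {(x1, x2) \<in> region f r i. x2 = 0}" if D: "is_path f D"
  proof -
    have V: "set D \<subseteq> vertices_below f" and hl: "hd D \<in> set D" "last D \<in> set D"
      using D by (auto simp: is_path_def)
    have reg: "v \<in> region f r i \<longleftrightarrow> v \<in> vertices_below f \<and> r i \<le> fst v \<and> fst v \<le> r (Suc i)" for v
      by (auto simp: region_def)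
    have S: "set D \<subseteq> region f r i \<longleftrightarrow> (\<forall>v \<in> set D. r i \<le> fst v \<and> fst v \<le> r (Suc i))"
      using V by (auto simp: reg subset_iff)
    have H: "hd D \<in> {(x1, x2) \<in> region f r i. (x1, x2 + 1) \<notin> region f r i} \<longleftrightarrow>
        (fst (hd D), snd (hd D) + 1) \<notin> vertices_below f" if "set D \<subseteq> region f r i"
    proof -
      have "hd D \<in> region f r i" using that hl by auto
      then show ?thesis by (cases "hd D") (auto simp: reg)
    qed
    have L: "last D \<in> {(x1, x2) \<in> region f r i. x2 = 0} \<longleftrightarrow> snd (last D) = 0"
        if "set D \<subseteq> region f r i"
    proof -
      have "last D \<in> region f r i" using that hl by auto
      then show ?thesis by (cases "last D") auto
    qed
    show ?thesis
    proof (cases "set D \<subseteq> region f r i")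
      case True
      then show ?thesis unfolding H[OF True] L[OF True] S[symmetric] by simp
    next
      case False
      then show ?thesis unfolding S[symmetric] by simp
    qed
  qed
  show "(is_path f D \<and> (\<forall>v \<in> set D. r i \<le> fst v \<and> fst v \<le> r (Suc i)) \<and>
      (fst (hd D), snd (hd D) + 1) \<notin> vertices_below f \<and> snd (last D) = 0 \<and>
      set (path_edges D) \<inter> {e \<in> edges_Z2. 0 < \<bar>w e\<bar>} = {}) \<longleftrightarrow>
      top_down_crossing f r i D \<and> open_path w D"
    unfolding top_down_crossing_def using O R by satx
qed

context fpp
begin

text \<open>Both sides equal the same sum over the subsets of \<open>I\<close>; only the laws of the
  two families are compared.\<close>

lemma expectation_closed_edges_transfer:
  fixes \<phi> :: "edge set \<Rightarrow> real"
  assumes t: "iid_bernoulli_weights M t (1 - q)" and I: "finite I" "I \<subseteq> edges_Z2"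
    and \<phi>: "\<And>Q. \<phi> Q = \<phi> (Q \<inter> I)"
  shows "expectation (\<lambda>\<omega>. \<phi> {e \<in> edges_Z2. 0 < \<bar>t e \<omega>\<bar>}) = expectation (\<lambda>\<omega>. \<phi> (closed_edges \<omega>))"
proof -
  have r: "\<phi> {e \<in> edges_Z2. 0 < w e} = \<phi> {e \<in> I. 0 < w e}" for w :: "edge \<Rightarrow> real"
  proof -
    have "{e \<in> edges_Z2. 0 < w e} \<inter> I = {e \<in> I. 0 < w e}" using I by auto
    then show ?thesis using \<phi>[of "{e \<in> edges_Z2. 0 < w e}"] by simp
  qed
  have q: "\<And>e. e \<in> edges_Z2 \<Longrightarrow> prob {\<omega> \<in> space M. 0 < \<bar>t e \<omega>\<bar>} = q"
    using bernoulli_closed(2)[OF t] by simp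
  have "expectation (\<lambda>\<omega>. \<phi> {e \<in> edges_Z2. 0 < \<bar>t e \<omega>\<bar>}) = expectation (\<lambda>\<omega>. \<phi> {e \<in> I. 0 < \<bar>t e \<omega>\<bar>})"
    by (simp only: r)
  also have "\<dots> = (\<Sum>A\<in>Pow I. \<phi> A * (q ^ card A * (1 - q) ^ card (I - A)))"
    by (rule expectation_closed_set[OF bernoulli_closed(1)[OF t] q I])
  also have "\<dots> = expectation (\<lambda>\<omega>. \<phi> {e \<in> I. 0 < \<tau> e \<omega>})"
    by (rule expectation_closed_set[OF indep prob_pos I, symmetric])
  also have "\<dots> = expectation (\<lambda>\<omega>. \<phi> (closed_edges \<omega>))"
    unfolding closed_edges_def by (simp only: r)
  finally show ?thesis .
qed

lemma prob_closed_edges_transfer: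
  assumes t: "iid_bernoulli_weights M t (1 - q)" and I: "finite I" "I \<subseteq> edges_Z2"
    and P: "\<And>Q. P Q = P (Q \<inter> I)"
  shows "prob {\<omega> \<in> space M. P {e \<in> edges_Z2. 0 < \<bar>t e \<omega>\<bar>}} = prob {\<omega> \<in> space M. P (closed_edges \<omega>)}"
proof -
  have e: "expectation (\<lambda>\<omega>. of_bool (R \<omega>)) = prob {\<omega> \<in> space M. R \<omega>}" for R
  proof -
    have "expectation (\<lambda>\<omega>. of_bool (R \<omega>)) = expectation (indicator {\<omega> \<in> space M. R \<omega>})"
      by (intro Bochner_Integration.integral_cong) (auto simp: indicator_def)
    also have "\<dots> = prob ({\<omega> \<in> space M. R \<omega>} \<inter> space M)"
        by (rule Bochner_Integration.integral_indicator)
    also have "{\<omega> \<in> space M. R \<omega>} \<inter> space M = {\<omega> \<in> space M. R \<omega>}" by auto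
    finally show ?thesis .
  qed
  have "(of_bool (P Q) :: real) = of_bool (P (Q \<inter> I))" for Q using P[of Q] by simp
  from expectation_closed_edges_transfer[OF t I, of "\<lambda>Q. of_bool (P Q)", OF this]
  show ?thesis unfolding e .
qed

lemma prob_crossing_transfer:
  assumes t: "iid_bernoulli_weights M t (1 - q)"
  shows "prob {\<omega> \<in> space M. \<exists>xs. top_down_crossing f r i xs \<and> open_path (\<lambda>e. t e \<omega>) xs}
    = prob {\<omega> \<in> space M. crossing f (r i) (r (Suc i)) (closed_edges \<omega>)}"
  unfolding crossing_iff_top_down[symmetric]
  by (rule prob_closed_edges_transfer[OF t finite_slab slab_edges_Z2]) (rule
      crossing_local[OF subset_refl])

lemma bernoulli_passage_time:
  assumes w: "\<forall>e \<in> edges_Z2. w e = 0 \<or> w e = 1" and ab: "0 \<le> a" "a \<le> b"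
  shows "passage_time_between f w (vertical_line a) (vertical_line b)
    = real (btime f {e \<in> edges_Z2. 0 < \<bar>w e\<bar>} a b)"
proof -
  have w01: "w e = of_bool (e \<in> {e \<in> edges_Z2. 0 < \<bar>w e\<bar>})" if "e \<in> edges_Z2" for e
    using w that by auto
  have "passage_time_between f w (vertical_line a) (vertical_line b) = strip_time f w a b"
    using w edges_below_subset by (intro passage_time_between_eq ab) fastforce
  also have "\<dots> = strip_time f (\<lambda>e. of_bool (e \<in> {e \<in> edges_Z2. 0 < \<bar>w e\<bar>})) a b"
    using w01 strip_edges_Z2 by (intro strip_time_cong) blast
  also have "\<dots> = real (btime f {e \<in> edges_Z2. 0 < \<bar>w e\<bar>} a b)" by (rule strip_time_of_bool[OF ab])
  finally show ?thesis .
qed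

lemma measurable_bernoulli: "iid_bernoulli_weights M t p \<Longrightarrow> e \<in> edges_Z2
    \<Longrightarrow> random_variable borel (t e)"
  unfolding iid_bernoulli_weights_def indep_vars_def by auto

text \<open>Measurability is inherited from the passage time for the 0-1 weights that indicate the
  closed edges.\<close>

lemma btime_measurable_bernoulli:
  assumes t: "iid_bernoulli_weights M t (1 - q)" and ab: "0 \<le> a" "a \<le> b"
  shows "(\<lambda>\<omega>. real (btime f {e \<in> edges_Z2. 0 < \<bar>t e \<omega>\<bar>} a b)) \<in> borel_measurable M"
proof -
  have "(\<lambda>\<omega>. passage_time_between f (\<lambda>e. of_bool (0 < \<bar>t e \<omega>\<bar>)) (vertical_line a) (vertical_line
      b)) \<in> borel_measurable M"
  proof (rule measurable_passage_time_between)
    fix e assume "e \<in> edges_Z2"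
    from measurable_bernoulli[OF t this] have [measurable]: "random_variable borel (t e)" .
    show "(\<lambda>\<omega>. of_bool (0 < \<bar>t e \<omega>\<bar>)) \<in> borel_measurable M" by measurable
  qed
  moreover have "passage_time_between f (\<lambda>e. of_bool (0 < \<bar>t e \<omega>\<bar>)) (vertical_line a)
      (vertical_line b)
      = real (btime f {e \<in> edges_Z2. 0 < \<bar>t e \<omega>\<bar>} a b)" for \<omega>
    using bernoulli_passage_time[of "\<lambda>e. of_bool (0 < \<bar>t e \<omega>\<bar>)", OF _ ab] by simp
  ultimately show ?thesis by simp
qed

lemma prob_block_transfer:
  assumes t: "iid_bernoulli_weights M t (1 - q)" and ab: "0 \<le> a" "a \<le> b"
  shows "prob {\<omega> \<in> space M. real m \<le> passage_time_between f (\<lambda>e. t e \<omega>) (vertical_line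
      a) (vertical_line b)}
    = prob {\<omega> \<in> space M. m \<le> B a b \<omega>}"
proof -
  have meas: "{\<omega> \<in> space M. real m \<le> passage_time_between f (\<lambda>e. t e \<omega>) (vertical_line
      a) (vertical_line b)} \<in> events"
    using measurable_passage_time_between[OF measurable_bernoulli[OF t], where f = f and S
        = "vertical_line a" and S' = "vertical_line b"]
    by measurable
  have meas': "{\<omega> \<in> space M. real m \<le> real (btime f {e \<in> edges_Z2. 0 < \<bar>t e \<omega>\<bar>} a b)} \<in> events"
    using btime_measurable_bernoulli[OF t ab] by measurable
  have "AE \<omega> in M. (\<omega> \<in> {\<omega> \<in> space M. real m \<le> passage_time_between f (\<lambda>e. t e \<omega>) (vertical_line
      a) (vertical_line b)})
      = (\<omega> \<in> {\<omega> \<in> space M. real m \<le> real (btime f {e \<in> edges_Z2. 0 < \<bar>t e \<omega>\<bar>} a b)})"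
    using bernoulli_closed(3)[OF t] by eventually_elim (simp add: bernoulli_passage_time[OF _ ab])
  then have "prob {\<omega> \<in> space M. real m \<le> passage_time_between f (\<lambda>e. t e \<omega>) (vertical_line
      a) (vertical_line b)}
      = prob {\<omega> \<in> space M. real m \<le> real (btime f {e \<in> edges_Z2. 0 < \<bar>t e \<omega>\<bar>} a b)}"
    by (rule measure_eq_AE[OF _ meas meas'])
  also have "\<dots> = prob {\<omega> \<in> space M. real m \<le> real (btime f (closed_edges \<omega>) a b)}"
    by (rule prob_closed_edges_transfer[OF t finite_strip strip_edges_Z2])
      (subst btime_cong[OF subset_refl], rule refl)
  finally show ?thesis by (simp add: B_def)
qed

lemma expectation_transfer:
  assumes t: "iid_bernoulli_weights M t (1 - q)" and b: "0 \<le> b" and f0: "f 0 = 0"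
  shows "expectation (\<lambda>\<omega>. passage_time_to f (\<lambda>e. t e \<omega>) (0, 0) (vertical_line b))
    = expectation (\<lambda>\<omega>. real (B 0 b \<omega>))"
proof -
  have eq: "passage_time_to f w (0, 0) (vertical_line b)
      = passage_time_between f w (vertical_line 0) (vertical_line b)"
    if "\<forall>e \<in> edges_Z2. w e = 0 \<or> w e = 1" for w
  proof -
    have w: "0 \<le> w e" if "e \<in> edges_below f" for e
      using that \<open>\<forall>e \<in> edges_Z2. w e = 0 \<or> w e = 1\<close> edges_below_subset by fastforce
    show ?thesis using passage_time_to_eq[OF w f0 b] passage_time_between_eq[OF w order_refl b]
        by simp
  qed
  have "expectation (\<lambda>\<omega>. passage_time_to f (\<lambda>e. t e \<omega>) (0, 0) (vertical_line b))
      = expectation (\<lambda>\<omega>. real (btime f {e \<in> edges_Z2. 0 < \<bar>t e \<omega>\<bar>} 0 b))"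
  proof (rule integral_cong_AE)
    show "AE \<omega> in M. passage_time_to f (\<lambda>e. t e \<omega>) (0, 0) (vertical_line b)
        = real (btime f {e \<in> edges_Z2. 0 < \<bar>t e \<omega>\<bar>} 0 b)"
      using bernoulli_closed(3)[OF t] by eventually_elim (simp add: eq bernoulli_passage_time[OF
          _ order_refl b])
    show "(\<lambda>\<omega>. passage_time_to f (\<lambda>e. t e \<omega>) (0, 0) (vertical_line b)) \<in> borel_measurable M"
      by (rule measurable_passage_time_to[OF measurable_bernoulli[OF t]])
    show "(\<lambda>\<omega>. real (btime f {e \<in> edges_Z2. 0 < \<bar>t e \<omega>\<bar>} 0 b)) \<in> borel_measurable M"
      by (rule btime_measurable_bernoulli[OF t order_refl b])
  qed
  also have "\<dots> = expectation (\<lambda>\<omega>. real (btime f (closed_edges \<omega>) 0 b))"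
    by (rule expectation_closed_edges_transfer[OF t finite_strip strip_edges_Z2])
      (subst btime_cong[OF subset_refl], rule refl)
  finally show ?thesis by (simp add: B_def)
qed

end

section \<open>The asymptotic comparison\<close>

text \<open>Replacing \<open>k1\<close> by the smaller \<open>1 - \<rho>\<close>, \<open>K2\<close>
  by \<open>K2 + 1\<close> and \<open>k3\<close> by its half gives the room that turns limits
  inferior and superior into bounds for all late blocks. \<open>D\<close> is the constant
  \<open>C\<close> of the blocks, written so that its independence of \<open>f\<close> and
  \<open>r\<close> is visible.\<close>

lemma (in fpp) eventually_linear:
  fixes r :: "nat \<Rightarrow> int" and t :: "edge \<Rightarrow> 'a \<Rightarrow> real"
  assumes t: "iid_bernoulli_weights M t (1 - q)" and f0: "f 0 = 0"
    and r0: "r 0 = 0" and r: "strict_mono r"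
    and A1: "assumption_A1 M t f r k1" and A2: "assumption_A2 M t f r K2"
        and A3: "assumption_A3 M t f r k3"
    and k: "0 < k1" "1 \<le> K2" "0 < k3 (real m)"
  defines "\<rho> \<equiv> 1 - min (k1 / 2) (1 / 2)" and "D \<equiv> fpp_blocks.C q s (1 - min (k1 / 2) (1 / 2)) (K2
      + 1)"
  assumes m: "D + 1 \<le> \<delta> * real m"
  shows "\<forall>\<^sub>F n in sequentially. 0 < iota r n \<and>
      k3 (real m) / 4 * real (iota r n) \<le> variance (T 0 (int n)) \<and>
      variance (T 0 (int n)) \<le> (8 * ((2 + sqrt 2) * D)\<^sup>2 + 1) * real (iota r n) \<and>
      \<delta> * (k3 (real m) / 2) * real (iota r n) \<le> expectation (T 0 (int n)) \<and>
      expectation (T 0 (int n)) \<le> (2 * D + 1) * real (iota r n)"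
proof -
  define K where "K = K2 + 1"
  define \<kappa> where "\<kappa> = k3 (real m) / 2"
  have \<kappa>: "0 < \<kappa>" using k by (simp add: \<kappa>_def)
  have rle: "r i \<le> r j" if "i \<le> j" for i j using r that by (simp add: strict_mono_less_eq)
  have rnn: "0 \<le> r i" for i using rle[of 0 i] r0 by simp
  let ?e = "\<lambda>i. expectation (\<lambda>\<omega>. real (B 0 (r i) \<omega>))"
  have "\<forall>\<^sub>F i in sequentially. 1 - \<rho> \<le> prob {\<omega> \<in> space M. crossing f (r i) (r (Suc i))
      (closed_edges \<omega>)}"
  proof -
    have "ereal (1 - \<rho>) < ereal k1" using k by (auto simp: \<rho>_def min_def)
    also have "\<dots> \<le> liminf (\<lambda>i. ereal (prob {\<omega> \<in> space M. crossing f (r i) (r (Suc i))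
        (closed_edges \<omega>)}))"
      using A1 unfolding assumption_A1_def prob_crossing_transfer[OF t] .
    finally have "\<forall>\<^sub>F i in sequentially. ereal (1 - \<rho>) < ereal (prob {\<omega> \<in> space M. crossing f (r
        i) (r (Suc i)) (closed_edges \<omega>)})"
      by (rule less_LiminfD)
    then show ?thesis by eventually_elim simp
  qed
  moreover have "\<forall>\<^sub>F i in sequentially. ?e (Suc i) - ?e i \<le> K"
  proof -
    have "limsup (\<lambda>i. ereal (?e (Suc i) - ?e i)) \<le> ereal K2"
      using A2 unfolding assumption_A2_def expectation_transfer[OF t rnn f0] .
    also have "\<dots> < ereal K" by (simp add: K_def)
    finally have "\<forall>\<^sub>F i in sequentially. ereal (?e (Suc i) - ?e i) < ereal K" by (rule Limsup_lessD)
    then show ?thesis by eventually_elim simp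
  qed
  moreover have "\<forall>\<^sub>F i in sequentially. \<kappa> \<le> prob {\<omega> \<in> space M. m \<le> B (r i) (r (Suc i)) \<omega>}"
  proof -
    have "ereal \<kappa> < ereal (k3 (real m))" using k by (simp add: \<kappa>_def)
    also have "\<dots> \<le> liminf (\<lambda>i. ereal (prob {\<omega> \<in> space M. m \<le> B (r i) (r (Suc i)) \<omega>}))"
      using A3 unfolding assumption_A3_def prob_block_transfer[OF t rnn rle[OF
          le_SucI[OF order_refl]], symmetric] by simp
    finally have "\<forall>\<^sub>F i in sequentially. ereal \<kappa> < ereal (prob {\<omega> \<in> space M. m
        \<le> B (r i) (r (Suc i)) \<omega>})"
      by (rule less_LiminfD)
    then show ?thesis by eventually_elim simp
  qed
  ultimately have "\<forall>\<^sub>F i in sequentially. 1 - \<rho>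
      \<le> prob {\<omega> \<in> space M. crossing f (r i) (r (Suc i)) (closed_edges \<omega>)}
      \<and> ?e (Suc i) - ?e i \<le> K \<and> \<kappa> \<le> prob {\<omega> \<in> space M. m \<le> B (r i) (r (Suc i)) \<omega>}"
    by eventually_elim blast
  then obtain i1 where i1: "\<And>i. i1 \<le> i \<Longrightarrow> 1 - \<rho>
      \<le> prob {\<omega> \<in> space M. crossing f (r i) (r (Suc i)) (closed_edges \<omega>)}"
    "\<And>i. i1 \<le> i \<Longrightarrow> ?e (Suc i) - ?e i \<le> K"
    "\<And>i. i1 \<le> i \<Longrightarrow> \<kappa> \<le> prob {\<omega> \<in> space M. m \<le> B (r i) (r (Suc i)) \<omega>}"
    unfolding eventually_sequentially by blast
  define i0 where "i0 = 2 * i1"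
  define u where "u = (\<lambda>j. r (i0 + j))"
  have incr: "?e (i0 + j) \<le> ?e (i0 + i) + K * (real j - real i)" if "i \<le> j" for i j
    using that
  proof (induction j rule: dec_induct)
    case (step j)
    have "?e (Suc (i0 + j)) - ?e (i0 + j) \<le> K" by (rule i1(2)) (simp add: i0_def)
    then show ?case using step by (simp add: algebra_simps)
  qed simp
  interpret fpp_blocks f M \<tau> \<delta> q s u \<rho> K
  proof
    show "strict_mono u" using r by (auto simp: u_def strict_mono_def)
    show "0 \<le> u 0" by (simp add: u_def rnn)
    show "0 < \<rho>" "\<rho> < 1" using k by (auto simp: \<rho>_def)
    show "1 \<le> K" using k by (simp add: K_def)
    show "1 - \<rho> \<le> prob {\<omega> \<in> space M. crossing f (u j) (u (Suc j)) (closed_edges \<omega>)}" for j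
      using i1(1)[of "i0 + j"] by (simp add: u_def i0_def)
    show "expectation (\<lambda>\<omega>. real (B (u i) (u j) \<omega>)) \<le> K * (real j - real i)" if ij: "i \<le> j" for i j
    proof -
      have u: "0 \<le> u i" "u i \<le> u j" using rnn rle ij by (auto simp: u_def)
      have i: "integrable M (\<lambda>\<omega>. real (B 0 (u i) \<omega>))" "integrable M (\<lambda>\<omega>. real (B (u i) (u j) \<omega>))"
        "integrable M (\<lambda>\<omega>. real (B 0 (u j) \<omega>))" using u by (auto intro!: integrable_B)
      have "expectation (\<lambda>\<omega>. real (B 0 (u i) \<omega>)) + expectation (\<lambda>\<omega>. real (B (u i) (u j) \<omega>))
          = expectation (\<lambda>\<omega>. real (B 0 (u i) \<omega>) + real (B (u i) (u j) \<omega>))" using i by simp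
      also have "\<dots> \<le> expectation (\<lambda>\<omega>. real (B 0 (u j) \<omega>))"
      proof (rule integral_mono)
        fix \<omega>
        have "B 0 (u i) \<omega> + B (u i) (u j) \<omega> \<le> B 0 (u j) \<omega>"
          using B_superadditive[of 0 "u i" "u j" "u j" \<omega>] u by simp
        then show "real (B 0 (u i) \<omega>) + real (B (u i) (u j) \<omega>) \<le> real (B 0 (u j) \<omega>)"
          unfolding of_nat_add[symmetric] by (rule of_nat_mono)
      qed (use i in auto)
      finally show ?thesis using incr[OF ij] by (simp add: u_def)
    qed
  qed
  have D: "D = C" by (simp add: D_def \<rho>_def K_def)
  have init: "expectation (\<lambda>\<omega>. real (B 0 (u j) \<omega>)) \<le> ?e i0 + K * real j" for j
    using incr[of 0 j] by (simp add: u_def)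
  have slow: "\<kappa> \<le> prob {\<omega> \<in> space M. m \<le> B (u k) (u (Suc k)) \<omega>}" for k
    using i1(3)[of "i0 + k"] by (simp add: u_def i0_def)
  have e0: "0 \<le> ?e i0" by simp
  obtain E where E: "\<And>n x. 0 < n \<Longrightarrow> u n \<le> x \<Longrightarrow> x \<le> u (n + 2) \<Longrightarrow>
      \<kappa> / 2 * real n - E \<le> variance (T 0 x) \<and> variance (T 0 x) \<le> 4 * ((2 + sqrt 2) * C)\<^sup>2 * real n
          + E \<and>
      \<delta> * \<kappa> * real n \<le> expectation (T 0 x) \<and> expectation (T 0 x) \<le> C * real n + E"
    using linear_bounds[OF init e0 m[unfolded D] slow] by blast
  \<comment> \<open>Beyond this threshold the error \<open>E\<close> is at most \<open>iota\<close>,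
    and in the lower bound for the variance \<open>E\<close> and the shift by \<open>i0\<close>
    together use up at most half of \<open>\<kappa> * iota\<close>.\<close>
  obtain L :: nat where L: "real i0 + 3 + \<bar>E\<bar> + (\<kappa> * (real i0 + 2) / 2 + \<bar>E\<bar>) * 2 / \<kappa> \<le> real L"
    using real_arch_simple by blast
  have "\<forall>\<^sub>F n in sequentially. r (2 * L) < int n"
    unfolding eventually_sequentially by (rule exI[of _ "nat (r (2 * L))
        + 1"]) (auto simp: le_nat_iff)
  then show ?thesis
  proof eventually_elim
    case (elim n)
    define i where "i = iota r n"
    have rgrow: "int j \<le> r j" for j
    proof (induction j)
      case (Suc j)
      have "r j < r (Suc j)" using r by (simp add: strict_mono_less)
      then show ?case using Suc by simp
    qed (simp add: r0)
    have ge: "int n \<le> r (2 * i)" unfolding i_def iota_def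
      by (rule LeastI[of _ n]) (use rgrow[of "2 * n"] in simp)
    have less: "r (2 * j) < int n" if "j < i" for j
      using not_less_Least[of j "\<lambda>i. int n \<le> r (2 * i)"] that unfolding i_def iota_def by simp
    have Li: "L < i"
    proof (rule ccontr)
      assume "\<not> L < i"
      then have "r (2 * i) \<le> r (2 * L)" by (intro rle) simp
      then show False using ge elim by simp
    qed
    have quot: "0 \<le> (\<kappa> * (real i0 + 2) / 2 + \<bar>E\<bar>) * 2 / \<kappa>" using \<kappa> by simp
    then have big: "real i0 + 3 + \<bar>E\<bar> \<le> real i" "(\<kappa> * (real i0 + 2) / 2 + \<bar>E\<bar>) * 2 / \<kappa> \<le> real i"
      using L Li by linarith+
    have bigE: "\<kappa> * (real i0 + 2) / 2 + \<bar>E\<bar> \<le> \<kappa> / 2 * real i"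
      using big(2) \<kappa> by (simp add: field_simps)
    \<comment> \<open>By minimality of \<open>iota\<close>, the column \<open>n\<close> lies beyond
      \<open>r (2 * (i - 1))\<close> but not beyond \<open>r (2 * i)\<close>; these columns are
      \<open>u N\<close> and \<open>u (N + 2)\<close>.\<close>
    define N where "N = 2 * i - 2 - i0"
    have "i0 + 3 \<le> i" using big(1) by linarith
    then have N: "0 < N" "i0 + N = 2 * (i - 1)" "i0 + (N + 2) = 2 * i" "real N
        = 2 * real i - 2 - real i0"
      by (auto simp: N_def of_nat_diff)
    have x: "u N \<le> int n" "int n \<le> u (N + 2)"
      unfolding u_def N(2,3) using ge less[of "i - 1"] Li by auto
    note bounds = E[OF N(1) x]
    have "\<kappa> / 2 * real i \<le> \<kappa> / 2 * real N - E"
    proof -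
      have "\<kappa> / 2 * real N = 2 * (\<kappa> / 2 * real i) - \<kappa> * (real i0 + 2) / 2"
        unfolding N(4) by (simp add: field_simps)
      then show ?thesis using bigE abs_ge_self[of E] by linarith
    qed
    moreover have "4 * ((2 + sqrt 2) * C)\<^sup>2 * real N + E \<le> (8 * ((2 + sqrt 2) * C)\<^sup>2 + 1) * real i"
    proof -
      have "4 * ((2 + sqrt 2) * C)\<^sup>2 * real N \<le> 4 * ((2 + sqrt 2) * C)\<^sup>2 * (2 * real i)"
        by (intro mult_left_mono) (auto simp: N(4))
      then show ?thesis using big(1) by (simp add: algebra_simps)
    qed
    moreover have "\<delta> * \<kappa> * real i \<le> \<delta> * \<kappa> * real N"
      using \<kappa> \<delta>_pos big(1) by (intro mult_left_mono) (auto simp: N(4))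
    moreover have "C * real N + E \<le> (2 * C + 1) * real i"
    proof -
      have "C * real N \<le> C * (2 * real i)" using C_pos by (intro mult_left_mono) (auto simp: N(4))
      then show ?thesis using big(1) by (simp add: algebra_simps)
    qed
    moreover have k: "k3 (real m) / 4 = \<kappa> / 2" "k3 (real m) / 2 = \<kappa>" by (auto simp: \<kappa>_def)
    moreover have "0 < i" using Li by simp
    moreover from bounds have "\<kappa> / 2 * real N - E \<le> variance (T 0 (int n))"
      "variance (T 0 (int n)) \<le> 4 * ((2 + sqrt 2) * C)\<^sup>2 * real N + E"
      "\<delta> * \<kappa> * real N \<le> expectation (T 0 (int n))" "expectation (T 0 (int n)) \<le> C * real N + E"
      by blast+
    ultimately show ?case unfolding D i_def[symmetric] k by (intro conjI) linarith+
  qed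
qed

lemma asymp_leI:
  assumes "\<forall>\<^sub>F n in sequentially. g n \<le> h n \<and> 0 < h n"
  shows "asymp_le g h"
  unfolding asymp_le_def
proof (rule Limsup_bounded)
  show "\<forall>\<^sub>F n in sequentially. ereal (g n) / ereal (h n) \<le> 1"
    using assms by eventually_elim (simp add: one_ereal_def divide_le_eq_1)
qed

text \<open>\<open>V\<close> and \<open>E\<close> are both comparable with \<open>i\<close>, hence
  with each other: \<open>E \<le> C2 * i\<close> and \<open>c1 * i \<le> V\<close> give the ratio
  \<open>c1 / C2\<close>, while \<open>c2 * i \<le> E\<close> and \<open>V \<le> C1 * i\<close> give
  \<open>C1 / c2\<close>.\<close>

lemma asymp_le_pairs:
  fixes V E i :: "nat \<Rightarrow> real"
  assumes ev: "\<forall>\<^sub>F n in sequentially. 0 < i n \<and> c1 * i n \<le> V n \<and> V n \<le> C1 * i n \<and> c2 * i n \<le> E n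
      \<and> E n \<le> C2 * i n"
    and pos: "0 < c1" "0 < C1" "0 < c2" "0 < C2"
  defines "c \<equiv> min c1 (c1 / C2)" and "C \<equiv> max C1 (C1 / c2)"
  shows "asymp_le (\<lambda>n. c * i n) V \<and> asymp_le V (\<lambda>n. C * i n) \<and> asymp_le (\<lambda>n. c * E n) V
      \<and> asymp_le V (\<lambda>n. C * E n)"
proof -
  have c: "0 < c" "c \<le> c1" "c * C2 \<le> c1" and C: "0 < C" "C1 \<le> C" "C1 \<le> C * c2"
    using pos by (auto simp: c_def C_def min_def max_def field_simps)
  have "\<forall>\<^sub>F n in sequentially. c * i n \<le> V n \<and> 0 < V n \<and> V n \<le> C * i n \<and> 0 < C * i n \<and>
      c * E n \<le> V n \<and> V n \<le> C * E n \<and> 0 < C * E n"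
    using ev
  proof eventually_elim
    case (elim n)
    have p: "0 < c1 * i n" "0 < c2 * i n" using pos elim by auto
    have "c * i n \<le> c1 * i n" "C1 * i n \<le> C * i n" using c C elim by (auto intro!: mult_right_mono)
    moreover have "c * E n \<le> c1 * i n"
    proof -
      have "c * E n \<le> c * (C2 * i n)" using c elim by (intro mult_left_mono) auto
      also have "\<dots> \<le> c1 * i n" using c elim mult_right_mono[of "c * C2" c1 "i n"]
          by (simp add: mult.assoc)
      finally show ?thesis .
    qed
    moreover have "C1 * i n \<le> C * E n"
    proof -
      have "C1 * i n \<le> C * c2 * i n" using C elim by (intro mult_right_mono) auto
      also have "\<dots> \<le> C * E n" using C elim by (simp add: mult.assoc)
      finally show ?thesis .
    qed
    moreover have "0 < C * i n" "0 < C * E n" using C elim p by auto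
    ultimately show ?case using elim p by (intro conjI) linarith+
  qed
  then show ?thesis by (intro conjI asymp_leI) (auto elim: eventually_mono)
qed


section \<open>Modified weights, choice of the constants and conclusion\<close>

lemma second_moment_finite:
  fixes \<mu> :: "real measure"
  assumes "prob_space \<mu>" and [measurable_cong]: "sets \<mu> = sets borel" and "\<delta> > 0" "\<eta> > 2"
    and fin: "(\<integral>\<^sup>+x. ennreal (x powr \<eta>) \<partial>\<mu>) < \<infinity>"
  shows "(\<integral>\<^sup>+x. ennreal ((if \<delta> < x then x else 0)\<^sup>2) \<partial>\<mu>) < \<infinity>"
proof -
  interpret prob_space \<mu> by fact
  have "(\<integral>\<^sup>+x. ennreal ((if \<delta> < x then x else 0)\<^sup>2) \<partial>\<mu>) \<le> (\<integral>\<^sup>+x. 1 + ennreal (x powr \<eta>) \<partial>\<mu>)"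
  proof (rule nn_integral_mono)
    fix x :: real
    have "(if \<delta> < x then x else 0)\<^sup>2 \<le> 1 + x powr \<eta>"
    proof (cases "\<delta> < x \<and> 1 < x")
      case True
      then have "x\<^sup>2 = x powr 2" by (simp add: powr_numeral)
      also have "\<dots> \<le> x powr \<eta>" using True assms by (intro powr_mono) auto
      finally show ?thesis using True by simp
    next
      case False
      then have "(if \<delta> < x then x else 0)\<^sup>2 \<le> 1" using assms by (auto simp: power_le_one)
      then show ?thesis by (smt (verit) powr_ge_zero)
    qed
    then show "ennreal ((if \<delta> < x then x else 0)\<^sup>2) \<le> 1 + ennreal (x powr \<eta>)"
      by (simp add: ennreal_leI ennreal_1[symmetric] ennreal_plus[symmetric] del:
          ennreal_plus ennreal_1)
  qed
  also have "\<dots> = 1 + (\<integral>\<^sup>+x. ennreal (x powr \<eta>) \<partial>\<mu>)"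
    by (subst nn_integral_add) (auto simp: emeasure_space_1)
  also have "\<dots> < \<infinity>" using fin by simp
  finally show ?thesis .
qed

lemma (in prob_space) prob_le_cdf: "prob {\<omega> \<in> space M. X \<omega> \<le> x} = cdf (distr M borel X) x"
  if "random_variable borel X" for X :: "'a \<Rightarrow> real"
  using that by (simp add: cdf_def measure_distr vimage_def Int_def conj_commute)

theorem theorem1p5:
  fixes F :: "real \<Rightarrow> real" and p \<delta> \<eta> :: real
    and M :: "'a measure" and \<tau> t :: "edge \<Rightarrow> 'a \<Rightarrow> real"
    and k1 K2 :: real and k3 :: "real \<Rightarrow> real"
  assumes "distribution_function F"
    and "(F \<longlongrightarrow> 0) (at_left 0)"
    and "\<delta> > 0" and "F 0 = p" and "F \<delta> = p" and "1 / 2 \<le> p" and "p < 1"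
    and "\<eta> > 4" and "(\<integral>\<^sup>+x. ennreal (x powr \<eta>) \<partial>interval_measure F) < \<infinity>"
    and "prob_space M"
    and "iid_weights M \<tau> F"
    and "iid_bernoulli_weights M t p"
    and "k1 > 0" and "K2 \<ge> 1" and "\<And>m. m \<ge> 0 \<Longrightarrow> k3 m > 0"
  shows "\<exists>c > 0. \<exists>C > 0. \<forall>(f :: real \<Rightarrow> real) (r :: nat \<Rightarrow> int).
    (\<forall>x \<ge> 0. f x \<ge> 0) \<longrightarrow> f 0 = 0 \<longrightarrow> r 0 = 0 \<longrightarrow> strict_mono r \<longrightarrow>
    assumption_A1 M t f r k1 \<longrightarrow> assumption_A2 M t f r K2 \<longrightarrow> assumption_A3 M t f r k3 \<longrightarrow>
    (let T = (\<lambda>n \<omega>. passage_time_to f (\<lambda>e. \<tau> e \<omega>) (0, 0) (vertical_line (int n)));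
         ET = (\<lambda>n. prob_space.expectation M (T n));
         VarT = (\<lambda>n. prob_space.variance M (T n))
     in asymp_le (\<lambda>n. c * real (iota r n)) VarT \<and>
        asymp_le VarT (\<lambda>n. C * real (iota r n)) \<and>
        asymp_le (\<lambda>n. c * ET n) VarT \<and>
        asymp_le VarT (\<lambda>n. C * ET n))"
proof -
  interpret prob_space M by fact
  have F: "mono F" "\<And>x. continuous (at_right x) F" "(F \<longlongrightarrow> 0) at_bot" "(F \<longlongrightarrow> 1) at_top"
    using assms(1) by (auto simp: distribution_function_def)
  have ind: "indep_vars (\<lambda>_. borel) \<tau> edges_Z2" and cdf: "\<And>e. e \<in> edges_Z2
      \<Longrightarrow> cdf (distr M borel (\<tau> e)) = F"
    using assms(11) by (auto simp: iid_weights_def)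
  have rv: "random_variable borel (\<tau> e)" if "e \<in> edges_Z2" for e
    using ind that by (auto simp: indep_vars_def)
  define \<mu> where "\<mu> = interval_measure F"
  have distr: "distr M borel (\<tau> e) = \<mu>" if e: "e \<in> edges_Z2" for e
  proof -
    interpret D: real_distribution "distr M borel (\<tau> e)"
        by (rule real_distribution_distr[OF rv[OF e]])
    have "real_distribution \<mu>" unfolding \<mu>_def using F
        by (intro real_distribution_interval_measure) (auto simp: mono_def)
    moreover have "cdf \<mu> = F" unfolding \<mu>_def using F
        by (intro cdf_interval_measure) (auto simp: mono_def)
    ultimately show ?thesis using cdf_unique[OF D.real_distribution_axioms] cdf[OF e] by simp
  qed
  have le: "prob {\<omega> \<in> space M. \<tau> e \<omega> \<le> x} = F x" if "e \<in> edges_Z2" for e x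
    using prob_le_cdf[OF rv[OF that]] cdf[OF that] by simp
  \<comment> \<open>A version of the weights that is 0 or above \<open>\<delta>\<close> at every
    \<open>\<omega>\<close>, so that pathwise statements hold without exceptional sets.\<close>
  define \<tau>' where "\<tau>' = (\<lambda>e \<omega>. if \<delta> < \<tau> e \<omega> then \<tau> e \<omega> else 0)"
  define q where "q = 1 - p"
  define s where "s = enn2real (\<integral>\<^sup>+x. ennreal ((if \<delta> < x then x else 0)\<^sup>2) \<partial>\<mu>)"
  have eq_ae: "AE \<omega> in M. \<forall>e \<in> edges_Z2. \<tau> e \<omega> = \<tau>' e \<omega>"
  proof -
    have "AE \<omega> in M. \<tau> e \<omega> = \<tau>' e \<omega>" if e: "e \<in> edges_Z2" for e
    proof -
      note [measurable] = rv[OF e]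
      \<comment> \<open>\<open>F\<close> is monotone with left limit 0 at 0, so it vanishes at
        negative points; nonnegativity follows along a sequence increasing to 0.\<close>
      have "AE \<omega> in M. \<not> \<tau> e \<omega> \<le> - 1 / (real n + 1)" for n
      proof -
        have "F (- 1 / (real n + 1)) \<le> 0"
        proof (rule tendsto_lowerbound[OF assms(2)])
          have "\<forall>\<^sub>F y in at_left 0. - 1 / (real n + 1) < y"
            by (rule eventually_at_leftI[of "- 1 / (real n + 1)"]) auto
          then show "\<forall>\<^sub>F y in at_left 0. F (- 1 / (real n + 1)) \<le> F y"
            by eventually_elim (auto intro: monoD[OF F(1)])
        qed simp
        then have "prob {\<omega> \<in> space M. \<tau> e \<omega> \<le> - 1 / (real n + 1)} = 0"
          unfolding le[OF e] using le[OF e, of "- 1 / (real n + 1)"]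
              by (metis measure_nonneg order_antisym)
        then show ?thesis by (subst prob_Collect_eq_0[symmetric]) auto
      qed
      then have "AE \<omega> in M. \<forall>n. \<not> \<tau> e \<omega> \<le> - 1 / (real n + 1)" by (subst AE_all_countable) auto
      then have nonneg: "AE \<omega> in M. 0 \<le> \<tau> e \<omega>"
      proof eventually_elim
        case (elim \<omega>)
        show ?case
        proof (rule ccontr)
          assume "\<not> 0 \<le> \<tau> e \<omega>"
          then obtain n where "inverse (real (Suc n)) < - \<tau> e \<omega>"
              using reals_Archimedean[of "- \<tau> e \<omega>"] by auto
          then show False using elim[rule_format, of n] by (simp add: inverse_eq_divide add.commute)
        qed
      qed
      \<comment> \<open>Since \<open>F\<close> takes the same value at 0 and at
        \<open>\<delta>\<close>, no mass lies above 0 and up to \<open>\<delta>\<close>.\<close>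
      have "prob ({\<omega> \<in> space M. \<tau> e \<omega> \<le> \<delta>} - {\<omega> \<in> space M. \<tau> e \<omega> \<le> 0})
          = prob {\<omega> \<in> space M. \<tau> e \<omega> \<le> \<delta>} - prob {\<omega> \<in> space M. \<tau> e \<omega> \<le> 0}"
        using assms(3) by (intro finite_measure_Diff) auto
      also have "\<dots> = 0" using le[OF e] assms(4,5) by simp
      also have "{\<omega> \<in> space M. \<tau> e \<omega> \<le> \<delta>} - {\<omega> \<in> space M. \<tau> e \<omega> \<le> 0} = {\<omega> \<in> space M. 0 < \<tau> e \<omega>
          \<and> \<tau> e \<omega> \<le> \<delta>}"
        by auto
      finally have "AE \<omega> in M. \<not> (0 < \<tau> e \<omega> \<and> \<tau> e \<omega> \<le> \<delta>)"
          by (subst prob_Collect_eq_0[symmetric]) auto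
      with nonneg show ?thesis by eventually_elim (auto simp: \<tau>'_def)
    qed
    then show ?thesis using countable_edges_Z2 by (subst AE_ball_countable) auto
  qed
  have s: "(\<integral>\<^sup>+\<omega>. ennreal ((\<tau>' e \<omega>)\<^sup>2) \<partial>M) \<le> ennreal s" if e: "e \<in> edges_Z2" for e
  proof -
    have "(\<integral>\<^sup>+\<omega>. ennreal ((\<tau>' e \<omega>)\<^sup>2) \<partial>M) = (\<integral>\<^sup>+x. ennreal ((if \<delta> < x then x else 0)\<^sup>2) \<partial>distr
        M borel (\<tau> e))"
      using rv[OF e] by (subst nn_integral_distr) (auto simp: \<tau>'_def)
    moreover have "prob_space \<mu>" using prob_space_distr[OF rv[OF e]] distr[OF e] by simp
    then have "(\<integral>\<^sup>+x. ennreal ((if \<delta> < x then x else 0)\<^sup>2) \<partial>\<mu>) < \<infinity>"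
      using assms(3,8,9) by (intro second_moment_finite) (auto simp: \<mu>_def)
    ultimately show ?thesis by (simp add: distr[OF e] s_def)
  qed
  have loc: "fpp f M \<tau>' \<delta> q s" if "\<forall>x \<ge> 0. f x \<ge> 0" for f
  proof
    show "indep_vars (\<lambda>_. borel) \<tau>' edges_Z2" unfolding \<tau>'_def
      by (rule indep_vars_compose2[OF ind, where Y = "\<lambda>_ x. if \<delta> < x then x else 0"]) measurable
    show "prob {\<omega> \<in> space M. 0 < \<tau>' e \<omega>} = q" if e: "e \<in> edges_Z2" for e
    proof -
      have "{\<omega> \<in> space M. 0 < \<tau>' e \<omega>} = {\<omega> \<in> space M. \<not> \<tau> e \<omega> \<le> \<delta>}"
        using assms(3) by (auto simp: \<tau>'_def)
      moreover have "{\<omega> \<in> space M. \<tau> e \<omega> \<le> \<delta>} \<in> events" using rv[OF e] by measurable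
      ultimately show ?thesis using prob_neg[of "\<lambda>\<omega>. \<tau> e \<omega> \<le> \<delta>"] le[OF e, of \<delta>] assms(5)
          by (simp add: q_def)
    qed
  qed (use that assms(3,7) s in \<open>auto simp: q_def s_def \<tau>'_def\<close>)
  \<comment> \<open>These constants are fixed before \<open>f\<close> and \<open>r\<close> are
    introduced. The choice of \<open>m\<close> makes a slow block cost at least
    \<open>D + 1\<close>, whereas \<open>D\<close> bounds the mean of a gap.\<close>
  define \<rho> where "\<rho> = 1 - min (k1 / 2) (1 / 2)"
  define D where "D = fpp_blocks.C q s \<rho> (K2 + 1)"
  define m where "m = nat \<lceil>(D + 1) / \<delta>\<rceil>"
  have m: "D + 1 \<le> \<delta> * real m"
  proof -
    have "(D + 1) / \<delta> \<le> real m" unfolding m_def by (rule real_nat_ceiling_ge)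
    then show ?thesis using assms(3) by (simp add: field_simps)
  qed
  have k3: "0 < k3 (real m)" by (rule assms(15)) simp
  have t: "iid_bernoulli_weights M t (1 - q)" using assms(12) by (simp add: q_def)
  \<comment> \<open>The absolute value of \<open>D\<close> secures positivity here, where the blocks
    that give the positivity of \<open>D\<close> are not yet available.\<close>
  let ?c1 = "k3 (real m) / 4" and ?C1 = "8 * ((2 + sqrt 2) * D)\<^sup>2 + 1"
    and ?c2 = "\<delta> * (k3 (real m) / 2)" and ?C2 = "2 * \<bar>D\<bar> + 1"
  have pos: "0 < ?c1" "0 < ?C1" "0 < ?c2" "0 < ?C2"
    using k3 assms(3) by (auto intro: add_nonneg_pos)
  show ?thesis
  proof (intro exI conjI allI impI)
    show "0 < min ?c1 (?c1 / ?C2)" "0 < max ?C1 (?C1 / ?c2)" using pos by auto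
    fix f :: "real \<Rightarrow> real" and r :: "nat \<Rightarrow> int"
    assume f: "\<forall>x \<ge> 0. f x \<ge> 0" "f 0 = 0" and r: "r 0 = 0" "strict_mono r"
      and A: "assumption_A1 M t f r k1" "assumption_A2 M t f r K2" "assumption_A3 M t f r k3"
    interpret fpp f M \<tau>' \<delta> q s by (rule loc[OF f(1)])
    let ?T = "\<lambda>n \<omega>. passage_time_to f (\<lambda>e. \<tau> e \<omega>) (0, 0) (vertical_line (int n))"
    have T: "AE \<omega> in M. ?T n \<omega> = T 0 (int n) \<omega>" for n
      using eq_ae
    proof eventually_elim
      case (elim \<omega>)
      then have eq: "\<tau> e \<omega> = \<tau>' e \<omega>" if "e \<in> edges_below f" for e using that edges_below_subset
          by blast
      have "?T n \<omega> = strip_time f (\<lambda>e. \<tau> e \<omega>) 0 (int n)"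
        using eq weight_nonneg' by (intro passage_time_to_eq f(2)) auto
      also have "\<dots> = T 0 (int n) \<omega>" unfolding T_def using eq strip_subset
          by (intro strip_time_cong) blast
      finally show ?case .
    qed
    have mT: "?T n \<in> borel_measurable M" for n by (rule measurable_passage_time_to[OF rv])
    have ET: "expectation (?T n) = expectation (T 0 (int n))" for n
      by (rule integral_cong_AE[OF mT measurable_T T])
    have VT: "variance (?T n) = variance (T 0 (int n))" for n
    proof (rule integral_cong_AE)
      show "AE \<omega> in M. (?T n \<omega> - expectation (?T n))\<^sup>2
          = (T 0 (int n) \<omega> - expectation (T 0 (int n)))\<^sup>2"
        using T[of n] by eventually_elim (simp add: ET)
    qed (use mT measurable_T in measurable)
    have "\<forall>\<^sub>F n in sequentially. 0 < real (iota r n) \<and>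
        ?c1 * real (iota r n) \<le> variance (?T n) \<and> variance (?T n) \<le> ?C1 * real (iota r n) \<and>
        ?c2 * real (iota r n) \<le> expectation (?T n) \<and> expectation (?T n) \<le> ?C2 * real (iota r n)"
      using eventually_linear[OF t f(2) r A assms(13,14) k3 m[unfolded D_def \<rho>_def], folded
          \<rho>_def, folded D_def]
    proof eventually_elim
      case (elim n)
      have "(2 * D + 1) * real (iota r n) \<le> ?C2 * real (iota r n)" by (intro mult_right_mono) auto
      from order_trans[OF _ this] show ?case using elim unfolding VT unfolding ET by simp
    qed
    from asymp_le_pairs[OF this pos]
    show "let T = ?T; ET = (\<lambda>n. expectation (T n)); VarT = (\<lambda>n. variance (T n))
      in asymp_le (\<lambda>n. min ?c1 (?c1 / ?C2) * real (iota r n)) VarT \<and>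
         asymp_le VarT (\<lambda>n. max ?C1 (?C1 / ?c2) * real (iota r n)) \<and>
         asymp_le (\<lambda>n. min ?c1 (?c1 / ?C2) * ET n) VarT \<and>
         asymp_le VarT (\<lambda>n. max ?C1 (?C1 / ?c2) * ET n)"
      unfolding Let_def .
  qed
qed

end
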